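(* Let $\mathbf{CPM}$ be the category of completely positive maps with monoidal structure $\oplus$ and unit $0$. For $f:X\oplus U\to Y\oplus U$ in $\mathbf{CPM}$ with components $f_{11}:X\to Y$, $f_{12}:U\to Y$, $f_{21}:X\to U$, $f_{22}:U\to U$, declare $\widetilde{\mathrm{Tr}}^U_{X,Y}(f)$ to be defined if and only if (a) $I-f_{22}$ is invertible as a linear function, and (b) the inverse $(I-f_{22})^{-1}$ is a completely positive map; in that case put $$\widetilde{\mathrm{Tr}}^U_{X,Y}(f)=f_{11}+f_{12}(I-f_{22})^{-1}f_{21},$$ where $I$ is the identity on $U$. Then $(\mathbf{CPM},\oplus,0)$ with $\widetilde{\mathrm{Tr}}$ is a partially traced category.
   Context: For a finite dimensional Hilbert space $H$ let $\mathcal{L}(H)$ be the space of linear maps $H\to H$. A linear map $F:\mathcal{L}(H)\to\mathcal{L}(K)$ is completely positive if $F(\rho)=\sum_{i=1}^mF_i\rho F_i^\dagger$ for some linear $F_i:H\to K$. Objects of $\mathbf{CPM}$ are finite sequences $(H_1,\dots,H_n)$ of finite dimensional Hilbert spaces; a morphism $(H_1,\dots,H_n)\to(K_1,\dots,K_m)$ is a matrix $(F_{ij})$ of completely positive maps $F_{ij}:\mathcal{L}(H_j)\to\mathcal{L}(K_i)$, viewed also as a linear map $\bigoplus_j\mathcal{L}(H_j)\to\bigoplus_i\mathcal{L}(K_i)$; composition is matrix multiplication. "Completely positive map" in (b) means a morphism of $\mathbf{CPM}$. $\oplus$ is concatenation of sequences (a biproduct) and $0$ is the empty sequence. For partially defined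 expressions, $a\simeq b$ (Kleene equality) means that $a,b$ are either both undefined, or both defined and equal; $a\lesssim b$ means that either $a$ is undefined, or both are defined and equal. A partial trace on a symmetric monoidal category $(\mathcal{C},\otimes,I,\rho,\lambda,\sigma)$ is a family of partial functions $\mathrm{Tr}^U_{X,Y}:\mathcal{C}(X\otimes U,Y\otimes U)\rightharpoonup\mathcal{C}(X,Y)$ satisfying (associativity isomorphisms suppressed): - Naturality: for $f:X\otimes U\to Y\otimes U$, $g:X'\to X$, $h:Y\to Y'$: $h\,\mathrm{Tr}^U_{X,Y}(f)\,g\lesssim \mathrm{Tr}^U_{X',Y'}((h\otimes 1_U)f(g\otimes 1_U))$. - Dinaturality: for $f:X\otimes U\to Y\otimes U'$, $g:U'\to U$: $\mathrm{Tr}^U_{X,Y}((1_Y\otimes g)f)\simeq \mathrm{Tr}^{U'}_{X,Y}(f(1_X\otimes g))$. - Vanishing I: for $f:X\otimes I\to Y\otimes I$: $\mathrm{Tr}^I_{X,Y}(f)\simeq\rho_Y f\rho_X^{-1}$, where $\rho_X:X\otimes I\to X$. - Vanishing II: for $g:X\otimes U\otimes V\to Y\otimes U\otimes V$, if $\mathrm{Tr}^V_{X\otimes U,Y\otimes U}(g)$ is defined then $\mathrm{Tr}^{U\otimes V}_{X,Y}(g)\simeq\mathrm{Tr}^U_{X,Y}(\mathrm{Tr}^V_{X\otimes U,Y\otimes U}(g))$. - Superposing: for $f:X\otimes U\to Y\otimes U$, $g:W\to Z$: $g\otimes\mathrm{Tr}^U_{X,Y}(f)\lesssim\mathrm{Tr}^U_{W\otimes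 X,Z\otimes Y}(g\otimes f)$. - Yanking: $\mathrm{Tr}^U_{U,U}(\sigma_{U,U})\simeq 1_U$. A partially traced category is a symmetric monoidal category with a partial trace; here $\otimes$ is $\oplus$ and the unit is $0$. *)

theory Defs
  imports "Jordan_Normal_Form.VS_Connect"
begin

section \<open>Symmetric monoidal categories and partial traces\<close>

locale category =
  fixes obj :: "'o set"
    and hom :: "'o \<Rightarrow> 'o \<Rightarrow> 'm set"
    and comp :: "'m \<Rightarrow> 'm \<Rightarrow> 'm"  (infixr \<open>\<cdot>\<close> 65)
    and ident :: "'o \<Rightarrow> 'm"
  assumes hom_disjoint:
      "\<lbrakk>X \<in> obj; Y \<in> obj; X' \<in> obj; Y' \<in> obj; f \<in> hom X Y; f \<in> hom X' Y'\<rbrakk> \<Longrightarrow> X = X' \<and> Y = Y'"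
    and comp_in_hom:
      "\<lbrakk>X \<in> obj; Y \<in> obj; Z \<in> obj; f \<in> hom X Y; g \<in> hom Y Z\<rbrakk> \<Longrightarrow> g \<cdot> f \<in> hom X Z"
    and ident_in_hom: "X \<in> obj \<Longrightarrow> ident X \<in> hom X X"
    and comp_assoc:
      "\<lbrakk>W \<in> obj; X \<in> obj; Y \<in> obj; Z \<in> obj; f \<in> hom W X; g \<in> hom X Y; h \<in> hom Y Z\<rbrakk>
        \<Longrightarrow> (h \<cdot> g) \<cdot> f = h \<cdot> (g \<cdot> f)"
    and comp_ident_right: "\<lbrakk>X \<in> obj; Y \<in> obj; f \<in> hom X Y\<rbrakk> \<Longrightarrow> f \<cdot> ident X = f"
    and comp_ident_left: "\<lbrakk>X \<in> obj; Y \<in> obj; f \<in> hom X Y\<rbrakk> \<Longrightarrow> ident Y \<cdot> f = f"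
begin

definition is_inverse :: "'o \<Rightarrow> 'o \<Rightarrow> 'm \<Rightarrow> 'm \<Rightarrow> bool" where
  "is_inverse X Y f g \<longleftrightarrow>
     f \<in> hom X Y \<and> g \<in> hom Y X \<and> g \<cdot> f = ident X \<and> f \<cdot> g = ident Y"

definition is_iso :: "'o \<Rightarrow> 'o \<Rightarrow> 'm \<Rightarrow> bool" where
  "is_iso X Y f \<longleftrightarrow> (\<exists>g. is_inverse X Y f g)"

definition inverse_of :: "'o \<Rightarrow> 'o \<Rightarrow> 'm \<Rightarrow> 'm" where
  "inverse_of X Y f = (THE g. is_inverse X Y f g)"

end

locale symmetric_monoidal_category = category obj hom comp ident
  for obj :: "'o set"
    and hom :: "'o \<Rightarrow> 'o \<Rightarrow> 'm set"
    and comp :: "'m \<Rightarrow> 'm \<Rightarrow> 'm"  (infixr \<open>\<cdot>\<close> 65)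
    and ident :: "'o \<Rightarrow> 'm" +
  fixes tensor_obj :: "'o \<Rightarrow> 'o \<Rightarrow> 'o"  (infixr \<open>\<boxtimes>\<close> 75)
    and tensor :: "'m \<Rightarrow> 'm \<Rightarrow> 'm"  (infixr \<open>\<odot>\<close> 75)
    and unit :: 'o
    and assoc :: "'o \<Rightarrow> 'o \<Rightarrow> 'o \<Rightarrow> 'm"
    and lunit :: "'o \<Rightarrow> 'm"
    and runit :: "'o \<Rightarrow> 'm"
    and sym :: "'o \<Rightarrow> 'o \<Rightarrow> 'm"
  assumes tensor_obj_closed: "\<lbrakk>X \<in> obj; Y \<in> obj\<rbrakk> \<Longrightarrow> X \<boxtimes> Y \<in> obj"
    and unit_obj: "unit \<in> obj"
    and tensor_in_hom:
      "\<lbrakk>X \<in> obj; Y \<in> obj; X' \<in> obj; Y' \<in> obj; f \<in> hom X Y; g \<in> hom X' Y'\<rbrakk>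
        \<Longrightarrow> f \<odot> g \<in> hom (X \<boxtimes> X') (Y \<boxtimes> Y')"
    and tensor_ident: "\<lbrakk>X \<in> obj; Y \<in> obj\<rbrakk> \<Longrightarrow> ident X \<odot> ident Y = ident (X \<boxtimes> Y)"
    and tensor_comp:
      "\<lbrakk>X \<in> obj; Y \<in> obj; Z \<in> obj; X' \<in> obj; Y' \<in> obj; Z' \<in> obj;
        f \<in> hom X Y; g \<in> hom Y Z; f' \<in> hom X' Y'; g' \<in> hom Y' Z'\<rbrakk>
        \<Longrightarrow> (g \<cdot> f) \<odot> (g' \<cdot> f') = (g \<odot> g') \<cdot> (f \<odot> f')"
    and assoc_iso:
      "\<lbrakk>X \<in> obj; Y \<in> obj; Z \<in> obj\<rbrakk>
        \<Longrightarrow> is_iso ((X \<boxtimes> Y) \<boxtimes> Z) (X \<boxtimes> (Y \<boxtimes> Z)) (assoc X Y Z)"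
    and lunit_iso: "X \<in> obj \<Longrightarrow> is_iso (unit \<boxtimes> X) X (lunit X)"
    and runit_iso: "X \<in> obj \<Longrightarrow> is_iso (X \<boxtimes> unit) X (runit X)"
    and sym_in_hom: "\<lbrakk>X \<in> obj; Y \<in> obj\<rbrakk> \<Longrightarrow> sym X Y \<in> hom (X \<boxtimes> Y) (Y \<boxtimes> X)"
    and sym_inverse: "\<lbrakk>X \<in> obj; Y \<in> obj\<rbrakk> \<Longrightarrow> sym Y X \<cdot> sym X Y = ident (X \<boxtimes> Y)"
    and assoc_natural:
      "\<lbrakk>X \<in> obj; Y \<in> obj; Z \<in> obj; X' \<in> obj; Y' \<in> obj; Z' \<in> obj;
        f \<in> hom X X'; g \<in> hom Y Y'; h \<in> hom Z Z'\<rbrakk>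
        \<Longrightarrow> assoc X' Y' Z' \<cdot> ((f \<odot> g) \<odot> h) = (f \<odot> (g \<odot> h)) \<cdot> assoc X Y Z"
    and lunit_natural:
      "\<lbrakk>X \<in> obj; Y \<in> obj; f \<in> hom X Y\<rbrakk> \<Longrightarrow> lunit Y \<cdot> (ident unit \<odot> f) = f \<cdot> lunit X"
    and runit_natural:
      "\<lbrakk>X \<in> obj; Y \<in> obj; f \<in> hom X Y\<rbrakk> \<Longrightarrow> runit Y \<cdot> (f \<odot> ident unit) = f \<cdot> runit X"
    and sym_natural:
      "\<lbrakk>X \<in> obj; Y \<in> obj; X' \<in> obj; Y' \<in> obj; f \<in> hom X X'; g \<in> hom Y Y'\<rbrakk>
        \<Longrightarrow> sym X' Y' \<cdot> (f \<odot> g) = (g \<odot> f) \<cdot> sym X Y"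
    and pentagon:
      "\<lbrakk>W \<in> obj; X \<in> obj; Y \<in> obj; Z \<in> obj\<rbrakk>
        \<Longrightarrow> assoc W X (Y \<boxtimes> Z) \<cdot> assoc (W \<boxtimes> X) Y Z =
            (ident W \<odot> assoc X Y Z) \<cdot> assoc W (X \<boxtimes> Y) Z \<cdot> (assoc W X Y \<odot> ident Z)"
    and triangle:
      "\<lbrakk>X \<in> obj; Y \<in> obj\<rbrakk>
        \<Longrightarrow> (ident X \<odot> lunit Y) \<cdot> assoc X unit Y = runit X \<odot> ident Y"
    and hexagon:
      "\<lbrakk>X \<in> obj; Y \<in> obj; Z \<in> obj\<rbrakk>
        \<Longrightarrow> assoc Y Z X \<cdot> sym X (Y \<boxtimes> Z) \<cdot> assoc X Y Z =
            (ident Y \<odot> sym X Z) \<cdot> assoc Y X Z \<cdot> (sym X Y \<odot> ident Z)"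

text \<open>
  Partially defined values are options. Kleene equality of two of them is then plain equality;
  the directed version is the following.
\<close>

definition kleene_le :: "'b option \<Rightarrow> 'b option \<Rightarrow> bool"  (infix \<open>\<lesssim>\<close> 50) where
  "a \<lesssim> b \<longleftrightarrow> a = None \<or> (a \<noteq> None \<and> b \<noteq> None \<and> a = b)"

text \<open>
  In \<open>vanishing_II\<close> and \<open>superposing\<close> the associators, which one usually suppresses,
  are written out.
\<close>

locale partially_traced_category =
  symmetric_monoidal_category obj hom comp ident tensor_obj tensor unit assoc lunit runit sym
  for obj :: "'o set"
    and hom :: "'o \<Rightarrow> 'o \<Rightarrow> 'm set"
    and comp :: "'m \<Rightarrow> 'm \<Rightarrow> 'm"  (infixr \<open>\<cdot>\<close> 65)
    and ident :: "'o \<Rightarrow> 'm"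
    and tensor_obj :: "'o \<Rightarrow> 'o \<Rightarrow> 'o"  (infixr \<open>\<boxtimes>\<close> 75)
    and tensor :: "'m \<Rightarrow> 'm \<Rightarrow> 'm"  (infixr \<open>\<odot>\<close> 75)
    and unit :: 'o
    and assoc :: "'o \<Rightarrow> 'o \<Rightarrow> 'o \<Rightarrow> 'm"
    and lunit :: "'o \<Rightarrow> 'm"
    and runit :: "'o \<Rightarrow> 'm"
    and sym :: "'o \<Rightarrow> 'o \<Rightarrow> 'm" +
  fixes Tr :: "'o \<Rightarrow> 'o \<Rightarrow> 'o \<Rightarrow> 'm \<rightharpoonup> 'm"
  assumes trace_partial_function:
      "\<lbrakk>U \<in> obj; X \<in> obj; Y \<in> obj\<rbrakk>
        \<Longrightarrow> dom (Tr U X Y) \<subseteq> hom (X \<boxtimes> U) (Y \<boxtimes> U) \<and> ran (Tr U X Y) \<subseteq> hom X Y"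
    and naturality:
      "\<lbrakk>U \<in> obj; X \<in> obj; Y \<in> obj; X' \<in> obj; Y' \<in> obj;
        f \<in> hom (X \<boxtimes> U) (Y \<boxtimes> U); g \<in> hom X' X; h \<in> hom Y Y'\<rbrakk>
        \<Longrightarrow> map_option (\<lambda>t. h \<cdot> t \<cdot> g) (Tr U X Y f)
            \<lesssim> Tr U X' Y' ((h \<odot> ident U) \<cdot> f \<cdot> (g \<odot> ident U))"
    and dinaturality:
      "\<lbrakk>U \<in> obj; U' \<in> obj; X \<in> obj; Y \<in> obj; f \<in> hom (X \<boxtimes> U) (Y \<boxtimes> U'); g \<in> hom U' U\<rbrakk>
        \<Longrightarrow> Tr U X Y ((ident Y \<odot> g) \<cdot> f) = Tr U' X Y (f \<cdot> (ident X \<odot> g))"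
    and vanishing_I:
      "\<lbrakk>X \<in> obj; Y \<in> obj; f \<in> hom (X \<boxtimes> unit) (Y \<boxtimes> unit)\<rbrakk>
        \<Longrightarrow> Tr unit X Y f = Some (runit Y \<cdot> f \<cdot> inverse_of (X \<boxtimes> unit) X (runit X))"
    and vanishing_II:
      "\<lbrakk>U \<in> obj; V \<in> obj; X \<in> obj; Y \<in> obj;
        g \<in> hom ((X \<boxtimes> U) \<boxtimes> V) ((Y \<boxtimes> U) \<boxtimes> V); Tr V (X \<boxtimes> U) (Y \<boxtimes> U) g \<noteq> None\<rbrakk>
        \<Longrightarrow> Tr (U \<boxtimes> V) X Y
              (assoc Y U V \<cdot> g \<cdot> inverse_of ((X \<boxtimes> U) \<boxtimes> V) (X \<boxtimes> (U \<boxtimes> V)) (assoc X U V))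
            = Option.bind (Tr V (X \<boxtimes> U) (Y \<boxtimes> U) g) (Tr U X Y)"
    and superposing:
      "\<lbrakk>U \<in> obj; X \<in> obj; Y \<in> obj; W \<in> obj; Z \<in> obj;
        f \<in> hom (X \<boxtimes> U) (Y \<boxtimes> U); g \<in> hom W Z\<rbrakk>
        \<Longrightarrow> map_option (\<lambda>t. g \<odot> t) (Tr U X Y f)
            \<lesssim> Tr U (W \<boxtimes> X) (Z \<boxtimes> Y)
                (inverse_of ((Z \<boxtimes> Y) \<boxtimes> U) (Z \<boxtimes> (Y \<boxtimes> U)) (assoc Z Y U) \<cdot> (g \<odot> f) \<cdot> assoc W X U)"
    and yanking: "U \<in> obj \<Longrightarrow> Tr U U U (sym U U) = Some (ident U)"


section \<open>Finite dimensional Hilbert spaces\<close>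

text \<open>
  A Hilbert space is a complex vector space with explicit carrier together with an inner product,
  conjugate linear in the first and linear in the second argument. The multiplicative fields that
  every \<^type>\<open>module_ext\<close> record inherits from rings are not used. In finite dimension
  completeness is automatic.
\<close>

record 'a hilbert = "(complex, 'a) module" +
  inprod :: "'a \<Rightarrow> 'a \<Rightarrow> complex"

locale fd_hilbert_space = vectorspace "class_ring :: complex ring" H
  for H :: "'a hilbert" (structure) +
  assumes finite_dimensional: "fin_dim"
    and inprod_add_right:
      "\<lbrakk>x \<in> carrier H; y \<in> carrier H; z \<in> carrier H\<rbrakk>
        \<Longrightarrow> inprod H x (y \<oplus> z) = inprod H x y + inprod H x z"
    and inprod_smult_right:
      "\<lbrakk>x \<in> carrier H; y \<in> carrier H\<rbrakk> \<Longrightarrow> inprod H x (c \<odot> y) = c * inprod H x y"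
    and inprod_cnj:
      "\<lbrakk>x \<in> carrier H; y \<in> carrier H\<rbrakk> \<Longrightarrow> inprod H y x = cnj (inprod H x y)"
    and inprod_pos: "\<lbrakk>x \<in> carrier H; x \<noteq> \<zero>\<rbrakk> \<Longrightarrow> 0 < Re (inprod H x x)"

text \<open>
  Linear maps are extensional functions, i.e. they are \<^const>\<open>undefined\<close> outside the carrier of
  their domain, so that equality of linear maps is equality of functions.
\<close>

definition linear_maps :: "'a hilbert \<Rightarrow> 'b hilbert \<Rightarrow> ('a \<Rightarrow> 'b) set" where
  "linear_maps H K =
     LinearCombinations.module_hom (class_ring :: complex ring) H K \<inter> extensional (carrier H)"

definition adjoint :: "'a hilbert \<Rightarrow> 'b hilbert \<Rightarrow> ('a \<Rightarrow> 'b) \<Rightarrow> 'b \<Rightarrow> 'a" where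
  "adjoint H K F = (THE G. G \<in> linear_maps K H \<and>
     (\<forall>x \<in> carrier H. \<forall>y \<in> carrier K. inprod K (F x) y = inprod H x (G y)))"

definition operators :: "'a hilbert \<Rightarrow> (complex, 'a \<Rightarrow> 'a) module"  (\<open>\<L>\<close>) where
  "\<L> H =
     \<lparr>carrier = linear_maps H H,
      mult = (\<lambda>\<rho> \<tau>. compose (carrier H) \<rho> \<tau>),
      one = (\<lambda>x \<in> carrier H. x),
      zero = (\<lambda>x \<in> carrier H. \<zero>\<^bsub>H\<^esub>),
      add = (\<lambda>\<rho> \<tau>. \<lambda>x \<in> carrier H. \<rho> x \<oplus>\<^bsub>H\<^esub> \<tau> x),
      smult = (\<lambda>c \<rho>. \<lambda>x \<in> carrier H. c \<odot>\<^bsub>H\<^esub> \<rho> x)\<rparr>"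

definition completely_positive_maps ::
    "'a hilbert \<Rightarrow> 'b hilbert \<Rightarrow> (('a \<Rightarrow> 'a) \<Rightarrow> ('b \<Rightarrow> 'b)) set" where
  "completely_positive_maps H K =
     {\<Phi>. \<exists>(m :: nat) F. (\<forall>i<m. F i \<in> linear_maps H K) \<and>
        \<Phi> = (\<lambda>\<rho> \<in> carrier (\<L> H). \<Oplus>\<^bsub>\<L> K\<^esub>i\<in>{..<m}.
               compose (carrier K) (compose (carrier H) (F i) \<rho>) (adjoint H K (F i)))}"


section \<open>The category of completely positive maps\<close>

type_synonym 'a cpm_obj = "'a hilbert list"

record 'a cpm_arrow =
  source :: "'a cpm_obj"
  target :: "'a cpm_obj"
  entries :: "(('a \<Rightarrow> 'a) \<Rightarrow> ('a \<Rightarrow> 'a)) mat"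

definition cpm_objects :: "'a cpm_obj set" where
  "cpm_objects = {X. \<forall>H \<in> set X. fd_hilbert_space H}"

definition cpm_hom :: "'a cpm_obj \<Rightarrow> 'a cpm_obj \<Rightarrow> 'a cpm_arrow set" where
  "cpm_hom X Y =
     {f. source f = X \<and> target f = Y \<and> entries f \<in> carrier_mat (length Y) (length X) \<and>
         (\<forall>i < length Y. \<forall>j < length X.
            entries f $$ (i, j) \<in> completely_positive_maps (X ! j) (Y ! i))}"

definition cpm_comp :: "'a cpm_arrow \<Rightarrow> 'a cpm_arrow \<Rightarrow> 'a cpm_arrow" where
  "cpm_comp g f =
     \<lparr>source = source f, target = target g,
      entries = mat (length (target g)) (length (source f))
        (\<lambda>(i, k). \<lambda>\<rho> \<in> carrier (\<L> (source f ! k)).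
           \<Oplus>\<^bsub>\<L> (target g ! i)\<^esub>j\<in>{..<length (target f)}.
             (entries g $$ (i, j)) ((entries f $$ (j, k)) \<rho>))\<rparr>"

definition cpm_id :: "'a cpm_obj \<Rightarrow> 'a cpm_arrow" where
  "cpm_id X =
     \<lparr>source = X, target = X,
      entries = mat (length X) (length X)
        (\<lambda>(i, j). \<lambda>\<rho> \<in> carrier (\<L> (X ! j)). if i = j then \<rho> else \<zero>\<^bsub>\<L> (X ! i)\<^esub>)\<rparr>"

definition cpm_zero :: "'a cpm_obj \<Rightarrow> 'a cpm_obj \<Rightarrow> 'a cpm_arrow" where
  "cpm_zero X Y =
     \<lparr>source = X, target = Y,
      entries = mat (length Y) (length X)
        (\<lambda>(i, j). \<lambda>\<rho> \<in> carrier (\<L> (X ! j)). \<zero>\<^bsub>\<L> (Y ! i)\<^esub>)\<rparr>"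

definition cpm_add :: "'a cpm_arrow \<Rightarrow> 'a cpm_arrow \<Rightarrow> 'a cpm_arrow" where
  "cpm_add f g =
     \<lparr>source = source f, target = target f,
      entries = mat (length (target f)) (length (source f))
        (\<lambda>(i, j). \<lambda>\<rho> \<in> carrier (\<L> (source f ! j)).
           (entries f $$ (i, j)) \<rho> \<oplus>\<^bsub>\<L> (target f ! i)\<^esub> (entries g $$ (i, j)) \<rho>)\<rparr>"


subsection \<open>Direct sums\<close>

definition cpm_oplus :: "'a cpm_arrow \<Rightarrow> 'a cpm_arrow \<Rightarrow> 'a cpm_arrow" where
  "cpm_oplus f g =
     \<lparr>source = source f @ source g, target = target f @ target g,
      entries = four_block_mat
        (entries f) (entries (cpm_zero (source g) (target f)))
        (entries (cpm_zero (source f) (target g))) (entries g)\<rparr>"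

text \<open>
  Concatenation of sequences is strictly associative and unital, so the associators and unitors
  are identities.
\<close>

definition cpm_assoc :: "'a cpm_obj \<Rightarrow> 'a cpm_obj \<Rightarrow> 'a cpm_obj \<Rightarrow> 'a cpm_arrow" where
  "cpm_assoc X Y Z = cpm_id (X @ Y @ Z)"

definition cpm_lunit :: "'a cpm_obj \<Rightarrow> 'a cpm_arrow" where
  "cpm_lunit X = cpm_id X"

definition cpm_runit :: "'a cpm_obj \<Rightarrow> 'a cpm_arrow" where
  "cpm_runit X = cpm_id X"

definition cpm_sym :: "'a cpm_obj \<Rightarrow> 'a cpm_obj \<Rightarrow> 'a cpm_arrow" where
  "cpm_sym X Y =
     \<lparr>source = X @ Y, target = Y @ X,
      entries = four_block_mat
        (entries (cpm_zero X Y)) (entries (cpm_id Y))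
        (entries (cpm_id X)) (entries (cpm_zero Y X))\<rparr>"


subsection \<open>The partial trace\<close>

definition operator_sum :: "'a cpm_obj \<Rightarrow> (complex, ('a \<Rightarrow> 'a) vec) module" where
  "operator_sum X =
     \<lparr>carrier = {v. dim_vec v = length X \<and> (\<forall>j < length X. v $ j \<in> carrier (\<L> (X ! j)))},
      mult = (\<lambda>v w. vec (length X) (\<lambda>j. v $ j \<otimes>\<^bsub>\<L> (X ! j)\<^esub> w $ j)),
      one = vec (length X) (\<lambda>j. \<one>\<^bsub>\<L> (X ! j)\<^esub>),
      zero = vec (length X) (\<lambda>j. \<zero>\<^bsub>\<L> (X ! j)\<^esub>),
      add = (\<lambda>v w. vec (length X) (\<lambda>j. v $ j \<oplus>\<^bsub>\<L> (X ! j)\<^esub> w $ j)),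
      smult = (\<lambda>c v. vec (length X) (\<lambda>j. c \<odot>\<^bsub>\<L> (X ! j)\<^esub> v $ j))\<rparr>"

definition linear_function :: "'a cpm_arrow \<Rightarrow> ('a \<Rightarrow> 'a) vec \<Rightarrow> ('a \<Rightarrow> 'a) vec" where
  "linear_function f v =
     vec (length (target f))
       (\<lambda>i. \<Oplus>\<^bsub>\<L> (target f ! i)\<^esub>j\<in>{..<length (source f)}. (entries f $$ (i, j)) (v $ j))"

text \<open>\<open>I - f\<close> need not be a morphism of the category, only a linear function.\<close>

definition id_minus :: "'a cpm_arrow \<Rightarrow> ('a \<Rightarrow> 'a) vec \<Rightarrow> ('a \<Rightarrow> 'a) vec" where
  "id_minus f v = v \<ominus>\<^bsub>operator_sum (source f)\<^esub> linear_function f v"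

definition invertible_linear ::
    "(complex, 'b) module \<Rightarrow> (complex, 'b) module \<Rightarrow> ('b \<Rightarrow> 'b) \<Rightarrow> bool" where
  "invertible_linear V W T \<longleftrightarrow>
     T \<in> LinearCombinations.module_hom (class_ring :: complex ring) V W \<and>
     (\<exists>S \<in> LinearCombinations.module_hom (class_ring :: complex ring) W V.
        (\<forall>v \<in> carrier V. S (T v) = v) \<and> (\<forall>w \<in> carrier W. T (S w) = w))"

definition represents_inverse :: "'a cpm_obj \<Rightarrow> 'a cpm_arrow \<Rightarrow> 'a cpm_arrow \<Rightarrow> bool" where
  "represents_inverse U f N \<longleftrightarrow> N \<in> cpm_hom U U \<and>
     (\<forall>v \<in> carrier (operator_sum U).
        linear_function N v = inv_into (carrier (operator_sum U)) (id_minus f) v)"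

definition cpm_trace ::
    "'a cpm_obj \<Rightarrow> 'a cpm_obj \<Rightarrow> 'a cpm_obj \<Rightarrow> 'a cpm_arrow \<rightharpoonup> 'a cpm_arrow" where
  "cpm_trace U X Y f =
     (let (E11, E12, E21, E22) = split_block (entries f) (length Y) (length X);
          f11 = \<lparr>source = X, target = Y, entries = E11\<rparr>;
          f12 = \<lparr>source = U, target = Y, entries = E12\<rparr>;
          f21 = \<lparr>source = X, target = U, entries = E21\<rparr>;
          f22 = \<lparr>source = U, target = U, entries = E22\<rparr>
      in if f \<in> cpm_hom (X @ U) (Y @ U) \<and>
            invertible_linear (operator_sum U) (operator_sum U) (id_minus f22) \<and>
            (\<exists>N. represents_inverse U f22 N)
         then Some (cpm_add f11
                (cpm_comp f12 (cpm_comp (THE N. represents_inverse U f22 N) f21)))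
         else None)"

end

theory Submission
  imports Defs
begin

text \<open>
  An arrow of the category is determined by its linear function on tuples of operators, so every
  equation between arrows is checked on vectors. For an arrow \<open>f\<close> from \<open>X \<oplus> U\<close> to
  \<open>Y \<oplus> U\<close>, the map \<open>I - f\<^sub>2\<^sub>2\<close> is invertible with completely positive inverse iff the
  feedback equation \<open>a = u + f\<^sub>2\<^sub>1 x + f\<^sub>2\<^sub>2 a\<close> has a unique solution \<open>a = s(x, u)\<close> for all
  \<open>x\<close> and \<open>u\<close>, and \<open>s\<close> is an arrow; the trace of \<open>f\<close> is then the first component
  of \<open>x \<mapsto> f(x, s(x, 0))\<close>. Each axiom follows by solving one feedback equation in terms of another,
  where only sums and composites of arrows occur in the solution: for dinaturality substitute
  \<open>a = g b\<close>, for Vanishing II eliminate the unknown in \<open>V\<close> first. Completely positive maps compose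
  because adjoints exist and reverse composition; existence is the Riesz representation theorem.
\<close>

section \<open>Complex modules\<close>

text \<open>The obstacle is the lack of negatives: a difference of completely positive maps is in
  general not completely positive, so \<open>I - f22\<close> need not be an arrow and the usual
  algebra of inverses leaves the category. Each axiom needs an identity for inverses with only sums
  and composites on one side. For dinaturality it is
  \<open>(I - ba)^-1 = I + b (I - ab)^-1 a\<close>. For Vanishing II it is block inversion:
  \<open>I\<close> minus the loop of the inner trace is the Schur complement of the block on
  \<open>V\<close>. Its inverse is the \<open>U\<close> block of the whole inverse, and conversely
  the whole inverse is obtained from it by back substitution. The free input \<open>u\<close> is
  what makes the feedback equation equivalent to (a) and (b): at \<open>x = 0\<close> the map from
  \<open>u\<close> to \<open>s(0, u)\<close> is the full inverse, whereas \<open>u = 0\<close> alone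
  would show it only on the range of \<open>f21\<close>. Since the equation characterises
  \<open>a\<close>, two candidate solutions are identified by checking that one solves the equation
  of the other, without computing with inverses.\<close>

abbreviation complex_module :: "(complex, 'b, 'c) module_scheme \<Rightarrow> bool" where
  "complex_module M \<equiv> module (class_ring :: complex ring) M"

abbreviation complex_linear ::
    "(complex, 'b, 'c) module_scheme \<Rightarrow> (complex, 'd, 'e) module_scheme \<Rightarrow> ('b \<Rightarrow> 'd) set" where
  "complex_linear M N \<equiv> LinearCombinations.module_hom (class_ring :: complex ring) M N"

lemma complex_module_abelian_group: "complex_module M \<Longrightarrow> abelian_group M"
  by (rule module.axioms)

lemma complex_linearI:
  assumes "\<And>x. x \<in> carrier M \<Longrightarrow> f x \<in> carrier N"
    and "\<And>x y. x \<in> carrier M \<Longrightarrow> y \<in> carrier M \<Longrightarrow> f (x \<oplus>\<^bsub>M\<^esub> y) = f x \<oplus>\<^bsub>N\<^esub> f y"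
    and "\<And>c x. x \<in> carrier M \<Longrightarrow> f (c \<odot>\<^bsub>M\<^esub> x) = c \<odot>\<^bsub>N\<^esub> f x"
  shows "f \<in> complex_linear M N"
  using assms by (auto simp: LinearCombinations.module_hom_def)

lemma complex_linear_closed: "f \<in> complex_linear M N \<Longrightarrow> x \<in> carrier M \<Longrightarrow> f x \<in> carrier N"
  by (auto simp: LinearCombinations.module_hom_def)

lemma complex_linear_add:
  "f \<in> complex_linear M N \<Longrightarrow> x \<in> carrier M \<Longrightarrow> y \<in> carrier M \<Longrightarrow>
     f (x \<oplus>\<^bsub>M\<^esub> y) = f x \<oplus>\<^bsub>N\<^esub> f y"
  by (auto simp: LinearCombinations.module_hom_def)

lemma complex_linear_smult:
  "f \<in> complex_linear M N \<Longrightarrow> x \<in> carrier M \<Longrightarrow> f (c \<odot>\<^bsub>M\<^esub> x) = c \<odot>\<^bsub>N\<^esub> f x"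
  by (auto simp: LinearCombinations.module_hom_def)

lemma complex_linear_zero:
  assumes "complex_module M" "complex_module N" "f \<in> complex_linear M N"
  shows "f \<zero>\<^bsub>M\<^esub> = \<zero>\<^bsub>N\<^esub>"
proof -
  interpret mod_hom class_ring M N f
    using assms by (simp add: mod_hom_def mod_hom_axioms_def)
  show ?thesis by (rule f0_is_0)
qed

lemma complex_linear_finsum:
  assumes M: "complex_module M" and N: "complex_module N" and f: "f \<in> complex_linear M N"
    and g: "\<And>i. i \<in> A \<Longrightarrow> g i \<in> carrier M" and "finite A"
  shows "f (\<Oplus>\<^bsub>M\<^esub>i\<in>A. g i) = (\<Oplus>\<^bsub>N\<^esub>i\<in>A. f (g i))"
proof -
  interpret M: Module.module class_ring M by fact
  interpret N: Module.module class_ring N by fact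
  show ?thesis
    using \<open>finite A\<close> g
  proof (induction A rule: finite_induct)
    case empty
    show ?case using complex_linear_zero[OF M N f] by simp
  next
    case (insert a A)
    have "g \<in> A \<rightarrow> carrier M" "(\<lambda>i. f (g i)) \<in> A \<rightarrow> carrier N"
      using insert.prems complex_linear_closed[OF f] by auto
    then show ?case
      using insert by (simp add: complex_linear_add[OF f] complex_linear_closed[OF f])
  qed
qed

text \<open>Negatives are written as multiples by \<open>- 1\<close>, so that the closure and
  linearity rules for scalar multiplication also cover subtraction.\<close>

lemma complex_module_smult_minus:
  assumes "complex_module M" "x \<in> carrier M"
  shows "x \<oplus>\<^bsub>M\<^esub> (- 1) \<odot>\<^bsub>M\<^esub> x = \<zero>\<^bsub>M\<^esub>"
proof -
  interpret M: Module.module class_ring M by fact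
  have "x \<oplus>\<^bsub>M\<^esub> (- 1) \<odot>\<^bsub>M\<^esub> x = (1 + - 1) \<odot>\<^bsub>M\<^esub> x"
    using assms(2) M.smult_l_distr[of 1 "-1" x] M.smult_one[of x] by simp
  also have "\<dots> = \<zero>\<^bsub>M\<^esub>"
    using assms(2) M.smult_l_null[of x] by simp
  finally show ?thesis .
qed


section \<open>Linear maps between Hilbert spaces\<close>

lemma fd_hilbert_space_module: "fd_hilbert_space H \<Longrightarrow> complex_module H"
  unfolding fd_hilbert_space_def vectorspace_def by blast

lemma linear_mapsI:
  assumes "\<And>x. x \<in> carrier H \<Longrightarrow> f x \<in> carrier K"
    and "\<And>x y. x \<in> carrier H \<Longrightarrow> y \<in> carrier H \<Longrightarrow> f (x \<oplus>\<^bsub>H\<^esub> y) = f x \<oplus>\<^bsub>K\<^esub> f y"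
    and "\<And>c x. x \<in> carrier H \<Longrightarrow> f (c \<odot>\<^bsub>H\<^esub> x) = c \<odot>\<^bsub>K\<^esub> f x"
    and "f \<in> extensional (carrier H)"
  shows "f \<in> linear_maps H K"
  using assms by (auto simp: LinearCombinations.module_hom_def linear_maps_def)

lemma linear_maps_closed: "f \<in> linear_maps H K \<Longrightarrow> x \<in> carrier H \<Longrightarrow> f x \<in> carrier K"
  by (auto simp: LinearCombinations.module_hom_def linear_maps_def)

lemma linear_maps_eqI:
  assumes "f \<in> linear_maps H K" "g \<in> linear_maps H K'" "\<And>x. x \<in> carrier H \<Longrightarrow> f x = g x"
  shows "f = g"
  using assms by (auto simp: linear_maps_def intro: extensionalityI)

lemma linear_maps_add:
  "f \<in> linear_maps H K \<Longrightarrow> x \<in> carrier H \<Longrightarrow> y \<in> carrier H \<Longrightarrow>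
    f (x \<oplus>\<^bsub>H\<^esub> y) = f x \<oplus>\<^bsub>K\<^esub> f y"
  by (auto simp: LinearCombinations.module_hom_def linear_maps_def)

lemma linear_maps_smult:
  "f \<in> linear_maps H K \<Longrightarrow> x \<in> carrier H \<Longrightarrow> f (c \<odot>\<^bsub>H\<^esub> x) = c \<odot>\<^bsub>K\<^esub> f x"
  by (auto simp: LinearCombinations.module_hom_def linear_maps_def)

lemma linear_maps_compose:
  assumes H: "complex_module H" and "F \<in> linear_maps H K" "G \<in> linear_maps K L"
  shows "compose (carrier H) G F \<in> linear_maps H L"
proof -
  interpret H: Module.module class_ring H by fact
  show ?thesis
    using assms(2,3)
    by (intro linear_mapsI) (auto simp: compose_def linear_maps_closed linear_maps_add
      linear_maps_smult H.smult_closed[simplified])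
qed

lemma linear_maps_ident:
  assumes H: "complex_module H"
  shows "(\<lambda>x\<in>carrier H. x) \<in> linear_maps H H"
proof -
  interpret H: Module.module class_ring H by fact
  show ?thesis by (intro linear_mapsI) (auto simp: H.smult_closed[simplified])
qed

lemma operators_module:
  assumes "complex_module H"
  shows "complex_module (\<L> H)"
proof (rule module_criteria)
  interpret H: Module.module class_ring H by fact
  have c: "carrier (\<L> H) = linear_maps H H" and z: "\<zero>\<^bsub>\<L> H\<^esub> = (\<lambda>x \<in> carrier H. \<zero>\<^bsub>H\<^esub>)"
    and a: "\<And>\<rho> \<tau>. \<rho> \<oplus>\<^bsub>\<L> H\<^esub> \<tau> = (\<lambda>x \<in> carrier H. \<rho> x \<oplus>\<^bsub>H\<^esub> \<tau> x)"
    and s: "\<And>c \<rho>. c \<odot>\<^bsub>\<L> H\<^esub> \<rho> = (\<lambda>x \<in> carrier H. c \<odot>\<^bsub>H\<^esub> \<rho> x)"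
    by (simp_all add: operators_def)
  note H_simps = H.smult_closed[simplified] H.smult_r_distr[simplified]
    H.smult_l_distr[simplified] H.smult_assoc1[simplified] H.a_ac
  have sr: "c \<odot>\<^bsub>H\<^esub> \<zero>\<^bsub>H\<^esub> = \<zero>\<^bsub>H\<^esub>" for c using H.smult_r_null[of c] by simp
  \<comment> \<open>Scalars commute; this is what makes a scalar multiple of a linear map
    homogeneous.\<close>
  have smult_commute: "c \<odot>\<^bsub>H\<^esub> (d \<odot>\<^bsub>H\<^esub> x) = d \<odot>\<^bsub>H\<^esub> (c \<odot>\<^bsub>H\<^esub> x)" if "x \<in> carrier H" for c d x
    using that by (simp add: H.smult_assoc1[simplified, symmetric] mult.commute)
  show "cring (class_ring :: complex ring)" using assms by (rule Module.module.axioms)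
  show "\<zero>\<^bsub>\<L> H\<^esub> \<in> carrier (\<L> H)"
    unfolding c z by (rule linear_mapsI) (auto simp: H_simps sr)
  show add: "\<forall>v w. v \<in> carrier (\<L> H) \<and> w \<in> carrier (\<L> H) \<longrightarrow> v \<oplus>\<^bsub>\<L> H\<^esub> w \<in> carrier (\<L> H)"
    unfolding c a
    by (auto intro!: linear_mapsI simp: linear_maps_closed linear_maps_add linear_maps_smult H_simps)
  show smult: "\<forall>c v. c \<in> carrier class_ring \<and> v \<in> carrier (\<L> H) \<longrightarrow> c \<odot>\<^bsub>\<L> H\<^esub> v \<in> carrier (\<L> H)"
    unfolding c s
    by (auto intro!: linear_mapsI simp: linear_maps_closed linear_maps_add linear_maps_smult H_simps
        smult_commute)
  show "\<forall>v\<in>carrier (\<L> H). \<exists>w\<in>carrier (\<L> H). v \<oplus>\<^bsub>\<L> H\<^esub> w = \<zero>\<^bsub>\<L> H\<^esub>"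
  proof
    fix v assume v: "v \<in> carrier (\<L> H)"
    have "(- 1) \<odot>\<^bsub>\<L> H\<^esub> v \<in> carrier (\<L> H)" using smult v by simp
    moreover have "v \<oplus>\<^bsub>\<L> H\<^esub> (- 1) \<odot>\<^bsub>\<L> H\<^esub> v = \<zero>\<^bsub>\<L> H\<^esub>"
      using v by (auto simp: c a z s linear_maps_closed complex_module_smult_minus[OF assms]
        intro!: restrict_ext)
    ultimately show "\<exists>w\<in>carrier (\<L> H). v \<oplus>\<^bsub>\<L> H\<^esub> w = \<zero>\<^bsub>\<L> H\<^esub>" by blast
  qed
  show "\<forall>v w. v \<in> carrier (\<L> H) \<and> w \<in> carrier (\<L> H) \<longrightarrow> v \<oplus>\<^bsub>\<L> H\<^esub> w = w \<oplus>\<^bsub>\<L> H\<^esub> v"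
    "\<forall>v w x. v \<in> carrier (\<L> H) \<and> w \<in> carrier (\<L> H) \<and> x \<in> carrier (\<L> H) \<longrightarrow>
      (v \<oplus>\<^bsub>\<L> H\<^esub> w) \<oplus>\<^bsub>\<L> H\<^esub> x = v \<oplus>\<^bsub>\<L> H\<^esub> (w \<oplus>\<^bsub>\<L> H\<^esub> x)"
    unfolding c a by (auto intro!: restrict_ext simp: linear_maps_closed H_simps)
  \<comment> \<open>Both neutral laws return a restriction to the carrier; extensionality of
    \<open>v\<close> turns it back into \<open>v\<close> itself.\<close>
  have ext: "(\<lambda>x\<in>carrier H. v x) = v" if "v \<in> linear_maps H H" for v
    using that by (simp add: linear_maps_def extensional_restrict)
  show "\<forall>v\<in>carrier (\<L> H). v \<oplus>\<^bsub>\<L> H\<^esub> \<zero>\<^bsub>\<L> H\<^esub> = v"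
    "\<forall>v\<in>carrier (\<L> H). \<one>\<^bsub>class_ring\<^esub> \<odot>\<^bsub>\<L> H\<^esub> v = v"
    unfolding c a z s
    by (auto simp: linear_maps_closed H.smult_one[simplified] linear_maps_def
      extensional_def restrict_def intro!: ext)
  show "\<forall>a b v. a \<in> carrier class_ring \<and> b \<in> carrier class_ring \<and> v \<in> carrier (\<L> H) \<longrightarrow>
      (a \<otimes>\<^bsub>class_ring\<^esub> b) \<odot>\<^bsub>\<L> H\<^esub> v = a \<odot>\<^bsub>\<L> H\<^esub> (b \<odot>\<^bsub>\<L> H\<^esub> v)"
    "\<forall>a b v. a \<in> carrier class_ring \<and> b \<in> carrier class_ring \<and> v \<in> carrier (\<L> H) \<longrightarrow>
      (a \<oplus>\<^bsub>class_ring\<^esub> b) \<odot>\<^bsub>\<L> H\<^esub> v = a \<odot>\<^bsub>\<L> H\<^esub> v \<oplus>\<^bsub>\<L> H\<^esub> b \<odot>\<^bsub>\<L> H\<^esub> v"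
    "\<forall>a v w. a \<in> carrier class_ring \<and> v \<in> carrier (\<L> H) \<and> w \<in> carrier (\<L> H) \<longrightarrow>
      a \<odot>\<^bsub>\<L> H\<^esub> (v \<oplus>\<^bsub>\<L> H\<^esub> w) = a \<odot>\<^bsub>\<L> H\<^esub> v \<oplus>\<^bsub>\<L> H\<^esub> a \<odot>\<^bsub>\<L> H\<^esub> w"
    unfolding c a s by (auto intro!: restrict_ext simp: linear_maps_closed H_simps)
qed

section \<open>Adjoints\<close>

text \<open>Values lie in the type \<open>complex\<close> itself rather than in a module record, so
  \<open>inprod H y\<close> qualifies as it stands and differences of functionals are formed
  pointwise.\<close>

definition linear_functional :: "(complex, 'a, 'c) module_scheme \<Rightarrow> ('a \<Rightarrow> complex) \<Rightarrow> bool" where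
  "linear_functional H \<phi> \<longleftrightarrow>
     (\<forall>x \<in> carrier H. \<forall>y \<in> carrier H. \<phi> (x \<oplus>\<^bsub>H\<^esub> y) = \<phi> x + \<phi> y) \<and>
     (\<forall>c. \<forall>x \<in> carrier H. \<phi> (c \<odot>\<^bsub>H\<^esub> x) = c * \<phi> x)"

lemma linear_functional_add:
  "linear_functional H \<phi> \<Longrightarrow> x \<in> carrier H \<Longrightarrow> y \<in> carrier H \<Longrightarrow> \<phi> (x \<oplus>\<^bsub>H\<^esub> y) = \<phi> x + \<phi> y"
  by (simp add: linear_functional_def)

lemma linear_functional_smult:
  "linear_functional H \<phi> \<Longrightarrow> x \<in> carrier H \<Longrightarrow> \<phi> (c \<odot>\<^bsub>H\<^esub> x) = c * \<phi> x"
  by (simp add: linear_functional_def)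

lemma linear_functional_zero:
  fixes H :: "(complex, 'a, 'c) module_scheme"
  assumes "complex_module H" "linear_functional H \<phi>"
  shows "\<phi> \<zero>\<^bsub>H\<^esub> = 0"
proof -
  interpret H: Module.module class_ring H by fact
  have "\<phi> (0 \<odot>\<^bsub>H\<^esub> \<zero>\<^bsub>H\<^esub>) = 0 * \<phi> \<zero>\<^bsub>H\<^esub>"
    by (rule linear_functional_smult[OF assms(2)]) simp
  moreover have "0 \<odot>\<^bsub>H\<^esub> \<zero>\<^bsub>H\<^esub> = \<zero>\<^bsub>H\<^esub>"
    using H.smult_l_null[of "\<zero>\<^bsub>H\<^esub>"] by simp
  ultimately show ?thesis by simp
qed

lemma linear_functional_diff:
  fixes H :: "(complex, 'a, 'c) module_scheme"
  assumes "complex_module H" "linear_functional H \<phi>" "x \<in> carrier H" "y \<in> carrier H"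
  shows "\<phi> (x \<oplus>\<^bsub>H\<^esub> (- 1) \<odot>\<^bsub>H\<^esub> y) = \<phi> x - \<phi> y"
proof -
  interpret H: Module.module class_ring H by fact
  have "(- 1) \<odot>\<^bsub>H\<^esub> y \<in> carrier H" using assms(4) by (intro H.smult_closed) simp_all
  then show ?thesis
    using assms by (simp add: linear_functional_add linear_functional_smult)
qed

text \<open>The kernel of \<open>\<phi>\<close> is a submodule; as it contains \<open>A\<close>, it
  contains the span of \<open>A\<close>.\<close>

lemma linear_functional_generating_set:
  fixes H :: "(complex, 'a, 'c) module_scheme"
  assumes H: "complex_module H" and A: "A \<subseteq> carrier H" "LinearCombinations.module.span class_ring H A = carrier H"
    and \<phi>: "linear_functional H \<phi>" "\<And>a. a \<in> A \<Longrightarrow> \<phi> a = 0" and x: "x \<in> carrier H"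
  shows "\<phi> x = 0"
proof -
  interpret H: Module.module class_ring H by fact
  have "submodule class_ring {x \<in> carrier H. \<phi> x = 0} H"
  proof (rule submodule.intro)
    show "complex_module H" by fact
    fix c v assume "c \<in> carrier (class_ring :: complex ring)" "v \<in> {x \<in> carrier H. \<phi> x = 0}"
    then show "c \<odot>\<^bsub>H\<^esub> v \<in> {x \<in> carrier H. \<phi> x = 0}"
      using H.smult_closed[of c v] by (simp add: linear_functional_smult[OF \<phi>(1)])
  qed (auto simp: linear_functional_add[OF \<phi>(1)] linear_functional_zero[OF H \<phi>(1)])
  then have "carrier H \<subseteq> {x \<in> carrier H. \<phi> x = 0}"
    using H.span_is_subset[of A "{x \<in> carrier H. \<phi> x = 0}"] A \<phi>(2) by auto
  then show ?thesis using x by auto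
qed

section \<open>Riesz representation in finite dimension\<close>

context fd_hilbert_space
begin

lemma smult_closed_complex: "x \<in> carrier H \<Longrightarrow> c \<odot> x \<in> carrier H"
  by (rule smult_closed) simp_all

lemma linear_functional_inprod: "y \<in> carrier H \<Longrightarrow> linear_functional H (inprod H y)"
  by (simp add: linear_functional_def inprod_add_right inprod_smult_right)

lemma inprod_self_eq_0: "x \<in> carrier H \<Longrightarrow> inprod H x x = 0 \<Longrightarrow> x = \<zero>"
  using inprod_pos[of x] by auto

text \<open>Testing with the difference of the two vectors shows that it is orthogonal to itself,
  hence zero by definiteness. All uniqueness statements about adjoints rest on this.\<close>

lemma inprod_left_eqI:
  assumes y: "y \<in> carrier H" "z \<in> carrier H"
    and eq: "\<And>x. x \<in> carrier H \<Longrightarrow> inprod H x y = inprod H x z"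
  shows "y = z"
proof -
  define d where "d = y \<oplus> (- 1) \<odot> z"
  have d: "d \<in> carrier H" using y by (simp add: d_def smult_closed_complex)
  have "inprod H d d = inprod H d y - inprod H d z"
    using linear_functional_diff[OF module_axioms linear_functional_inprod[OF d] y]
    by (simp flip: d_def)
  then have "d = \<zero>" using eq[OF d] inprod_self_eq_0[OF d] by simp
  then have "y \<oplus> (- 1) \<odot> z = z \<oplus> (- 1) \<odot> z"
    using complex_module_smult_minus[OF module_axioms y(2)] by (simp add: d_def)
  then show ?thesis using y by (simp add: smult_closed_complex)
qed

text \<open>
  Gram-Schmidt without spans: the last conjunct says that \<open>y\<close> lies in the span of \<open>A\<close>,
  expressed by duality. In the induction step it makes the functional vanish on the component
  of the new vector along the old ones.
\<close>

lemma riesz_on_finite_set: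
  assumes "finite A" "A \<subseteq> carrier H" "linear_functional H \<phi>"
  shows "\<exists>y \<in> carrier H. (\<forall>a \<in> A. inprod H y a = \<phi> a) \<and>
    (\<forall>\<psi>. linear_functional H \<psi> \<longrightarrow> (\<forall>a \<in> A. \<psi> a = 0) \<longrightarrow> \<psi> y = 0)"
  using assms
proof (induction A arbitrary: \<phi> rule: finite_induct)
  case empty
  show ?case
    by (intro bexI[of _ \<zero>]) (simp_all add: linear_functional_zero[OF module_axioms])
next
  case (insert a A)
  then have a: "a \<in> carrier H" and A: "A \<subseteq> carrier H" by auto
  obtain y where y: "y \<in> carrier H" "\<And>b. b \<in> A \<Longrightarrow> inprod H y b = \<phi> b"
    and y_span: "\<And>\<psi>. linear_functional H \<psi> \<Longrightarrow> (\<And>b. b \<in> A \<Longrightarrow> \<psi> b = 0) \<Longrightarrow> \<psi> y = 0"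
    using insert.IH[OF A insert.prems(2)] by blast
  \<comment> \<open>Applied to the functional \<open>inprod H a\<close>, the induction hypothesis
    yields the orthogonal projection \<open>p\<close> of \<open>a\<close> onto the span of
    \<open>A\<close>.\<close>
  obtain p where p: "p \<in> carrier H" "\<And>b. b \<in> A \<Longrightarrow> inprod H p b = inprod H a b"
    and p_span: "\<And>\<psi>. linear_functional H \<psi> \<Longrightarrow> (\<And>b. b \<in> A \<Longrightarrow> \<psi> b = 0) \<Longrightarrow> \<psi> p = 0"
    using insert.IH[OF A linear_functional_inprod[OF a]] by blast
  define r where "r = a \<oplus> (- 1) \<odot> p"
  have r: "r \<in> carrier H" using a p by (simp add: r_def smult_closed_complex)
  have functional_r: "\<psi> r = \<psi> a - \<psi> p" if "linear_functional H \<psi>" for \<psi>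
    unfolding r_def using module_axioms that a p(1) by (rule linear_functional_diff)
  have r_orth: "inprod H r b = 0" if "b \<in> A" for b
  proof -
    have b: "b \<in> carrier H" using that A by auto
    have "inprod H b r = inprod H b a - inprod H b p"
      by (rule functional_r[OF linear_functional_inprod[OF b]])
    also have "\<dots> = 0"
      using p(2)[OF that] inprod_cnj[OF a b] inprod_cnj[OF p(1) b] by simp
    finally show ?thesis using inprod_cnj[OF b r] by simp
  qed
  \<comment> \<open>Obtained by solving \<open>inprod H y' a = \<phi> a\<close> for
    \<open>c\<close>, given that \<open>inprod H r a = inprod H r r\<close>. The conjugate
    compensates for conjugate linearity in the first slot. If \<open>r\<close> vanishes, the
    numerator turns out to be zero.\<close>
  define c where "c = cnj ((\<phi> a - inprod H y a) / inprod H r r)"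
  define y' where "y' = y \<oplus> c \<odot> r"
  have y': "y' \<in> carrier H" using y r by (simp add: y'_def smult_closed_complex)
  have inprod_y': "inprod H y' x = inprod H y x + cnj c * inprod H r x" if x: "x \<in> carrier H" for x
  proof -
    have "inprod H x y' = inprod H x y + c * inprod H x r"
      using x y r by (simp add: y'_def inprod_add_right inprod_smult_right smult_closed_complex)
    then show ?thesis
      using inprod_cnj[OF x y'] inprod_cnj[OF x y(1)] inprod_cnj[OF x r] by simp
  qed
  have "inprod H y' b = \<phi> b" if "b \<in> A" for b
    using that A r_orth[OF that] by (subst inprod_y') (auto simp: y(2))
  moreover have "inprod H y' a = \<phi> a"
  proof (cases "r = \<zero>")
    case True
    define \<psi> where "\<psi> x = \<phi> x - inprod H y x" for x
    have \<psi>: "linear_functional H \<psi>"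
      using insert.prems(2) linear_functional_inprod[OF y(1)]
      by (auto simp: \<psi>_def linear_functional_def algebra_simps)
    then have "\<psi> p = 0" by (rule p_span) (simp add: \<psi>_def y(2))
    moreover have "\<psi> r = 0"
      using True \<psi> by (simp add: linear_functional_zero[OF module_axioms])
    ultimately have "\<phi> a = inprod H y a" using functional_r[OF \<psi>] by (simp add: \<psi>_def)
    then show ?thesis using a by (simp add: inprod_y' c_def)
  next
    case False
    \<comment> \<open>\<open>r\<close> is orthogonal to \<open>A\<close>, and \<open>p\<close> lies
      in the span of \<open>A\<close>.\<close>
    have "inprod H r p = 0"
      using linear_functional_inprod[OF r] by (rule p_span) (rule r_orth)
    then have "inprod H r r = inprod H r a"
      using functional_r[OF linear_functional_inprod[OF r]] by simp
    moreover have "inprod H r r \<noteq> 0" using False inprod_self_eq_0[OF r] by blast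
    ultimately show ?thesis using a by (simp add: inprod_y' c_def)
  qed
  moreover have "\<psi> y' = 0" if \<psi>: "linear_functional H \<psi>" "\<And>b. b \<in> insert a A \<Longrightarrow> \<psi> b = 0" for \<psi>
  proof -
    have "\<psi> y' = \<psi> y + c * \<psi> r"
      using \<psi>(1) y r
      by (simp add: y'_def linear_functional_add linear_functional_smult smult_closed_complex)
    then show ?thesis using \<psi> y_span[of \<psi>] p_span[of \<psi>] functional_r[of \<psi>] by simp
  qed
  ultimately show ?case using y' by (intro bexI[of _ y']) auto
qed

text \<open>The difference between \<open>\<phi>\<close> and its representation on a finite
  generating set vanishes on the generators, hence everywhere.\<close>

lemma riesz:
  assumes "linear_functional H \<phi>"
  shows "\<exists>y \<in> carrier H. \<forall>x \<in> carrier H. inprod H y x = \<phi> x"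
proof -
  obtain A where A: "finite A" "A \<subseteq> carrier H" "span A = carrier H"
    using finite_dimensional unfolding fin_dim_def by blast
  obtain y where y: "y \<in> carrier H" "\<forall>a \<in> A. inprod H y a = \<phi> a"
    using riesz_on_finite_set[OF A(1,2) assms] by blast
  have "linear_functional H (\<lambda>x. inprod H y x - \<phi> x)"
    using assms linear_functional_inprod[OF y(1)]
    by (auto simp: linear_functional_def algebra_simps)
  then have "inprod H y x - \<phi> x = 0" if "x \<in> carrier H" for x
    using linear_functional_generating_set[OF module_axioms A(2,3), of "\<lambda>x. inprod H y x - \<phi> x"]
      y(2) that by auto
  then show ?thesis using y(1) by auto
qed

end

text \<open>The definite description in \<open>adjoint\<close> has one candidate at most:
  \<open>inprod_left_eqI\<close> fixes its values on \<open>carrier K\<close> and extensionality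
  fixes it elsewhere.\<close>

lemma adjoint_eqI:
  assumes H: "fd_hilbert_space H" and "G \<in> linear_maps K H"
    and "\<And>x y. x \<in> carrier H \<Longrightarrow> y \<in> carrier K \<Longrightarrow> inprod K (F x) y = inprod H x (G y)"
  shows "adjoint H K F = G"
proof -
  interpret H: fd_hilbert_space H by fact
  show ?thesis
    unfolding adjoint_def
  proof (rule the_equality)
    show "G \<in> linear_maps K H \<and> (\<forall>x\<in>carrier H. \<forall>y\<in>carrier K. inprod K (F x) y = inprod H x (G y))"
      using assms by blast
    fix G' assume G': "G' \<in> linear_maps K H \<and>
      (\<forall>x\<in>carrier H. \<forall>y\<in>carrier K. inprod K (F x) y = inprod H x (G' y))"
    show "G' = G"
    proof (rule linear_maps_eqI)
      fix y assume "y \<in> carrier K"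
      then show "G' y = G y"
        using G' assms by (intro H.inprod_left_eqI) (auto simp: linear_maps_closed)
    qed (use G' assms in auto)
  qed
qed

text \<open>For each \<open>y\<close>, Riesz represents the functional sending \<open>x\<close> to
  \<open>inprod K y (F x)\<close>; the chosen vectors form the adjoint. The choice is linear in
  \<open>y\<close> because both sides of each linearity equation have the same inner products with
  every \<open>x\<close>.\<close>

lemma adjoint_exists:
  assumes H: "fd_hilbert_space H" and K: "fd_hilbert_space K" and F: "F \<in> linear_maps H K"
  shows "\<exists>G \<in> linear_maps K H. \<forall>x\<in>carrier H. \<forall>y\<in>carrier K. inprod K (F x) y = inprod H x (G y)"
proof -
  interpret H: fd_hilbert_space H by fact
  interpret K: fd_hilbert_space K by fact
  have "\<exists>z\<in>carrier H. \<forall>x\<in>carrier H. inprod H z x = inprod K y (F x)" if "y \<in> carrier K" for y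
    using F that
    by (intro H.riesz) (auto simp: linear_functional_def linear_maps_closed linear_maps_add
      linear_maps_smult K.inprod_add_right K.inprod_smult_right)
  then obtain g where g: "\<And>y. y \<in> carrier K \<Longrightarrow> g y \<in> carrier H"
    "\<And>x y. y \<in> carrier K \<Longrightarrow> x \<in> carrier H \<Longrightarrow> inprod H (g y) x = inprod K y (F x)"
    by metis
  \<comment> \<open>Riesz places the representing vector in the first slot; conjugating both sides
    moves it to the second, as the definition of the adjoint demands.\<close>
  have adj: "inprod K (F x) y = inprod H x (g y)" if "x \<in> carrier H" "y \<in> carrier K" for x y
    using g[of y] that H.inprod_cnj[of "g y" x] K.inprod_cnj[of y "F x"] F
    by (simp add: linear_maps_closed)
  have "(\<lambda>y\<in>carrier K. g y) \<in> linear_maps K H"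
  proof (rule linear_mapsI)
    fix y z assume yz: "y \<in> carrier K" "z \<in> carrier K"
    have "g (y \<oplus>\<^bsub>K\<^esub> z) = g y \<oplus>\<^bsub>H\<^esub> g z"
      using yz by (intro H.inprod_left_eqI)
        (auto simp: g(1) H.inprod_add_right K.inprod_add_right adj[symmetric] linear_maps_closed[OF F])
    then show "(\<lambda>y\<in>carrier K. g y) (y \<oplus>\<^bsub>K\<^esub> z) =
        (\<lambda>y\<in>carrier K. g y) y \<oplus>\<^bsub>H\<^esub> (\<lambda>y\<in>carrier K. g y) z"
      using yz by simp
  next
    fix c y assume y: "y \<in> carrier K"
    have "g (c \<odot>\<^bsub>K\<^esub> y) = c \<odot>\<^bsub>H\<^esub> g y"
      using y by (intro H.inprod_left_eqI)
        (auto simp: g(1) H.smult_closed_complex K.smult_closed_complex H.inprod_smult_right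
          K.inprod_smult_right adj[symmetric] linear_maps_closed[OF F])
    then show "(\<lambda>y\<in>carrier K. g y) (c \<odot>\<^bsub>K\<^esub> y) = c \<odot>\<^bsub>H\<^esub> (\<lambda>y\<in>carrier K. g y) y"
      using y by (simp add: K.smult_closed_complex)
  qed (auto simp: g)
  then show ?thesis using adj by (intro bexI[of _ "\<lambda>y\<in>carrier K. g y"]) auto
qed

lemma
  assumes "fd_hilbert_space H" "fd_hilbert_space K" "F \<in> linear_maps H K"
  shows adjoint_linear: "adjoint H K F \<in> linear_maps K H"
    and inprod_adjoint:
      "x \<in> carrier H \<Longrightarrow> y \<in> carrier K \<Longrightarrow> inprod H x (adjoint H K F y) = inprod K (F x) y"
proof -
  obtain G where G: "G \<in> linear_maps K H"
    "\<And>x y. x \<in> carrier H \<Longrightarrow> y \<in> carrier K \<Longrightarrow> inprod K (F x) y = inprod H x (G y)"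
    using adjoint_exists[OF assms] by blast
  have "adjoint H K F = G" using assms(1) G by (rule adjoint_eqI)
  then show "adjoint H K F \<in> linear_maps K H"
    "x \<in> carrier H \<Longrightarrow> y \<in> carrier K \<Longrightarrow> inprod H x (adjoint H K F y) = inprod K (F x) y"
    using G by auto
qed

text \<open>Move \<open>G\<close> and then \<open>F\<close> across the inner product;
  \<open>adjoint_eqI\<close> recognises the result.\<close>

lemma adjoint_compose:
  assumes H: "fd_hilbert_space H" and K: "fd_hilbert_space K" and L: "fd_hilbert_space L"
    and F: "F \<in> linear_maps H K" and G: "G \<in> linear_maps K L"
  shows "adjoint H L (compose (carrier H) G F) = compose (carrier L) (adjoint H K F) (adjoint K L G)"
proof (rule adjoint_eqI[OF H])
  show "compose (carrier L) (adjoint H K F) (adjoint K L G) \<in> linear_maps L H"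
    by (intro linear_maps_compose[where K = K] adjoint_linear fd_hilbert_space_module assms)
  fix x y assume "x \<in> carrier H" "y \<in> carrier L"
  then show "inprod L (compose (carrier H) G F x) y =
      inprod H x (compose (carrier L) (adjoint H K F) (adjoint K L G) y)"
    by (simp add: compose_def inprod_adjoint[OF H K F] inprod_adjoint[OF K L G]
      linear_maps_closed[OF F] linear_maps_closed[OF adjoint_linear[OF K L G]])
qed

lemma adjoint_ident:
  assumes "fd_hilbert_space H"
  shows "adjoint H H (\<lambda>x\<in>carrier H. x) = (\<lambda>x\<in>carrier H. x)"
  using assms by (intro adjoint_eqI linear_maps_ident fd_hilbert_space_module) auto

section \<open>Completely positive maps\<close>

lemma operators_add: "x \<in> carrier H \<Longrightarrow> (\<rho> \<oplus>\<^bsub>\<L> H\<^esub> \<tau>) x = \<rho> x \<oplus>\<^bsub>H\<^esub> \<tau> x"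
  by (simp add: operators_def)

lemma operators_smult: "x \<in> carrier H \<Longrightarrow> (c \<odot>\<^bsub>\<L> H\<^esub> \<rho>) x = c \<odot>\<^bsub>H\<^esub> \<rho> x"
  by (simp add: operators_def)

lemma carrier_operators: "carrier (\<L> H) = linear_maps H H"
  by (simp add: operators_def)

text \<open>A single Kraus term \<open>F \<rho> F^\<dagger>\<close>. It is not cut off outside
  \<open>carrier (\<L> H)\<close>, so an explicit restriction appears wherever it serves as a
  completely positive map.\<close>

definition conjugation :: "'a hilbert \<Rightarrow> 'b hilbert \<Rightarrow> ('a \<Rightarrow> 'b) \<Rightarrow> ('a \<Rightarrow> 'a) \<Rightarrow> 'b \<Rightarrow> 'b" where
  "conjugation H K F \<rho> = compose (carrier K) (compose (carrier H) F \<rho>) (adjoint H K F)"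

lemma conjugation_linear:
  assumes H: "fd_hilbert_space H" and K: "fd_hilbert_space K" and F: "F \<in> linear_maps H K"
  shows "conjugation H K F \<in> complex_linear (\<L> H) (\<L> K)"
proof (rule complex_linearI)
  interpret H: fd_hilbert_space H by fact
  interpret K: fd_hilbert_space K by fact
  note adj = adjoint_linear[OF H K F]
  show closed: "conjugation H K F \<rho> \<in> carrier (\<L> K)" if "\<rho> \<in> carrier (\<L> H)" for \<rho>
    unfolding conjugation_def carrier_operators
    using that linear_maps_compose[OF K.module_axioms adj linear_maps_compose[OF H.module_axioms _ F]]
    by (simp add: carrier_operators)
  show "conjugation H K F (\<rho> \<oplus>\<^bsub>\<L> H\<^esub> \<tau>) = conjugation H K F \<rho> \<oplus>\<^bsub>\<L> K\<^esub> conjugation H K F \<tau>"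
    if "\<rho> \<in> carrier (\<L> H)" "\<tau> \<in> carrier (\<L> H)" for \<rho> \<tau>
  proof (rule linear_maps_eqI[of _ K K _ K])
    show "conjugation H K F (\<rho> \<oplus>\<^bsub>\<L> H\<^esub> \<tau>) \<in> linear_maps K K"
      "conjugation H K F \<rho> \<oplus>\<^bsub>\<L> K\<^esub> conjugation H K F \<tau> \<in> linear_maps K K"
      using closed that
        abelian_groupE(1)[OF complex_module_abelian_group[OF operators_module[OF H.module_axioms]]]
        abelian_groupE(1)[OF complex_module_abelian_group[OF operators_module[OF K.module_axioms]]]
      by (simp_all add: carrier_operators)
    fix x assume "x \<in> carrier K"
    then show "conjugation H K F (\<rho> \<oplus>\<^bsub>\<L> H\<^esub> \<tau>) x = (conjugation H K F \<rho> \<oplus>\<^bsub>\<L> K\<^esub> conjugation H K F \<tau>) x"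
      using that by (simp add: operators_add conjugation_def compose_def linear_maps_closed[OF adj]
        carrier_operators linear_maps_add[OF F] linear_maps_closed)
  qed
  show "conjugation H K F (c \<odot>\<^bsub>\<L> H\<^esub> \<rho>) = c \<odot>\<^bsub>\<L> K\<^esub> conjugation H K F \<rho>"
    if "\<rho> \<in> carrier (\<L> H)" for c \<rho>
  proof (rule linear_maps_eqI[of _ K K _ K])
    show "conjugation H K F (c \<odot>\<^bsub>\<L> H\<^esub> \<rho>) \<in> linear_maps K K"
      "c \<odot>\<^bsub>\<L> K\<^esub> conjugation H K F \<rho> \<in> linear_maps K K"
      using closed that module.smult_closed[OF operators_module[OF H.module_axioms], of c]
        module.smult_closed[OF operators_module[OF K.module_axioms], of c]
      by (simp_all add: carrier_operators)
    fix x assume "x \<in> carrier K"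
    then show "conjugation H K F (c \<odot>\<^bsub>\<L> H\<^esub> \<rho>) x = (c \<odot>\<^bsub>\<L> K\<^esub> conjugation H K F \<rho>) x"
      using that by (simp add: operators_smult conjugation_def compose_def linear_maps_closed[OF adj]
        carrier_operators linear_maps_smult[OF F] linear_maps_closed)
  qed
qed

text \<open>By \<open>adjoint_compose\<close> the two outer adjoints merge into the adjoint of the
  product, so single Kraus terms compose to single Kraus terms.\<close>

lemma conjugation_compose:
  assumes H: "fd_hilbert_space H" and K: "fd_hilbert_space K" and L: "fd_hilbert_space L"
    and F: "F \<in> linear_maps H K" and G: "G \<in> linear_maps K L" and \<rho>: "\<rho> \<in> carrier (\<L> H)"
  shows "conjugation K L G (conjugation H K F \<rho>) = conjugation H L (compose (carrier H) G F) \<rho>"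
  using \<rho> unfolding conjugation_def adjoint_compose[OF H K L F G]
  by (auto simp: compose_def carrier_operators linear_maps_closed[OF adjoint_linear[OF H K F]]
    linear_maps_closed[OF adjoint_linear[OF K L G]] linear_maps_closed intro!: restrict_ext)

lemma conjugation_ident:
  assumes H: "fd_hilbert_space H" and \<rho>: "\<rho> \<in> carrier (\<L> H)"
  shows "conjugation H H (\<lambda>x\<in>carrier H. x) \<rho> = \<rho>"
  using \<rho> unfolding conjugation_def adjoint_ident[OF H]
  by (intro extensionalityI[of _ "carrier H"])
    (auto simp: compose_def carrier_operators linear_maps_closed linear_maps_def[of H H]
      complex_linear_closed)

lemma completely_positive_maps_conjugation:
  "completely_positive_maps H K =
     {\<Phi>. \<exists>(m :: nat) F. (\<forall>i<m. F i \<in> linear_maps H K) \<and>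
        \<Phi> = (\<lambda>\<rho> \<in> carrier (\<L> H). \<Oplus>\<^bsub>\<L> K\<^esub>i\<in>{..<m}. conjugation H K (F i) \<rho>)}"
  by (simp add: completely_positive_maps_def conjugation_def)

lemma completely_positive_zero:
  "(\<lambda>\<rho> \<in> carrier (\<L> H). \<zero>\<^bsub>\<L> K\<^esub>) \<in> completely_positive_maps H K" if "fd_hilbert_space K"
proof -
  interpret Module.module class_ring "\<L> K" by (intro operators_module fd_hilbert_space_module that)
  show ?thesis unfolding completely_positive_maps_conjugation by (rule CollectI, rule exI[of _ 0]) simp
qed

section \<open>Kraus sums built term by term\<close>

context
  fixes H :: "'a hilbert" and K :: "'b hilbert"
  assumes H: "fd_hilbert_space H" and K: "fd_hilbert_space K"
begin

interpretation LK: Module.module class_ring "\<L> K"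
  by (intro operators_module fd_hilbert_space_module K)

lemma finsum_conjugation_Suc:
  assumes "\<rho> \<in> carrier (\<L> H)" "\<forall>i<Suc m. F i \<in> linear_maps H K"
  shows "(\<Oplus>\<^bsub>\<L> K\<^esub>i\<in>{..<Suc m}. conjugation H K (F i) \<rho>) =
    (\<Oplus>\<^bsub>\<L> K\<^esub>i\<in>{..<m}. conjugation H K (F i) \<rho>) \<oplus>\<^bsub>\<L> K\<^esub> conjugation H K (F m) \<rho>"
proof -
  have "(\<lambda>i. conjugation H K (F i) \<rho>) \<in> {..<m} \<rightarrow> carrier (\<L> K)"
    "conjugation H K (F m) \<rho> \<in> carrier (\<L> K)"
    using assms complex_linear_closed[OF conjugation_linear[OF H K]] by auto
  then show ?thesis by (simp add: lessThan_Suc LK.a_comm LK.finsum_closed)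
qed

lemma completely_positive_add_conjugation:
  assumes "\<Phi> \<in> completely_positive_maps H K" "G \<in> linear_maps H K"
  shows "(\<lambda>\<rho> \<in> carrier (\<L> H). \<Phi> \<rho> \<oplus>\<^bsub>\<L> K\<^esub> conjugation H K G \<rho>) \<in> completely_positive_maps H K"
proof -
  obtain m :: nat and F where F: "\<forall>i<m. F i \<in> linear_maps H K"
    and \<Phi>: "\<Phi> = (\<lambda>\<rho> \<in> carrier (\<L> H). \<Oplus>\<^bsub>\<L> K\<^esub>i\<in>{..<m}. conjugation H K (F i) \<rho>)"
    using assms(1) unfolding completely_positive_maps_conjugation by blast
  \<comment> \<open>\<open>m\<close> is the first free index, so the old sum over
    \<open>i < m\<close> does not see the update.\<close>
  let ?F = "F(m := G)"
  have F': "\<forall>i<Suc m. ?F i \<in> linear_maps H K" using F assms(2) by (auto simp: less_Suc_eq)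
  have "(\<lambda>\<rho> \<in> carrier (\<L> H). \<Phi> \<rho> \<oplus>\<^bsub>\<L> K\<^esub> conjugation H K G \<rho>) =
      (\<lambda>\<rho> \<in> carrier (\<L> H). \<Oplus>\<^bsub>\<L> K\<^esub>i\<in>{..<Suc m}. conjugation H K (?F i) \<rho>)"
  proof (rule restrict_ext)
    fix \<rho> assume \<rho>: "\<rho> \<in> carrier (\<L> H)"
    have "(\<Oplus>\<^bsub>\<L> K\<^esub>i\<in>{..<m}. conjugation H K (?F i) \<rho>) = (\<Oplus>\<^bsub>\<L> K\<^esub>i\<in>{..<m}. conjugation H K (F i) \<rho>)"
      using F \<rho> complex_linear_closed[OF conjugation_linear[OF H K]]
      by (intro LK.finsum_cong') auto
    then show "\<Phi> \<rho> \<oplus>\<^bsub>\<L> K\<^esub> conjugation H K G \<rho> = (\<Oplus>\<^bsub>\<L> K\<^esub>i\<in>{..<Suc m}. conjugation H K (?F i) \<rho>)"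
      using \<rho> unfolding finsum_conjugation_Suc[OF \<rho> F'] by (simp add: \<Phi>)
  qed
  then show ?thesis
    unfolding completely_positive_maps_conjugation using F' by blast
qed

text \<open>Peels off the last Kraus term. Closure under sums and composition then follows by
  induction, without explicit Kraus families for the results.\<close>

lemma completely_positive_induct [consumes 1, case_names zero add]:
  assumes "\<Phi> \<in> completely_positive_maps H K"
    and zero: "P (\<lambda>\<rho> \<in> carrier (\<L> H). \<zero>\<^bsub>\<L> K\<^esub>)"
    and add: "\<And>\<Phi> G. \<Phi> \<in> completely_positive_maps H K \<Longrightarrow> P \<Phi> \<Longrightarrow> G \<in> linear_maps H K \<Longrightarrow>
      P (\<lambda>\<rho> \<in> carrier (\<L> H). \<Phi> \<rho> \<oplus>\<^bsub>\<L> K\<^esub> conjugation H K G \<rho>)"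
  shows "P \<Phi>"
proof -
  have "P (\<lambda>\<rho> \<in> carrier (\<L> H). \<Oplus>\<^bsub>\<L> K\<^esub>i\<in>{..<m}. conjugation H K (F i) \<rho>)"
    if "\<forall>i<m. F i \<in> linear_maps H K" for m :: nat and F
    using that
  proof (induction m)
    case 0
    show ?case using zero by (simp add: restrict_def)
  next
    case (Suc m)
    let ?\<Phi> = "\<lambda>\<rho> \<in> carrier (\<L> H). \<Oplus>\<^bsub>\<L> K\<^esub>i\<in>{..<m}. conjugation H K (F i) \<rho>"
    have F: "\<forall>i<m. F i \<in> linear_maps H K" "F m \<in> linear_maps H K" using Suc.prems by auto
    have "?\<Phi> \<in> completely_positive_maps H K"
      unfolding completely_positive_maps_conjugation using F(1) by blast
    then have "P (\<lambda>\<rho> \<in> carrier (\<L> H). ?\<Phi> \<rho> \<oplus>\<^bsub>\<L> K\<^esub> conjugation H K (F m) \<rho>)"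
      by (intro add Suc.IH F)
    also have "(\<lambda>\<rho> \<in> carrier (\<L> H). ?\<Phi> \<rho> \<oplus>\<^bsub>\<L> K\<^esub> conjugation H K (F m) \<rho>) =
        (\<lambda>\<rho> \<in> carrier (\<L> H). \<Oplus>\<^bsub>\<L> K\<^esub>i\<in>{..<Suc m}. conjugation H K (F i) \<rho>)"
      by (rule restrict_ext) (simp only: finsum_conjugation_Suc[OF _ Suc.prems] restrict_apply if_True)
    finally show ?case .
  qed
  then show ?thesis using assms(1) unfolding completely_positive_maps_conjugation by blast
qed

lemma completely_positive_linear:
  assumes "\<Phi> \<in> completely_positive_maps H K"
  shows "\<Phi> \<in> complex_linear (\<L> H) (\<L> K)"
  using assms
proof (induction rule: completely_positive_induct)
  interpret LH: Module.module class_ring "\<L> H"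
    by (intro operators_module fd_hilbert_space_module H)
  note simps = LH.smult_closed[simplified] LK.smult_closed[simplified] LK.smult_r_distr[simplified]
  case zero
  have "c \<odot>\<^bsub>\<L> K\<^esub> \<zero>\<^bsub>\<L> K\<^esub> = \<zero>\<^bsub>\<L> K\<^esub>" for c using LK.smult_r_null[of c] by simp
  then show ?case by (intro complex_linearI) (auto simp: simps)
next
  interpret LH: Module.module class_ring "\<L> H"
    by (intro operators_module fd_hilbert_space_module H)
  note simps = LH.smult_closed[simplified] LK.smult_closed[simplified] LK.smult_r_distr[simplified]
  case (add \<Phi> G)
  note G = conjugation_linear[OF H K add.hyps(2)]
  show ?case
    by (intro complex_linearI)
      (auto simp: simps complex_linear_closed[OF add.IH] complex_linear_closed[OF G]
        complex_linear_add[OF add.IH] complex_linear_add[OF G] complex_linear_smult[OF add.IH]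
        complex_linear_smult[OF G] LK.a_ac)
qed

lemma completely_positive_extensional:
  "\<Phi> \<in> completely_positive_maps H K \<Longrightarrow> \<Phi> \<in> extensional (carrier (\<L> H))"
  by (auto simp: completely_positive_maps_def)

lemmas completely_positive_closed = complex_linear_closed[OF completely_positive_linear]

lemma completely_positive_eqI:
  assumes "\<Phi> \<in> completely_positive_maps H K" "\<Psi> \<in> completely_positive_maps H K"
    "\<And>\<rho>. \<rho> \<in> carrier (\<L> H) \<Longrightarrow> \<Phi> \<rho> = \<Psi> \<rho>"
  shows "\<Phi> = \<Psi>"
  using assms completely_positive_extensional by (blast intro: extensionalityI)

text \<open>Induction on \<open>\<Psi>\<close>: by associativity its Kraus terms are added to
  \<open>\<Phi>\<close> one after the other.\<close>

lemma completely_positive_add: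
  assumes "\<Psi> \<in> completely_positive_maps H K" "\<Phi> \<in> completely_positive_maps H K"
  shows "(\<lambda>\<rho> \<in> carrier (\<L> H). \<Phi> \<rho> \<oplus>\<^bsub>\<L> K\<^esub> \<Psi> \<rho>) \<in> completely_positive_maps H K"
  using assms(1)
proof (induction rule: completely_positive_induct)
  case zero
  have "(\<lambda>\<rho> \<in> carrier (\<L> H). \<Phi> \<rho> \<oplus>\<^bsub>\<L> K\<^esub> (\<lambda>\<rho> \<in> carrier (\<L> H). \<zero>\<^bsub>\<L> K\<^esub>) \<rho>) = \<Phi>"
    using assms(2) completely_positive_extensional
    by (intro extensionalityI[of _ "carrier (\<L> H)"]) (auto simp: completely_positive_closed)
  then show ?case using assms(2) by simp
next
  case (add \<Psi> G)
  have "(\<lambda>\<rho> \<in> carrier (\<L> H). \<Phi> \<rho> \<oplus>\<^bsub>\<L> K\<^esub> (\<lambda>\<rho> \<in> carrier (\<L> H). \<Psi> \<rho> \<oplus>\<^bsub>\<L> K\<^esub> conjugation H K G \<rho>) \<rho>) =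
      (\<lambda>\<rho> \<in> carrier (\<L> H). (\<lambda>\<rho> \<in> carrier (\<L> H). \<Phi> \<rho> \<oplus>\<^bsub>\<L> K\<^esub> \<Psi> \<rho>) \<rho> \<oplus>\<^bsub>\<L> K\<^esub> conjugation H K G \<rho>)"
    using assms(2) add.hyps complex_linear_closed[OF conjugation_linear[OF H K]]
    by (intro restrict_ext) (simp add: LK.a_assoc completely_positive_closed)
  then show ?case using completely_positive_add_conjugation[OF add.IH add.hyps(2)] by (simp only:)
qed

lemma completely_positive_conjugation:
  assumes "G \<in> linear_maps H K"
  shows "(\<lambda>\<rho> \<in> carrier (\<L> H). conjugation H K G \<rho>) \<in> completely_positive_maps H K"
proof -
  have "(\<lambda>\<rho> \<in> carrier (\<L> H). (\<lambda>\<rho> \<in> carrier (\<L> H). \<zero>\<^bsub>\<L> K\<^esub>) \<rho> \<oplus>\<^bsub>\<L> K\<^esub> conjugation H K G \<rho>) =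
      (\<lambda>\<rho> \<in> carrier (\<L> H). conjugation H K G \<rho>)"
    using complex_linear_closed[OF conjugation_linear[OF H K assms]]
    by (intro restrict_ext) simp
  then show ?thesis
    using completely_positive_add_conjugation[OF completely_positive_zero[OF K] assms] by simp
qed

end

text \<open>One Kraus operator suffices, the identity, because it is its own adjoint.\<close>

lemma completely_positive_ident:
  assumes H: "fd_hilbert_space H"
  shows "(\<lambda>\<rho> \<in> carrier (\<L> H). \<rho>) \<in> completely_positive_maps H H"
proof -
  have "(\<lambda>\<rho> \<in> carrier (\<L> H). \<rho>) = (\<lambda>\<rho> \<in> carrier (\<L> H). conjugation H H (\<lambda>x\<in>carrier H. x) \<rho>)"
    by (intro restrict_ext) (simp add: conjugation_ident[OF H])
  then show ?thesis
    using completely_positive_conjugation[OF H H linear_maps_ident[OF fd_hilbert_space_module[OF H]]]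
    by simp
qed

text \<open>Two inductions replace the double sum over products of Kraus operators. The first, over
  \<open>\<Phi>\<close>, puts a single Kraus term after \<open>\<Phi>\<close> and uses
  \<open>conjugation_compose\<close>; the second, over \<open>\<Psi>\<close>, adds up such
  composites.\<close>

lemma completely_positive_compose:
  assumes H: "fd_hilbert_space H" and K: "fd_hilbert_space K" and L: "fd_hilbert_space L"
    and \<Phi>: "\<Phi> \<in> completely_positive_maps H K" and \<Psi>: "\<Psi> \<in> completely_positive_maps K L"
  shows "(\<lambda>\<rho> \<in> carrier (\<L> H). \<Psi> (\<Phi> \<rho>)) \<in> completely_positive_maps H L"
proof -
  have mods: "complex_module (\<L> H)" "complex_module (\<L> K)" "complex_module (\<L> L)"
    by (intro operators_module fd_hilbert_space_module assms)+
  have *: "(\<lambda>\<rho> \<in> carrier (\<L> H). conjugation K L G (\<Phi> \<rho>)) \<in> completely_positive_maps H L"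
    if G: "G \<in> linear_maps K L" for G
    using \<Phi>
  proof (induction rule: completely_positive_induct[OF H K, consumes 1, case_names zero add])
    case zero
    have "(\<lambda>\<rho> \<in> carrier (\<L> H). conjugation K L G ((\<lambda>\<rho> \<in> carrier (\<L> H). \<zero>\<^bsub>\<L> K\<^esub>) \<rho>)) =
        (\<lambda>\<rho> \<in> carrier (\<L> H). \<zero>\<^bsub>\<L> L\<^esub>)"
      by (intro restrict_ext)
        (simp add: complex_linear_zero[OF mods(2,3) conjugation_linear[OF K L G]])
    then show ?case using completely_positive_zero[OF L] by (simp only:)
  next
    case (add \<Phi> F)
    have "(\<lambda>\<rho> \<in> carrier (\<L> H). conjugation K L G ((\<lambda>\<rho> \<in> carrier (\<L> H). \<Phi> \<rho> \<oplus>\<^bsub>\<L> K\<^esub> conjugation H K F \<rho>) \<rho>)) =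
      (\<lambda>\<rho> \<in> carrier (\<L> H). (\<lambda>\<rho> \<in> carrier (\<L> H). conjugation K L G (\<Phi> \<rho>)) \<rho> \<oplus>\<^bsub>\<L> L\<^esub>
         conjugation H L (compose (carrier H) G F) \<rho>)"
      using add.hyps complex_linear_closed[OF conjugation_linear[OF H K add.hyps(2)]]
        completely_positive_closed[OF H K]
      by (intro restrict_ext)
        (simp add: complex_linear_add[OF conjugation_linear[OF K L G]] conjugation_compose[OF H K L _ G])
    then show ?case
      using completely_positive_add_conjugation[OF H L add.IH
          linear_maps_compose[OF fd_hilbert_space_module[OF H] add.hyps(2) G]]
      by (simp only:)
  qed
  show ?thesis
    using \<Psi>
  proof (induction rule: completely_positive_induct[OF K L, consumes 1, case_names zero add])
    case zero
    have "(\<lambda>\<rho> \<in> carrier (\<L> H). (\<lambda>\<rho> \<in> carrier (\<L> K). \<zero>\<^bsub>\<L> L\<^esub>) (\<Phi> \<rho>)) = (\<lambda>\<rho> \<in> carrier (\<L> H). \<zero>\<^bsub>\<L> L\<^esub>)"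
      using completely_positive_closed[OF H K \<Phi>] by (intro restrict_ext) simp
    then show ?case using completely_positive_zero[OF L] by (simp only:)
  next
    case (add \<Psi> G)
    have "(\<lambda>\<rho> \<in> carrier (\<L> H). (\<lambda>\<rho> \<in> carrier (\<L> K). \<Psi> \<rho> \<oplus>\<^bsub>\<L> L\<^esub> conjugation K L G \<rho>) (\<Phi> \<rho>)) =
      (\<lambda>\<rho> \<in> carrier (\<L> H). (\<lambda>\<rho> \<in> carrier (\<L> H). \<Psi> (\<Phi> \<rho>)) \<rho> \<oplus>\<^bsub>\<L> L\<^esub>
         (\<lambda>\<rho> \<in> carrier (\<L> H). conjugation K L G (\<Phi> \<rho>)) \<rho>)"
      using completely_positive_closed[OF H K \<Phi>] by (intro restrict_ext) simp
    then show ?case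
      using completely_positive_add[OF H L *[OF add.hyps(2)] add.IH] by (simp only:)
  qed
qed

section \<open>Tuples of operators\<close>

text \<open>Cuts the sum along a row of a block matrix at the boundary between its two column
  blocks.\<close>

lemma (in abelian_monoid) finsum_lessThan_add:
  fixes n m :: nat
  assumes "\<And>j. j < n + m \<Longrightarrow> f j \<in> carrier G"
  shows "(\<Oplus>j\<in>{..<n + m}. f j) = (\<Oplus>j\<in>{..<n}. f j) \<oplus> (\<Oplus>j\<in>{..<m}. f (n + j))"
  using assms
proof (induction m)
  case 0
  then show ?case by (simp add: finsum_closed Pi_def)
next
  case (Suc m)
  then have "f \<in> {..<n + m} \<rightarrow> carrier G" "f (n + m) \<in> carrier G"
    "f \<in> {..<n} \<rightarrow> carrier G" "(\<lambda>j. f (n + j)) \<in> {..<m} \<rightarrow> carrier G"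
    by auto
  then show ?case using Suc by (simp add: lessThan_Suc a_ac finsum_closed)
qed

lemma cpm_objects_nth: "X \<in> cpm_objects \<Longrightarrow> j < length X \<Longrightarrow> fd_hilbert_space (X ! j)"
  by (auto simp: cpm_objects_def)

lemma cpm_objects_append: "X @ Y \<in> cpm_objects \<longleftrightarrow> X \<in> cpm_objects \<and> Y \<in> cpm_objects"
  by (auto simp: cpm_objects_def)

lemma operators_nth_module:
  "X \<in> cpm_objects \<Longrightarrow> j < length X \<Longrightarrow> complex_module (\<L> (X ! j))"
  by (intro operators_module fd_hilbert_space_module cpm_objects_nth)

abbreviation vectors :: "'a cpm_obj \<Rightarrow> ('a \<Rightarrow> 'a) vec set" where
  "vectors X \<equiv> carrier (operator_sum X)"

lemma carrier_operator_sum: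
  "v \<in> vectors X \<longleftrightarrow>
     dim_vec v = length X \<and> (\<forall>j < length X. v $ j \<in> carrier (\<L> (X ! j)))"
  by (simp add: operator_sum_def)

lemma operator_sum_dim: "v \<in> vectors X \<Longrightarrow> dim_vec v = length X"
  by (simp add: operator_sum_def)

lemma operator_sum_ops:
  "\<zero>\<^bsub>operator_sum X\<^esub> = vec (length X) (\<lambda>j. \<zero>\<^bsub>\<L> (X ! j)\<^esub>)"
  "v \<oplus>\<^bsub>operator_sum X\<^esub> w = vec (length X) (\<lambda>j. v $ j \<oplus>\<^bsub>\<L> (X ! j)\<^esub> w $ j)"
  "c \<odot>\<^bsub>operator_sum X\<^esub> v = vec (length X) (\<lambda>j. c \<odot>\<^bsub>\<L> (X ! j)\<^esub> v $ j)"
  by (simp_all add: operator_sum_def)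

lemma operator_sum_module:
  assumes X: "X \<in> cpm_objects"
  shows "complex_module (operator_sum X)"
proof (rule module_criteria)
  note mod = operators_nth_module[OF X]
  note monoid = abelian_group.axioms(1)[OF complex_module_abelian_group[OF mod]]
  note closed = module.smult_closed[OF mod, simplified]
    abelian_monoid.a_closed[OF monoid]
  let ?S = "operator_sum X"
  show "cring (class_ring :: complex ring)"
    by (rule class_cring.cring_axioms)
  show "\<zero>\<^bsub>?S\<^esub> \<in> carrier ?S"
    by (simp add: carrier_operator_sum operator_sum_ops
      abelian_monoid.zero_closed[OF monoid])
  show "\<forall>v w. v \<in> carrier ?S \<and> w \<in> carrier ?S \<longrightarrow> v \<oplus>\<^bsub>?S\<^esub> w \<in> carrier ?S"
    "\<forall>c v. c \<in> carrier class_ring \<and> v \<in> carrier ?S \<longrightarrow> c \<odot>\<^bsub>?S\<^esub> v \<in> carrier ?S"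
    by (simp_all add: carrier_operator_sum operator_sum_ops closed)
  show "\<forall>v\<in>carrier ?S. \<exists>w\<in>carrier ?S. v \<oplus>\<^bsub>?S\<^esub> w = \<zero>\<^bsub>?S\<^esub>"
  proof
    fix v assume v: "v \<in> carrier ?S"
    show "\<exists>w\<in>carrier ?S. v \<oplus>\<^bsub>?S\<^esub> w = \<zero>\<^bsub>?S\<^esub>"
      using v by (intro bexI[of _ "(- 1) \<odot>\<^bsub>?S\<^esub> v"] eq_vecI)
        (simp_all add: carrier_operator_sum operator_sum_ops closed complex_module_smult_minus[OF mod])
  qed
  show "\<forall>v w. v \<in> carrier ?S \<and> w \<in> carrier ?S \<longrightarrow> v \<oplus>\<^bsub>?S\<^esub> w = w \<oplus>\<^bsub>?S\<^esub> v"
    by (intro allI impI ballI eq_vecI) (simp_all add: carrier_operator_sum operator_sum_ops closed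
      abelian_monoid.a_comm[OF monoid])
  show "\<forall>v w x. v \<in> carrier ?S \<and> w \<in> carrier ?S \<and> x \<in> carrier ?S \<longrightarrow>
      (v \<oplus>\<^bsub>?S\<^esub> w) \<oplus>\<^bsub>?S\<^esub> x = v \<oplus>\<^bsub>?S\<^esub> (w \<oplus>\<^bsub>?S\<^esub> x)"
    by (intro allI impI ballI eq_vecI) (simp_all add: carrier_operator_sum operator_sum_ops closed
      abelian_monoid.a_assoc[OF monoid])
  show "\<forall>v\<in>carrier ?S. v \<oplus>\<^bsub>?S\<^esub> \<zero>\<^bsub>?S\<^esub> = v"
    by (intro allI impI ballI eq_vecI) (simp_all add: carrier_operator_sum operator_sum_ops closed
      abelian_monoid.r_zero[OF monoid])
  show "\<forall>a b v. a \<in> carrier class_ring \<and> b \<in> carrier class_ring \<and> v \<in> carrier ?S \<longrightarrow>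
      (a \<otimes>\<^bsub>class_ring\<^esub> b) \<odot>\<^bsub>?S\<^esub> v = a \<odot>\<^bsub>?S\<^esub> (b \<odot>\<^bsub>?S\<^esub> v)"
    by (intro allI impI ballI eq_vecI) (simp_all add: carrier_operator_sum operator_sum_ops closed
      module.smult_assoc1[OF mod, simplified])
  show "\<forall>v\<in>carrier ?S. \<one>\<^bsub>class_ring\<^esub> \<odot>\<^bsub>?S\<^esub> v = v"
    by (intro allI impI ballI eq_vecI) (simp_all add: carrier_operator_sum operator_sum_ops closed
      module.smult_one[OF mod, simplified])
  show "\<forall>a b v. a \<in> carrier class_ring \<and> b \<in> carrier class_ring \<and> v \<in> carrier ?S \<longrightarrow>
      (a \<oplus>\<^bsub>class_ring\<^esub> b) \<odot>\<^bsub>?S\<^esub> v = a \<odot>\<^bsub>?S\<^esub> v \<oplus>\<^bsub>?S\<^esub> b \<odot>\<^bsub>?S\<^esub> v"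
    by (intro allI impI ballI eq_vecI) (simp_all add: carrier_operator_sum operator_sum_ops closed
      module.smult_l_distr[OF mod, simplified])
  show "\<forall>a v w. a \<in> carrier class_ring \<and> v \<in> carrier ?S \<and> w \<in> carrier ?S \<longrightarrow>
      a \<odot>\<^bsub>?S\<^esub> (v \<oplus>\<^bsub>?S\<^esub> w) = a \<odot>\<^bsub>?S\<^esub> v \<oplus>\<^bsub>?S\<^esub> a \<odot>\<^bsub>?S\<^esub> w"
    by (intro allI impI ballI eq_vecI) (simp_all add: carrier_operator_sum operator_sum_ops closed
      module.smult_r_distr[OF mod, simplified])
qed

section \<open>Concatenating and splitting tuples\<close>

lemma operator_sum_append:
  "x \<in> vectors X \<Longrightarrow> u \<in> vectors U \<Longrightarrow>
    x @\<^sub>v u \<in> vectors (X @ U)"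
  by (simp add: carrier_operator_sum nth_append)

lemma operator_sum_vec_first:
  assumes "v \<in> vectors (X @ U)"
  shows "vec_first v (length X) \<in> vectors X"
proof -
  have "v $ j \<in> carrier (\<L> (X ! j))" if "j < length X" for j
    using assms[unfolded carrier_operator_sum, THEN conjunct2, rule_format, of j] that
    by (simp add: nth_append)
  then show ?thesis by (simp add: carrier_operator_sum vec_first_def)
qed

lemma operator_sum_vec_last:
  assumes "v \<in> vectors (X @ U)"
  shows "vec_last v (length U) \<in> vectors U"
proof -
  have "v $ (length X + j) \<in> carrier (\<L> (U ! j))" if "j < length U" for j
    using assms[unfolded carrier_operator_sum, THEN conjunct2, rule_format, of "length X + j"] that
    by simp
  then show ?thesis using assms by (simp add: carrier_operator_sum vec_last_def)
qed

lemma operator_sum_vec_first_append: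
  assumes "x \<in> vectors X"
  shows "vec_first (x @\<^sub>v u) (length X) = x"
  using assms by (intro eq_vecI) (auto simp: carrier_operator_sum vec_first_def)

lemma operator_sum_vec_last_append:
  assumes "u \<in> vectors U"
  shows "vec_last (x @\<^sub>v u) (length U) = u"
  using assms by (intro eq_vecI) (auto simp: carrier_operator_sum vec_last_def)

lemma operator_sum_append_first_last:
  assumes "v \<in> vectors (X @ U)"
  shows "vec_first v (length X) @\<^sub>v vec_last v (length U) = v"
  by (intro vec_first_last_append carrier_vecI) (simp add: operator_sum_dim[OF assms])

lemma operator_sum_append_eq_iff:
  assumes "x \<in> vectors X" "x' \<in> vectors X"
  shows "x @\<^sub>v u = x' @\<^sub>v u' \<longleftrightarrow> x = x' \<and> u = u'"
  by (intro append_vec_eq[of _ "length X"] carrier_vecI operator_sum_dim assms)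

lemma operator_sum_append_add:
  assumes "x \<in> vectors X" "u \<in> vectors U"
    "x' \<in> vectors X" "u' \<in> vectors U"
  shows "(x @\<^sub>v u) \<oplus>\<^bsub>operator_sum (X @ U)\<^esub> (x' @\<^sub>v u') =
    (x \<oplus>\<^bsub>operator_sum X\<^esub> x') @\<^sub>v (u \<oplus>\<^bsub>operator_sum U\<^esub> u')"
  using assms by (intro eq_vecI) (auto simp: carrier_operator_sum operator_sum_ops nth_append)

lemma operator_sum_append_zero:
  "\<zero>\<^bsub>operator_sum X\<^esub> @\<^sub>v \<zero>\<^bsub>operator_sum U\<^esub> = \<zero>\<^bsub>operator_sum (X @ U)\<^esub>"
  by (intro eq_vecI) (auto simp: operator_sum_ops nth_append)


section \<open>Arrows as linear functions\<close>

lemma cpm_homD: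
  assumes "f \<in> cpm_hom X Y"
  shows "source f = X" "target f = Y" "dim_row (entries f) = length Y" "dim_col (entries f) = length X"
    "i < length Y \<Longrightarrow> j < length X \<Longrightarrow>
      entries f $$ (i, j) \<in> completely_positive_maps (X ! j) (Y ! i)"
  using assms by (auto simp: cpm_hom_def)

lemma cpm_homI:
  assumes "source f = X" "target f = Y" "dim_row (entries f) = length Y" "dim_col (entries f) = length X"
    "\<And>i j. i < length Y \<Longrightarrow> j < length X \<Longrightarrow>
      entries f $$ (i, j) \<in> completely_positive_maps (X ! j) (Y ! i)"
  shows "f \<in> cpm_hom X Y"
  using assms by (auto simp: cpm_hom_def)

context
  fixes X Y :: "'a cpm_obj" and f
  assumes X: "X \<in> cpm_objects" and Y: "Y \<in> cpm_objects" and f: "f \<in> cpm_hom X Y"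
begin

lemma entries_linear:
  "i < length Y \<Longrightarrow> j < length X \<Longrightarrow> entries f $$ (i, j) \<in> complex_linear (\<L> (X ! j)) (\<L> (Y ! i))"
  by (intro completely_positive_linear cpm_homD[OF f] cpm_objects_nth X Y)

lemma entries_closed:
  "i < length Y \<Longrightarrow> j < length X \<Longrightarrow> \<rho> \<in> carrier (\<L> (X ! j)) \<Longrightarrow>
    (entries f $$ (i, j)) \<rho> \<in> carrier (\<L> (Y ! i))"
  by (rule complex_linear_closed[OF entries_linear])

lemma linear_function_nth:
  "i < length Y \<Longrightarrow>
    linear_function f v $ i = (\<Oplus>\<^bsub>\<L> (Y ! i)\<^esub>j\<in>{..<length X}. (entries f $$ (i, j)) (v $ j))"
  by (simp add: linear_function_def cpm_homD[OF f])

lemma linear_function_linear: "linear_function f \<in> complex_linear (operator_sum X) (operator_sum Y)"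
proof (rule complex_linearI)
  have dim: "dim_vec (linear_function f v) = length Y" for v
    by (simp add: linear_function_def cpm_homD[OF f])
  show "linear_function f v \<in> vectors Y" if v: "v \<in> vectors X" for v
    unfolding carrier_operator_sum
  proof (intro conjI allI impI dim)
    fix i assume i: "i < length Y"
    interpret L: Module.module class_ring "\<L> (Y ! i)" by (rule operators_nth_module[OF Y i])
    show "linear_function f v $ i \<in> carrier (\<L> (Y ! i))"
      using v i by (auto simp: linear_function_nth carrier_operator_sum intro!: L.finsum_closed entries_closed)
  qed
  show "linear_function f (v \<oplus>\<^bsub>operator_sum X\<^esub> w) =
      linear_function f v \<oplus>\<^bsub>operator_sum Y\<^esub> linear_function f w"
    if v: "v \<in> vectors X" and w: "w \<in> vectors X" for v w
  proof (rule eq_vecI)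
    fix i assume "i < dim_vec (linear_function f v \<oplus>\<^bsub>operator_sum Y\<^esub> linear_function f w)"
    then have i: "i < length Y" by (simp add: operator_sum_ops)
    interpret L: Module.module class_ring "\<L> (Y ! i)" by (rule operators_nth_module[OF Y i])
    have "(\<Oplus>\<^bsub>\<L> (Y ! i)\<^esub>j\<in>{..<length X}. (entries f $$ (i, j)) ((v \<oplus>\<^bsub>operator_sum X\<^esub> w) $ j)) =
        (\<Oplus>\<^bsub>\<L> (Y ! i)\<^esub>j\<in>{..<length X}. (entries f $$ (i, j)) (v $ j) \<oplus>\<^bsub>\<L> (Y ! i)\<^esub> (entries f $$ (i, j)) (w $ j))"
      using v w i by (intro L.finsum_cong')
        (auto simp: operator_sum_ops carrier_operator_sum entries_closed complex_linear_add[OF entries_linear])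
    also have "\<dots> = (\<Oplus>\<^bsub>\<L> (Y ! i)\<^esub>j\<in>{..<length X}. (entries f $$ (i, j)) (v $ j)) \<oplus>\<^bsub>\<L> (Y ! i)\<^esub>
        (\<Oplus>\<^bsub>\<L> (Y ! i)\<^esub>j\<in>{..<length X}. (entries f $$ (i, j)) (w $ j))"
      using v w i by (intro L.finsum_addf) (auto simp: carrier_operator_sum entries_closed)
    finally show "linear_function f (v \<oplus>\<^bsub>operator_sum X\<^esub> w) $ i =
        (linear_function f v \<oplus>\<^bsub>operator_sum Y\<^esub> linear_function f w) $ i"
      using i by (simp add: linear_function_nth operator_sum_ops(2)[of Y])
  qed (simp add: dim operator_sum_ops)
  show "linear_function f (c \<odot>\<^bsub>operator_sum X\<^esub> v) = c \<odot>\<^bsub>operator_sum Y\<^esub> linear_function f v"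
    if v: "v \<in> vectors X" for c v
  proof (rule eq_vecI)
    fix i assume "i < dim_vec (c \<odot>\<^bsub>operator_sum Y\<^esub> linear_function f v)"
    then have i: "i < length Y" by (simp add: operator_sum_ops)
    interpret L: Module.module class_ring "\<L> (Y ! i)" by (rule operators_nth_module[OF Y i])
    have "(\<Oplus>\<^bsub>\<L> (Y ! i)\<^esub>j\<in>{..<length X}. (entries f $$ (i, j)) ((c \<odot>\<^bsub>operator_sum X\<^esub> v) $ j)) =
        (\<Oplus>\<^bsub>\<L> (Y ! i)\<^esub>j\<in>{..<length X}. c \<odot>\<^bsub>\<L> (Y ! i)\<^esub> (entries f $$ (i, j)) (v $ j))"
      using v i by (intro L.finsum_cong')
        (auto simp: operator_sum_ops carrier_operator_sum entries_closed complex_linear_smult[OF entries_linear]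
          L.smult_closed[simplified])
    also have "\<dots> = c \<odot>\<^bsub>\<L> (Y ! i)\<^esub> (\<Oplus>\<^bsub>\<L> (Y ! i)\<^esub>j\<in>{..<length X}. (entries f $$ (i, j)) (v $ j))"
      using v i by (intro L.finsum_smult[symmetric]) (auto simp: carrier_operator_sum entries_closed)
    finally show "linear_function f (c \<odot>\<^bsub>operator_sum X\<^esub> v) $ i = (c \<odot>\<^bsub>operator_sum Y\<^esub> linear_function f v) $ i"
      using i by (simp add: linear_function_nth operator_sum_ops(3)[of Y])
  qed (simp add: dim operator_sum_ops)
qed

lemmas linear_function_closed = complex_linear_closed[OF linear_function_linear]
  and linear_function_add = complex_linear_add[OF linear_function_linear]
  and linear_function_zero =
    complex_linear_zero[OF operator_sum_module[OF X] operator_sum_module[OF Y] linear_function_linear]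

lemma linear_function_dim: "dim_vec (linear_function f v) = length Y"
  by (simp add: linear_function_def cpm_homD[OF f])

text \<open>A tuple supported at the single index \<open>j\<close> reads off the entry
  \<open>(i, j)\<close>: every other summand of the row is a linear map applied to zero.\<close>

lemma linear_function_single:
  assumes i: "i < length Y" and j: "j < length X" and \<rho>: "\<rho> \<in> carrier (\<L> (X ! j))"
  defines "v \<equiv> vec (length X) (\<lambda>k. if j = k then \<rho> else \<zero>\<^bsub>\<L> (X ! k)\<^esub>)"
  shows "v \<in> vectors X" "linear_function f v $ i = (entries f $$ (i, j)) \<rho>"
proof -
  interpret L: Module.module class_ring "\<L> (Y ! i)" by (rule operators_nth_module[OF Y i])
  show "v \<in> vectors X"
    using \<rho> by (auto simp: v_def carrier_operator_sum
      abelian_monoid.zero_closed[OF abelian_group.axioms(1)[OF complex_module_abelian_group[OF operators_nth_module[OF X]]]])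
  have "(\<Oplus>\<^bsub>\<L> (Y ! i)\<^esub>k\<in>{..<length X}. (entries f $$ (i, k)) (v $ k)) =
      (\<Oplus>\<^bsub>\<L> (Y ! i)\<^esub>k\<in>{..<length X}. if j = k then (\<lambda>_. (entries f $$ (i, j)) \<rho>) k else \<zero>\<^bsub>\<L> (Y ! i)\<^esub>)"
    using i j \<rho> by (intro L.finsum_cong')
      (auto simp: v_def entries_closed
        complex_linear_zero[OF operators_nth_module[OF X] operators_nth_module[OF Y] entries_linear])
  also have "\<dots> = (entries f $$ (i, j)) \<rho>"
    using i j \<rho> by (subst L.finsum_singleton) (auto simp: entries_closed)
  finally show "linear_function f v $ i = (entries f $$ (i, j)) \<rho>" using i by (simp add: linear_function_nth)
qed

end

text \<open>All entries are recovered with tuples supported at one index. As entries are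
  extensional, agreement on operators makes them equal as functions, and so the matrices
  agree.\<close>

lemma cpm_hom_eqI:
  assumes X: "X \<in> cpm_objects" and Y: "Y \<in> cpm_objects"
    and f: "f \<in> cpm_hom X Y" and g: "g \<in> cpm_hom X Y"
    and eq: "\<And>v. v \<in> vectors X \<Longrightarrow> linear_function f v = linear_function g v"
  shows "f = g"
proof -
  have "entries f = entries g"
  proof (rule eq_matI)
    fix i j assume "i < dim_row (entries g)" "j < dim_col (entries g)"
    then have ij: "i < length Y" "j < length X" by (simp_all add: cpm_homD[OF g])
    show "entries f $$ (i, j) = entries g $$ (i, j)"
    proof (rule completely_positive_eqI[OF cpm_objects_nth[OF X ij(2)] cpm_objects_nth[OF Y ij(1)]])
      fix \<rho> assume \<rho>: "\<rho> \<in> carrier (\<L> (X ! j))"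
      show "(entries f $$ (i, j)) \<rho> = (entries g $$ (i, j)) \<rho>"
        using linear_function_single(2)[OF X Y f ij \<rho>] linear_function_single(2)[OF X Y g ij \<rho>]
          eq[OF linear_function_single(1)[OF X Y f ij \<rho>]] by simp
    qed (intro cpm_homD(5)[OF f] cpm_homD(5)[OF g] ij)+
  qed (simp_all add: cpm_homD[OF f] cpm_homD[OF g])
  then show ?thesis using cpm_homD[OF f] cpm_homD[OF g] by simp
qed

text \<open>Needed for composite arrows, whose entries are sums over the components of the middle
  object.\<close>

lemma completely_positive_finsum:
  assumes H: "fd_hilbert_space H" and K: "fd_hilbert_space K" and "finite A"
    and "\<And>i. i \<in> A \<Longrightarrow> \<Phi> i \<in> completely_positive_maps H K"
  shows "(\<lambda>\<rho> \<in> carrier (\<L> H). \<Oplus>\<^bsub>\<L> K\<^esub>i\<in>A. \<Phi> i \<rho>) \<in> completely_positive_maps H K"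
  using assms(3,4)
proof (induction A rule: finite_induct)
  interpret LK: Module.module class_ring "\<L> K" by (intro operators_module fd_hilbert_space_module K)
  case empty
  show ?case using completely_positive_zero[OF K] by (simp add: restrict_def)
next
  interpret LK: Module.module class_ring "\<L> K" by (intro operators_module fd_hilbert_space_module K)
  case (insert a A)
  have "(\<lambda>\<rho> \<in> carrier (\<L> H). \<Oplus>\<^bsub>\<L> K\<^esub>i\<in>insert a A. \<Phi> i \<rho>) =
      (\<lambda>\<rho> \<in> carrier (\<L> H). \<Phi> a \<rho> \<oplus>\<^bsub>\<L> K\<^esub> (\<lambda>\<rho> \<in> carrier (\<L> H). \<Oplus>\<^bsub>\<L> K\<^esub>i\<in>A. \<Phi> i \<rho>) \<rho>)"
    using insert.hyps insert.prems
    by (intro restrict_ext) (simp add: completely_positive_closed[OF H K] Pi_def)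
  then show ?case
    using completely_positive_add[OF H K insert.IH insert.prems] insert.prems by (simp only:) blast
qed

lemma
  assumes X: "X \<in> cpm_objects" and Y: "Y \<in> cpm_objects" and Z: "Z \<in> cpm_objects"
    and f: "f \<in> cpm_hom X Y" and g: "g \<in> cpm_hom Y Z"
  shows cpm_comp_hom: "cpm_comp g f \<in> cpm_hom X Z"
    and linear_function_comp:
      "v \<in> vectors X \<Longrightarrow> linear_function (cpm_comp g f) v = linear_function g (linear_function f v)"
proof -
  note f_hom = cpm_homD[OF f] and g_hom = cpm_homD[OF g]
  note entries_f = entries_closed[OF X Y f] and entries_g = entries_closed[OF Y Z g]
  show gf: "cpm_comp g f \<in> cpm_hom X Z"
  proof (rule cpm_homI)
    fix i k assume i: "i < length Z" and k: "k < length X"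
    note H = cpm_objects_nth[OF X k] and K = cpm_objects_nth[OF Y] and L = cpm_objects_nth[OF Z i]
    \<comment> \<open>A further restriction around each summand gives the form to which
      \<open>completely_positive_finsum\<close> applies.\<close>
    have "entries (cpm_comp g f) $$ (i, k) =
      (\<lambda>\<rho> \<in> carrier (\<L> (X ! k)). \<Oplus>\<^bsub>\<L> (Z ! i)\<^esub>j\<in>{..<length Y}.
        (\<lambda>\<rho> \<in> carrier (\<L> (X ! k)). (entries g $$ (i, j)) ((entries f $$ (j, k)) \<rho>)) \<rho>)"
      using i k by (simp add: cpm_comp_def f_hom g_hom cong: restrict_cong)
    also have "\<dots> \<in> completely_positive_maps (X ! k) (Z ! i)"
      using i k f_hom(5) g_hom(5)
      by (intro completely_positive_finsum H L completely_positive_compose[OF H K L]) auto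
    finally show "entries (cpm_comp g f) $$ (i, k) \<in> completely_positive_maps (X ! k) (Z ! i)" .
  qed (simp_all add: cpm_comp_def f_hom g_hom)
  assume v: "v \<in> vectors X"
  then have vk: "k < length X \<Longrightarrow> v $ k \<in> carrier (\<L> (X ! k))" for k
    by (simp add: carrier_operator_sum)
  show "linear_function (cpm_comp g f) v = linear_function g (linear_function f v)"
  proof (rule eq_vecI)
    fix i assume "i < dim_vec (linear_function g (linear_function f v))"
    then have i: "i < length Z" by (simp add: linear_function_dim[OF Y Z g])
    interpret L: Module.module class_ring "\<L> (Z ! i)" by (rule operators_nth_module[OF Z i])
    have "linear_function (cpm_comp g f) v $ i =
      (\<Oplus>\<^bsub>\<L> (Z ! i)\<^esub>k\<in>{..<length X}. \<Oplus>\<^bsub>\<L> (Z ! i)\<^esub>j\<in>{..<length Y}.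
        (entries g $$ (i, j)) ((entries f $$ (j, k)) (v $ k)))"
      unfolding linear_function_nth[OF X Z gf i] using i vk
      by (intro L.finsum_cong')
        (auto simp: cpm_comp_def f_hom g_hom intro!: L.finsum_closed entries_f entries_g)
    \<comment> \<open>The two finite sums are interchanged, so that for each \<open>j\<close>
      linearity of the entry of \<open>g\<close> can pull the sum over \<open>k\<close> inside,
      where it is a component of \<open>linear_function f v\<close>.\<close>
    also have "\<dots> = (\<Oplus>\<^bsub>\<L> (Z ! i)\<^esub>j\<in>{..<length Y}. \<Oplus>\<^bsub>\<L> (Z ! i)\<^esub>k\<in>{..<length X}.
        (entries g $$ (i, j)) ((entries f $$ (j, k)) (v $ k)))"
      using i vk by (intro L.add.finprod_finprod_swap) (auto intro!: entries_f entries_g)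
    also have "\<dots> = (\<Oplus>\<^bsub>\<L> (Z ! i)\<^esub>j\<in>{..<length Y}. (entries g $$ (i, j)) (linear_function f v $ j))"
    proof (rule L.finsum_cong')
      fix j assume "j \<in> {..<length Y}"
      then have j: "j < length Y" by simp
      show "(\<Oplus>\<^bsub>\<L> (Z ! i)\<^esub>k\<in>{..<length X}. (entries g $$ (i, j)) ((entries f $$ (j, k)) (v $ k))) =
          (entries g $$ (i, j)) (linear_function f v $ j)"
        unfolding linear_function_nth[OF X Y f j] using i j vk
        by (intro complex_linear_finsum[symmetric, OF operators_nth_module[OF Y j]
            operators_nth_module[OF Z i] entries_linear[OF Y Z g i j]]) (auto intro!: entries_f)
    qed (use i linear_function_closed[OF X Y f v] in \<open>auto simp: carrier_operator_sum intro!: entries_g\<close>)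
    finally show "linear_function (cpm_comp g f) v $ i = linear_function g (linear_function f v) $ i"
      by (simp add: linear_function_nth[OF Y Z g i])
  qed (simp add: linear_function_dim[OF X Z gf] linear_function_dim[OF Y Z g])
qed

lemma
  assumes X: "X \<in> cpm_objects"
  shows cpm_id_hom: "cpm_id X \<in> cpm_hom X X"
    and linear_function_id: "v \<in> vectors X \<Longrightarrow> linear_function (cpm_id X) v = v"
proof -
  show hom: "cpm_id X \<in> cpm_hom X X"
  proof (rule cpm_homI)
    fix i j assume "i < length X" "j < length X"
    then show "entries (cpm_id X) $$ (i, j) \<in> completely_positive_maps (X ! j) (X ! i)"
      by (cases "i = j")
        (auto simp: cpm_id_def intro!: completely_positive_ident completely_positive_zero cpm_objects_nth[OF X])
  qed (simp_all add: cpm_id_def)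
  assume v: "v \<in> vectors X"
  show "linear_function (cpm_id X) v = v"
  proof (rule eq_vecI)
    fix i assume "i < dim_vec v"
    then have i: "i < length X" using v by (simp add: carrier_operator_sum)
    interpret L: Module.module class_ring "\<L> (X ! i)" by (rule operators_nth_module[OF X i])
    have "linear_function (cpm_id X) v $ i =
        (\<Oplus>\<^bsub>\<L> (X ! i)\<^esub>j\<in>{..<length X}. if i = j then (\<lambda>_. v $ i) j else \<zero>\<^bsub>\<L> (X ! i)\<^esub>)"
      unfolding linear_function_nth[OF X X hom i] using i v
      by (intro L.finsum_cong') (auto simp: cpm_id_def carrier_operator_sum)
    also have "\<dots> = v $ i"
      using i v by (subst L.finsum_singleton) (auto simp: carrier_operator_sum)
    finally show "linear_function (cpm_id X) v $ i = v $ i" .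
  qed (use v in \<open>simp add: linear_function_dim[OF X X hom] carrier_operator_sum\<close>)
qed

lemma
  assumes X: "X \<in> cpm_objects" and Y: "Y \<in> cpm_objects"
  shows cpm_zero_hom: "cpm_zero X Y \<in> cpm_hom X Y"
    and linear_function_zero_arrow:
      "v \<in> vectors X \<Longrightarrow> linear_function (cpm_zero X Y) v = \<zero>\<^bsub>operator_sum Y\<^esub>"
proof -
  show hom: "cpm_zero X Y \<in> cpm_hom X Y"
    by (rule cpm_homI) (simp_all add: cpm_zero_def completely_positive_zero cpm_objects_nth[OF Y])
  assume v: "v \<in> vectors X"
  show "linear_function (cpm_zero X Y) v = \<zero>\<^bsub>operator_sum Y\<^esub>"
  proof (rule eq_vecI)
    fix i assume "i < dim_vec \<zero>\<^bsub>operator_sum Y\<^esub>"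
    then have i: "i < length Y" by (simp add: operator_sum_ops)
    interpret L: Module.module class_ring "\<L> (Y ! i)" by (rule operators_nth_module[OF Y i])
    have "linear_function (cpm_zero X Y) v $ i = (\<Oplus>\<^bsub>\<L> (Y ! i)\<^esub>j\<in>{..<length X}. \<zero>\<^bsub>\<L> (Y ! i)\<^esub>)"
      unfolding linear_function_nth[OF X Y hom i] using i v
      by (intro L.finsum_cong') (auto simp: cpm_zero_def carrier_operator_sum)
    then show "linear_function (cpm_zero X Y) v $ i = \<zero>\<^bsub>operator_sum Y\<^esub> $ i"
      using i by (simp add: operator_sum_ops)
  qed (simp add: linear_function_dim[OF X Y hom] operator_sum_ops)
qed

lemma
  assumes X: "X \<in> cpm_objects" and Y: "Y \<in> cpm_objects"
    and f: "f \<in> cpm_hom X Y" and g: "g \<in> cpm_hom X Y"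
  shows cpm_add_hom: "cpm_add f g \<in> cpm_hom X Y"
    and linear_function_add_arrow:
      "v \<in> vectors X \<Longrightarrow>
        linear_function (cpm_add f g) v = linear_function f v \<oplus>\<^bsub>operator_sum Y\<^esub> linear_function g v"
proof -
  show hom: "cpm_add f g \<in> cpm_hom X Y"
  proof (rule cpm_homI)
    fix i j assume ij: "i < length Y" "j < length X"
    show "entries (cpm_add f g) $$ (i, j) \<in> completely_positive_maps (X ! j) (Y ! i)"
      using ij completely_positive_add[OF cpm_objects_nth[OF X ij(2)] cpm_objects_nth[OF Y ij(1)]
          cpm_homD(5)[OF g ij] cpm_homD(5)[OF f ij]]
      by (simp add: cpm_add_def cpm_homD[OF f])
  qed (simp_all add: cpm_add_def cpm_homD[OF f])
  assume v: "v \<in> vectors X"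
  show "linear_function (cpm_add f g) v = linear_function f v \<oplus>\<^bsub>operator_sum Y\<^esub> linear_function g v"
  proof (rule eq_vecI)
    fix i assume "i < dim_vec (linear_function f v \<oplus>\<^bsub>operator_sum Y\<^esub> linear_function g v)"
    then have i: "i < length Y" by (simp add: operator_sum_ops)
    interpret L: Module.module class_ring "\<L> (Y ! i)" by (rule operators_nth_module[OF Y i])
    have "linear_function (cpm_add f g) v $ i = (\<Oplus>\<^bsub>\<L> (Y ! i)\<^esub>j\<in>{..<length X}.
        (entries f $$ (i, j)) (v $ j) \<oplus>\<^bsub>\<L> (Y ! i)\<^esub> (entries g $$ (i, j)) (v $ j))"
      unfolding linear_function_nth[OF X Y hom i] using i v
      by (intro L.finsum_cong') (auto simp: cpm_add_def carrier_operator_sum cpm_homD[OF f]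
        entries_closed[OF X Y f] entries_closed[OF X Y g])
    also have "\<dots> = linear_function f v $ i \<oplus>\<^bsub>\<L> (Y ! i)\<^esub> linear_function g v $ i"
      unfolding linear_function_nth[OF X Y f i] linear_function_nth[OF X Y g i] using i v
      by (intro L.finsum_addf) (auto simp: carrier_operator_sum entries_closed[OF X Y f] entries_closed[OF X Y g])
    finally show "linear_function (cpm_add f g) v $ i =
        (linear_function f v \<oplus>\<^bsub>operator_sum Y\<^esub> linear_function g v) $ i"
      using i by (simp add: operator_sum_ops)
  qed (simp add: linear_function_dim[OF X Y hom] operator_sum_ops)
qed

section \<open>Block arrows\<close>

text \<open>The common shape of direct sums, symmetries, pairings and projections, and also of an
  arbitrary arrow once it is split for the trace. One computation of its linear function serves them
  all.\<close>

definition cpm_block ::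
    "'a cpm_arrow \<Rightarrow> 'a cpm_arrow \<Rightarrow> 'a cpm_arrow \<Rightarrow> 'a cpm_arrow \<Rightarrow> 'a cpm_arrow" where
  "cpm_block f11 f12 f21 f22 =
     \<lparr>source = source f11 @ source f22, target = target f11 @ target f22,
      entries = four_block_mat (entries f11) (entries f12) (entries f21) (entries f22)\<rparr>"

text \<open>Block matrix times block vector: the sum along row \<open>i\<close> splits at column
  \<open>length X\<close>, and the position of \<open>i\<close> relative to \<open>length Y\<close>
  decides whether the upper or the lower pair of blocks is read.\<close>

lemma
  assumes X: "X \<in> cpm_objects" and U: "U \<in> cpm_objects" and Y: "Y \<in> cpm_objects" and V: "V \<in> cpm_objects"
    and f11: "f11 \<in> cpm_hom X Y" and f12: "f12 \<in> cpm_hom U Y"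
    and f21: "f21 \<in> cpm_hom X V" and f22: "f22 \<in> cpm_hom U V"
  shows cpm_block_hom: "cpm_block f11 f12 f21 f22 \<in> cpm_hom (X @ U) (Y @ V)"
    and linear_function_block:
      "x \<in> vectors X \<Longrightarrow> u \<in> vectors U \<Longrightarrow>
       linear_function (cpm_block f11 f12 f21 f22) (x @\<^sub>v u) =
         (linear_function f11 x \<oplus>\<^bsub>operator_sum Y\<^esub> linear_function f12 u) @\<^sub>v
         (linear_function f21 x \<oplus>\<^bsub>operator_sum V\<^esub> linear_function f22 u)"
proof -
  note homs = cpm_homD[OF f11] cpm_homD[OF f12] cpm_homD[OF f21] cpm_homD[OF f22]
  let ?F = "cpm_block f11 f12 f21 f22"
  have XU: "X @ U \<in> cpm_objects" and YV: "Y @ V \<in> cpm_objects"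
    using X U Y V by (simp_all add: cpm_objects_append)
  show F: "?F \<in> cpm_hom (X @ U) (Y @ V)"
  proof (rule cpm_homI)
    fix i j assume "i < length (Y @ V)" "j < length (X @ U)"
    then show "entries ?F $$ (i, j) \<in> completely_positive_maps ((X @ U) ! j) ((Y @ V) ! i)"
      by (simp add: cpm_block_def homs nth_append)
  qed (simp_all add: cpm_block_def homs)
  assume x: "x \<in> vectors X" and u: "u \<in> vectors U"
  then have xj: "j < length X \<Longrightarrow> x $ j \<in> carrier (\<L> (X ! j))"
    and uj: "j < length U \<Longrightarrow> u $ j \<in> carrier (\<L> (U ! j))" for j
    by (simp_all add: carrier_operator_sum)
  note dims = operator_sum_dim[OF x] operator_sum_dim[OF u]
  note xu = operator_sum_append[OF x u]
  show "linear_function ?F (x @\<^sub>v u) =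
      (linear_function f11 x \<oplus>\<^bsub>operator_sum Y\<^esub> linear_function f12 u) @\<^sub>v
      (linear_function f21 x \<oplus>\<^bsub>operator_sum V\<^esub> linear_function f22 u)" (is "_ = ?r")
  proof (rule eq_vecI)
    fix i assume "i < dim_vec ?r"
    then have i: "i < length (Y @ V)" by (simp add: operator_sum_ops)
    interpret L: Module.module class_ring "\<L> ((Y @ V) ! i)" by (rule operators_nth_module[OF YV i])
    have cl: "(entries ?F $$ (i, j)) ((x @\<^sub>v u) $ j) \<in> carrier (\<L> ((Y @ V) ! i))"
      if "j < length (X @ U)" for j
      using entries_closed[OF XU YV F i that] xu[unfolded carrier_operator_sum] that by blast
    have clx: "(entries ?F $$ (i, j)) (x $ j) \<in> carrier (\<L> ((Y @ V) ! i))" if "j < length X" for j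
      using cl[of j] that by (simp add: dims)
    have clu: "(entries ?F $$ (i, length X + j)) (u $ j) \<in> carrier (\<L> ((Y @ V) ! i))"
      if "j < length U" for j
      using cl[of "length X + j"] that by (simp add: dims)
    have "linear_function ?F (x @\<^sub>v u) $ i =
        (\<Oplus>\<^bsub>\<L> ((Y @ V) ! i)\<^esub>j\<in>{..<length X}. (entries ?F $$ (i, j)) (x $ j)) \<oplus>\<^bsub>\<L> ((Y @ V) ! i)\<^esub>
        (\<Oplus>\<^bsub>\<L> ((Y @ V) ! i)\<^esub>j\<in>{..<length U}. (entries ?F $$ (i, length X + j)) (u $ j))"
      (is "_ = ?s")
    proof -
      have "linear_function ?F (x @\<^sub>v u) $ i =
        (\<Oplus>\<^bsub>\<L> ((Y @ V) ! i)\<^esub>j\<in>{..<length X}. (entries ?F $$ (i, j)) ((x @\<^sub>v u) $ j)) \<oplus>\<^bsub>\<L> ((Y @ V) ! i)\<^esub>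
        (\<Oplus>\<^bsub>\<L> ((Y @ V) ! i)\<^esub>j\<in>{..<length U}. (entries ?F $$ (i, length X + j)) ((x @\<^sub>v u) $ (length X + j)))"
        unfolding linear_function_nth[OF XU YV F i] length_append
        using cl by (intro L.finsum_lessThan_add) simp
      also have "\<dots> = ?s"
        using clx clu
        by (intro arg_cong2[where f = "\<lambda>a b. a \<oplus>\<^bsub>\<L> ((Y @ V) ! i)\<^esub> b"] L.finsum_cong')
          (auto simp: dims)
      finally show ?thesis .
    qed
    also have "\<dots> = ?r $ i"
    proof (cases "i < length Y")
      case True
      have "?s = linear_function f11 x $ i \<oplus>\<^bsub>\<L> ((Y @ V) ! i)\<^esub> linear_function f12 u $ i"
        unfolding linear_function_nth[OF X Y f11 True] linear_function_nth[OF U Y f12 True]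
        using True xj uj
        by (intro arg_cong2[where f = "\<lambda>a b. a \<oplus>\<^bsub>\<L> ((Y @ V) ! i)\<^esub> b"])
          (simp_all add: nth_append, auto simp: cpm_block_def homs intro!:
            abelian_monoid.finsum_cong'[OF abelian_group.axioms(1)[OF complex_module_abelian_group[OF operators_nth_module[OF Y]]]]
            entries_closed[OF X Y f11] entries_closed[OF U Y f12])
      then show ?thesis
        using True by (simp add: operator_sum_ops nth_append)
    next
      case False
      define k where "k = i - length Y"
      have k: "k < length V" "i = length Y + k" using i False by (simp_all add: k_def)
      have "?s = linear_function f21 x $ k \<oplus>\<^bsub>\<L> ((Y @ V) ! i)\<^esub> linear_function f22 u $ k"
        unfolding linear_function_nth[OF X V f21 k(1)] linear_function_nth[OF U V f22 k(1)]
        using k xj uj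
        by (intro arg_cong2[where f = "\<lambda>a b. a \<oplus>\<^bsub>\<L> ((Y @ V) ! i)\<^esub> b"])
          (simp_all add: nth_append, auto simp: cpm_block_def homs intro!:
            abelian_monoid.finsum_cong'[OF abelian_group.axioms(1)[OF complex_module_abelian_group[OF operators_nth_module[OF V]]]]
            entries_closed[OF X V f21] entries_closed[OF U V f22])
      then show ?thesis
        using k by (simp add: operator_sum_ops nth_append)
    qed
    finally show "linear_function ?F (x @\<^sub>v u) $ i = ?r $ i" .
  qed (simp add: linear_function_dim[OF XU YV F] operator_sum_ops)
qed

text \<open>Connects the \<open>split_block\<close> in \<open>cpm_trace\<close> with
  \<open>cpm_block\<close>: the four submatrices are themselves arrows, since each of their entries
  is an entry of \<open>f\<close>.\<close>

lemma split_cpm_block: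
  assumes f: "f \<in> cpm_hom (X @ U) (Y @ V)"
    and split: "split_block (entries f) (length Y) (length X) = (E11, E12, E21, E22)"
  defines "f11 \<equiv> \<lparr>source = X, target = Y, entries = E11\<rparr>"
    and "f12 \<equiv> \<lparr>source = U, target = Y, entries = E12\<rparr>"
    and "f21 \<equiv> \<lparr>source = X, target = V, entries = E21\<rparr>"
    and "f22 \<equiv> \<lparr>source = U, target = V, entries = E22\<rparr>"
  shows "f11 \<in> cpm_hom X Y" "f12 \<in> cpm_hom U Y" "f21 \<in> cpm_hom X V" "f22 \<in> cpm_hom U V"
    "f = cpm_block f11 f12 f21 f22"
proof -
  note f_hom = cpm_homD[OF f]
  note block = split_block[OF split, of "length V" "length U"]
  have E: "E11 \<in> carrier_mat (length Y) (length X)" "E12 \<in> carrier_mat (length Y) (length U)"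
    "E21 \<in> carrier_mat (length V) (length X)" "E22 \<in> carrier_mat (length V) (length U)"
    "entries f = four_block_mat E11 E12 E21 E22"
    using block f_hom by simp_all
  then show "f = cpm_block f11 f12 f21 f22"
    using f_hom by (simp add: cpm_block_def f11_def f12_def f21_def f22_def)
  have entry: "four_block_mat E11 E12 E21 E22 $$ (i, j) \<in> completely_positive_maps ((X @ U) ! j) ((Y @ V) ! i)"
    if "i < length (Y @ V)" "j < length (X @ U)" for i j
    using f_hom(5)[OF that] E(5) by simp
  have "E11 $$ (i, j) \<in> completely_positive_maps (X ! j) (Y ! i)" if "i < length Y" "j < length X" for i j
    using entry[of i j] that E(1-4) by (simp add: nth_append)
  then show "f11 \<in> cpm_hom X Y" using E(1) by (intro cpm_homI) (simp_all add: f11_def)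
  have "E12 $$ (i, j) \<in> completely_positive_maps (U ! j) (Y ! i)" if "i < length Y" "j < length U" for i j
    using entry[of i "length X + j"] that E(1-4) by (simp add: nth_append)
  then show "f12 \<in> cpm_hom U Y" using E(2) by (intro cpm_homI) (simp_all add: f12_def)
  have "E21 $$ (i, j) \<in> completely_positive_maps (X ! j) (V ! i)" if "i < length V" "j < length X" for i j
    using entry[of "length Y + i" j] that E(1-4) by (simp add: nth_append)
  then show "f21 \<in> cpm_hom X V" using E(3) by (intro cpm_homI) (simp_all add: f21_def)
  have "E22 $$ (i, j) \<in> completely_positive_maps (U ! j) (V ! i)" if "i < length V" "j < length U" for i j
    using entry[of "length Y + i" "length X + j"] that E(1-4) by (simp add: nth_append)
  then show "f22 \<in> cpm_hom U V" using E(4) by (intro cpm_homI) (simp_all add: f22_def)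
qed


section \<open>The symmetric monoidal category\<close>

text \<open>Reads the objects off the record, so that typing reduces to equations between sources
  and targets, which rewriting can settle.\<close>

definition is_cpm_arrow :: "'a cpm_arrow \<Rightarrow> bool" where
  "is_cpm_arrow f \<longleftrightarrow>
     source f \<in> cpm_objects \<and> target f \<in> cpm_objects \<and> f \<in> cpm_hom (source f) (target f)"

lemma is_cpm_arrowD:
  assumes "is_cpm_arrow f"
  shows "source f \<in> cpm_objects" "target f \<in> cpm_objects" "f \<in> cpm_hom (source f) (target f)"
  using assms by (simp_all add: is_cpm_arrow_def)

lemma cpm_hom_iff:
  assumes "X \<in> cpm_objects" "Y \<in> cpm_objects"
  shows "f \<in> cpm_hom X Y \<longleftrightarrow> is_cpm_arrow f \<and> source f = X \<and> target f = Y"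
  using assms cpm_homD(1,2)[of f X Y] by (auto simp: is_cpm_arrow_def)

lemma is_cpm_arrow_eqI:
  assumes "is_cpm_arrow f" "is_cpm_arrow g" "source f = source g" "target f = target g"
    "\<And>v. v \<in> vectors (source g) \<Longrightarrow> linear_function f v = linear_function g v"
  shows "f = g"
  using assms by (intro cpm_hom_eqI[of "source g" "target g"]) (auto dest: is_cpm_arrowD)

text \<open>Every tuple over \<open>X @ U\<close> is the concatenation of its two parts, so
  concatenations suffice as test vectors.\<close>

lemma is_cpm_arrow_append_eqI:
  assumes f: "is_cpm_arrow f" and g: "is_cpm_arrow g"
    and st: "source f = X @ U" "source g = X @ U" "target f = target g"
    and eq: "\<And>x u. x \<in> vectors X \<Longrightarrow> u \<in> vectors U \<Longrightarrow>
      linear_function f (x @\<^sub>v u) = linear_function g (x @\<^sub>v u)"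
  shows "f = g"
proof (rule is_cpm_arrow_eqI[OF f g])
  fix v assume "v \<in> vectors (source g)"
  then have v: "v \<in> vectors (X @ U)" by (simp add: st)
  show "linear_function f v = linear_function g v"
    using eq[OF operator_sum_vec_first[OF v] operator_sum_vec_last[OF v]]
    by (simp add: operator_sum_append_first_last[OF v])
qed (simp_all add: st)

lemma linear_function_arrow_closed:
  assumes "is_cpm_arrow f" "target f = Y" "v \<in> vectors (source f)"
  shows "linear_function f v \<in> vectors Y"
  using assms linear_function_closed[OF is_cpm_arrowD] by auto

lemma linear_function_arrow_add:
  assumes "is_cpm_arrow f" "source f = X"
    "v \<in> vectors X" "w \<in> vectors X"
  shows "linear_function f (v \<oplus>\<^bsub>operator_sum X\<^esub> w) =
    linear_function f v \<oplus>\<^bsub>operator_sum (target f)\<^esub> linear_function f w"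
  using assms linear_function_add[OF is_cpm_arrowD] by auto

lemma linear_function_arrow_zero:
  assumes "is_cpm_arrow f" "source f = X"
  shows "linear_function f \<zero>\<^bsub>operator_sum X\<^esub> = \<zero>\<^bsub>operator_sum (target f)\<^esub>"
  using assms linear_function_zero[OF is_cpm_arrowD] by auto

section \<open>Typing and action of the structural arrows\<close>

lemma source_target_simps:
  "source (cpm_comp g f) = source f" "target (cpm_comp g f) = target g"
  "source (cpm_id X) = X" "target (cpm_id X) = X"
  "source (cpm_zero X Y) = X" "target (cpm_zero X Y) = Y"
  "source (cpm_add f g) = source f" "target (cpm_add f g) = target f"
  "source (cpm_oplus f g) = source f @ source g" "target (cpm_oplus f g) = target f @ target g"
  "source (cpm_sym X Y) = X @ Y" "target (cpm_sym X Y) = Y @ X"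
  "source (cpm_block f11 f12 f21 f22) = source f11 @ source f22"
  "target (cpm_block f11 f12 f21 f22) = target f11 @ target f22"
  by (simp_all add: cpm_comp_def cpm_id_def cpm_zero_def cpm_add_def cpm_oplus_def cpm_sym_def cpm_block_def)

lemma is_cpm_arrow_comp:
  assumes "is_cpm_arrow g" "is_cpm_arrow f" "source g = target f"
  shows "is_cpm_arrow (cpm_comp g f)"
  using assms cpm_comp_hom[of "source f" "source g" "target g" f g]
  by (simp add: is_cpm_arrow_def source_target_simps)

lemma linear_function_arrow_comp:
  assumes "is_cpm_arrow g" "is_cpm_arrow f" "source g = target f" "v \<in> vectors (source f)"
  shows "linear_function (cpm_comp g f) v = linear_function g (linear_function f v)"
  using assms linear_function_comp[of "source f" "source g" "target g" f g v]
  by (simp add: is_cpm_arrow_def)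

lemma is_cpm_arrow_id: "X \<in> cpm_objects \<Longrightarrow> is_cpm_arrow (cpm_id X)"
  by (simp add: is_cpm_arrow_def source_target_simps cpm_id_hom)

lemma is_cpm_arrow_zero: "X \<in> cpm_objects \<Longrightarrow> Y \<in> cpm_objects \<Longrightarrow> is_cpm_arrow (cpm_zero X Y)"
  by (simp add: is_cpm_arrow_def source_target_simps cpm_zero_hom)

lemma cpm_oplus_block: "cpm_oplus f g = cpm_block f (cpm_zero (source g) (target f)) (cpm_zero (source f) (target g)) g"
  by (simp add: cpm_oplus_def cpm_block_def)

lemma cpm_sym_block: "cpm_sym X Y = cpm_block (cpm_zero X Y) (cpm_id Y) (cpm_id X) (cpm_zero Y X)"
  by (simp add: cpm_sym_def cpm_block_def source_target_simps)

lemma is_cpm_arrow_block: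
  assumes "is_cpm_arrow f11" "is_cpm_arrow f12" "is_cpm_arrow f21" "is_cpm_arrow f22"
    and "source f12 = source f22" "source f21 = source f11" "target f12 = target f11" "target f21 = target f22"
  shows "is_cpm_arrow (cpm_block f11 f12 f21 f22)"
  using assms cpm_block_hom[of "source f11" "source f22" "target f11" "target f22" f11 f12 f21 f22]
  by (simp add: is_cpm_arrow_def source_target_simps cpm_objects_append)

lemma linear_function_arrow_block:
  assumes "is_cpm_arrow f11" "is_cpm_arrow f12" "is_cpm_arrow f21" "is_cpm_arrow f22"
    and "source f12 = source f22" "source f21 = source f11" "target f12 = target f11" "target f21 = target f22"
    and "x \<in> vectors (source f11)" "u \<in> vectors (source f22)"
  shows "linear_function (cpm_block f11 f12 f21 f22) (x @\<^sub>v u) =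
         (linear_function f11 x \<oplus>\<^bsub>operator_sum (target f11)\<^esub> linear_function f12 u) @\<^sub>v
         (linear_function f21 x \<oplus>\<^bsub>operator_sum (target f22)\<^esub> linear_function f22 u)"
  using assms linear_function_block[of "source f11" "source f22" "target f11" "target f22" f11 f12 f21 f22]
  by (simp add: is_cpm_arrow_def)

lemmas operator_sum_monoid =
  abelian_group.axioms(1)[OF complex_module_abelian_group[OF operator_sum_module]]

lemmas operator_sum_simps =
  abelian_monoid.a_closed[OF operator_sum_monoid] abelian_monoid.zero_closed[OF operator_sum_monoid]
  abelian_monoid.l_zero[OF operator_sum_monoid] abelian_monoid.r_zero[OF operator_sum_monoid]

lemma is_cpm_arrow_oplus: "is_cpm_arrow f \<Longrightarrow> is_cpm_arrow g \<Longrightarrow> is_cpm_arrow (cpm_oplus f g)"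
  unfolding cpm_oplus_block
  by (intro is_cpm_arrow_block is_cpm_arrow_zero) (simp_all add: source_target_simps is_cpm_arrowD)

lemma linear_function_oplus:
  assumes "is_cpm_arrow f" "is_cpm_arrow g"
    "x \<in> vectors (source f)" "u \<in> vectors (source g)"
  shows "linear_function (cpm_oplus f g) (x @\<^sub>v u) = linear_function f x @\<^sub>v linear_function g u"
  unfolding cpm_oplus_block using assms
  by (subst linear_function_arrow_block)
    (simp_all add: source_target_simps is_cpm_arrowD is_cpm_arrow_zero linear_function_zero_arrow
      operator_sum_simps linear_function_arrow_closed)

lemma is_cpm_arrow_sym: "X \<in> cpm_objects \<Longrightarrow> Y \<in> cpm_objects \<Longrightarrow> is_cpm_arrow (cpm_sym X Y)"
  unfolding cpm_sym_block
  by (intro is_cpm_arrow_block is_cpm_arrow_zero is_cpm_arrow_id) (simp_all add: source_target_simps)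

lemma linear_function_sym:
  assumes "X \<in> cpm_objects" "Y \<in> cpm_objects" "x \<in> vectors X" "y \<in> vectors Y"
  shows "linear_function (cpm_sym X Y) (x @\<^sub>v y) = y @\<^sub>v x"
  unfolding cpm_sym_block using assms
  by (subst linear_function_arrow_block)
    (simp_all add: source_target_simps is_cpm_arrow_id is_cpm_arrow_zero linear_function_zero_arrow
      operator_sum_simps linear_function_id)

lemma append_vec_assoc: "(x @\<^sub>v y) @\<^sub>v z = x @\<^sub>v (y @\<^sub>v z)"
  by (intro eq_vecI) auto

lemma append_vec_empty: "dim_vec x = 0 \<Longrightarrow> x @\<^sub>v y = y" "dim_vec x = 0 \<Longrightarrow> y @\<^sub>v x = y"
  by (auto intro!: eq_vecI)

lemmas cpm_arrow_simps =
  source_target_simps is_cpm_arrowD(1,2) is_cpm_arrow_comp is_cpm_arrow_id is_cpm_arrow_zero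
  is_cpm_arrow_oplus is_cpm_arrow_sym cpm_objects_append

lemmas linear_function_simps =
  linear_function_arrow_closed linear_function_arrow_comp linear_function_id
  linear_function_oplus linear_function_sym operator_sum_append append_vec_assoc

lemma Nil_cpm_objects: "[] \<in> cpm_objects"
  by (simp add: cpm_objects_def)

lemma cpm_category: "category (cpm_objects :: 'a cpm_obj set) cpm_hom cpm_comp cpm_id"
proof
  fix W X Y Z :: "'a cpm_obj" and f g h
  assume "W \<in> cpm_objects" "X \<in> cpm_objects" "Y \<in> cpm_objects" "Z \<in> cpm_objects"
    "f \<in> cpm_hom W X" "g \<in> cpm_hom X Y" "h \<in> cpm_hom Y Z"
  then show "cpm_comp (cpm_comp h g) f = cpm_comp h (cpm_comp g f)"
    by (intro is_cpm_arrow_eqI) (simp_all add: cpm_hom_iff cpm_arrow_simps linear_function_simps)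
next
  fix X Y :: "'a cpm_obj" and f
  assume "X \<in> cpm_objects" "Y \<in> cpm_objects" "f \<in> cpm_hom X Y"
  then show "cpm_comp f (cpm_id X) = f" "cpm_comp (cpm_id Y) f = f"
    by (intro is_cpm_arrow_eqI; simp add: cpm_hom_iff cpm_arrow_simps linear_function_simps)+
qed (auto simp: cpm_hom_iff cpm_arrow_simps)

text \<open>Associators and unitors are identities here, so this removes every
  \<open>inverse_of\<close> from the trace axioms.\<close>

lemma cpm_inverse_of_id:
  assumes "X \<in> cpm_objects"
  shows "category.inverse_of cpm_hom cpm_comp cpm_id X X (cpm_id X) = cpm_id X"
proof -
  interpret category cpm_objects cpm_hom cpm_comp cpm_id by (rule cpm_category)
  show ?thesis
    unfolding inverse_of_def is_inverse_def using assms
    by (intro the_equality) (auto simp: ident_in_hom comp_ident_left[OF assms assms])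
qed

text \<open>Concatenation being strict, the coherence isomorphisms drop out through
  \<open>id_left\<close> and \<open>id_right\<close>. Naturality of \<open>cpm_assoc\<close> becomes
  strict associativity of \<open>cpm_oplus\<close> on arrows, and the hexagon says that moving
  \<open>X\<close> past \<open>Y @ Z\<close> is moving it past \<open>Y\<close> and then past
  \<open>Z\<close>; both are checked on vectors.\<close>

lemma cpm_symmetric_monoidal_category:
  "symmetric_monoidal_category (cpm_objects :: 'a cpm_obj set) cpm_hom cpm_comp cpm_id
    (@) cpm_oplus [] cpm_assoc cpm_lunit cpm_runit cpm_sym"
proof -
  interpret category cpm_objects cpm_hom cpm_comp cpm_id by (rule cpm_category)
  have id_iso: "is_iso X X (cpm_id X)" if "X \<in> cpm_objects" for X
    using that by (auto simp: is_iso_def is_inverse_def ident_in_hom comp_ident_left intro!: exI[of _ "cpm_id X"])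
  have id_left: "cpm_comp (cpm_id Y) f = f" if "is_cpm_arrow f" "target f = Y" for f Y
    using that comp_ident_left[of "source f" Y f] is_cpm_arrowD[OF that(1)] by (simp add: cpm_hom_iff)
  have id_right: "cpm_comp f (cpm_id X) = f" if "is_cpm_arrow f" "source f = X" for f X
    using that comp_ident_right[of X "target f" f] is_cpm_arrowD[OF that(1)] by (simp add: cpm_hom_iff)
  have tensor_id: "cpm_oplus (cpm_id X) (cpm_id Y) = cpm_id (X @ Y)"
    if "X \<in> cpm_objects" "Y \<in> cpm_objects" for X Y
    using that by (intro is_cpm_arrow_append_eqI[of _ _ X Y]) (simp_all add: cpm_arrow_simps linear_function_simps)
  have nil: "linear_function (cpm_id []) v = v" "dim_vec v = 0" if "v \<in> vectors []" for v
    using that by (auto simp: linear_function_id Nil_cpm_objects operator_sum_dim)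
  note simps = cpm_hom_iff cpm_arrow_simps linear_function_simps id_left id_right tensor_id
    cpm_assoc_def cpm_lunit_def cpm_runit_def Nil_cpm_objects id_iso
  show ?thesis
  proof
    fix X Y Z X' Y' Z' :: "'a cpm_obj" and f g f' g'
    assume "X \<in> cpm_objects" "Y \<in> cpm_objects" "Z \<in> cpm_objects"
      "X' \<in> cpm_objects" "Y' \<in> cpm_objects" "Z' \<in> cpm_objects"
      "f \<in> cpm_hom X Y" "g \<in> cpm_hom Y Z" "f' \<in> cpm_hom X' Y'" "g' \<in> cpm_hom Y' Z'"
    then show "cpm_oplus (cpm_comp g f) (cpm_comp g' f') = cpm_comp (cpm_oplus g g') (cpm_oplus f f')"
      by (intro is_cpm_arrow_append_eqI[of _ _ X X']) (simp_all add: simps)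
  next
    fix X Y :: "'a cpm_obj" assume "X \<in> cpm_objects" "Y \<in> cpm_objects"
    then show "cpm_comp (cpm_sym Y X) (cpm_sym X Y) = cpm_id (X @ Y)"
      by (intro is_cpm_arrow_append_eqI[of _ _ X Y]) (simp_all add: simps)
  next
    fix X Y Z X' Y' Z' :: "'a cpm_obj" and f g h
    assume *: "X \<in> cpm_objects" "Y \<in> cpm_objects" "Z \<in> cpm_objects"
      "X' \<in> cpm_objects" "Y' \<in> cpm_objects" "Z' \<in> cpm_objects"
      "f \<in> cpm_hom X X'" "g \<in> cpm_hom Y Y'" "h \<in> cpm_hom Z Z'"
    have "cpm_oplus (cpm_oplus f g) h = cpm_oplus f (cpm_oplus g h)"
    proof (rule is_cpm_arrow_append_eqI[of _ _ X "Y @ Z"])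
      fix x u assume x: "x \<in> vectors X" and u: "u \<in> vectors (Y @ Z)"
      define y z where "y = vec_first u (length Y)" "z = vec_last u (length Z)"
      have yz: "y \<in> vectors Y" "z \<in> vectors Z" "u = y @\<^sub>v z"
        using u by (simp_all add: y_z_def operator_sum_vec_first operator_sum_vec_last operator_sum_append_first_last)
      \<comment> \<open>The same vector, split before \<open>z\<close> instead of after
        \<open>x\<close>, as the outer \<open>cpm_oplus\<close> of this arrow requires.\<close>
      have "linear_function (cpm_oplus (cpm_oplus f g) h) (x @\<^sub>v u) =
          linear_function (cpm_oplus (cpm_oplus f g) h) ((x @\<^sub>v y) @\<^sub>v z)"
        by (simp add: yz append_vec_assoc)
      also have "\<dots> = linear_function f x @\<^sub>v linear_function g y @\<^sub>v linear_function h z"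
        using * x yz(1,2)
        by (subst linear_function_oplus) (simp_all add: cpm_hom_iff cpm_arrow_simps linear_function_simps)
      also have "\<dots> = linear_function (cpm_oplus f (cpm_oplus g h)) (x @\<^sub>v u)"
        using * x yz(1,2) by (simp add: yz(3) cpm_hom_iff cpm_arrow_simps linear_function_simps)
      finally show "linear_function (cpm_oplus (cpm_oplus f g) h) (x @\<^sub>v u) =
          linear_function (cpm_oplus f (cpm_oplus g h)) (x @\<^sub>v u)" .
    qed (use * in \<open>simp_all add: simps\<close>)
    then show "cpm_comp (cpm_assoc X' Y' Z') (cpm_oplus (cpm_oplus f g) h) =
        cpm_comp (cpm_oplus f (cpm_oplus g h)) (cpm_assoc X Y Z)"
      using * by (simp add: simps)
  next
    fix X Y :: "'a cpm_obj" and f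
    assume *: "X \<in> cpm_objects" "Y \<in> cpm_objects" "f \<in> cpm_hom X Y"
    have "cpm_oplus (cpm_id []) f = f"
    proof (rule is_cpm_arrow_append_eqI[of _ _ "[]" X])
      fix x u assume "x \<in> vectors ([] :: 'a cpm_obj)" "u \<in> vectors X"
      then show "linear_function (cpm_oplus (cpm_id []) f) (x @\<^sub>v u) = linear_function f (x @\<^sub>v u)"
        using * by (subst linear_function_oplus) (simp_all add: simps nil append_vec_empty)
    qed (use * in \<open>simp_all add: simps\<close>)
    then show "cpm_comp (cpm_lunit Y) (cpm_oplus (cpm_id []) f) = cpm_comp f (cpm_lunit X)"
      using * by (simp add: simps)
    have "cpm_oplus f (cpm_id []) = f"
    proof (rule is_cpm_arrow_append_eqI[of _ _ X "[]"])
      fix x u assume "x \<in> vectors X" "u \<in> vectors ([] :: 'a cpm_obj)"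
      then show "linear_function (cpm_oplus f (cpm_id [])) (x @\<^sub>v u) = linear_function f (x @\<^sub>v u)"
        using * by (subst linear_function_oplus) (simp_all add: simps nil append_vec_empty)
    qed (use * in \<open>simp_all add: simps\<close>)
    then show "cpm_comp (cpm_runit Y) (cpm_oplus f (cpm_id [])) = cpm_comp f (cpm_runit X)"
      using * by (simp add: simps)
  next
    fix X Y X' Y' :: "'a cpm_obj" and f g
    assume "X \<in> cpm_objects" "Y \<in> cpm_objects" "X' \<in> cpm_objects" "Y' \<in> cpm_objects"
      "f \<in> cpm_hom X X'" "g \<in> cpm_hom Y Y'"
    then show "cpm_comp (cpm_sym X' Y') (cpm_oplus f g) = cpm_comp (cpm_oplus g f) (cpm_sym X Y)"
      by (intro is_cpm_arrow_append_eqI[of _ _ X Y]) (simp_all add: simps)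
  next
    fix X Y Z :: "'a cpm_obj"
    assume *: "X \<in> cpm_objects" "Y \<in> cpm_objects" "Z \<in> cpm_objects"
    have "cpm_sym X (Y @ Z) = cpm_comp (cpm_oplus (cpm_id Y) (cpm_sym X Z)) (cpm_oplus (cpm_sym X Y) (cpm_id Z))"
    proof (rule is_cpm_arrow_append_eqI[of _ _ X "Y @ Z"])
      fix x u assume x: "x \<in> vectors X" and u: "u \<in> vectors (Y @ Z)"
      define y z where "y = vec_first u (length Y)" "z = vec_last u (length Z)"
      have yz: "y \<in> vectors Y" "z \<in> vectors Z" "u = y @\<^sub>v z"
        using u by (simp_all add: y_z_def operator_sum_vec_first operator_sum_vec_last operator_sum_append_first_last)
      have "x @\<^sub>v u \<in> vectors (X @ Y @ Z)"
        using operator_sum_append[OF x u] .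
      then have "linear_function (cpm_comp (cpm_oplus (cpm_id Y) (cpm_sym X Z)) (cpm_oplus (cpm_sym X Y) (cpm_id Z))) (x @\<^sub>v u) =
        linear_function (cpm_oplus (cpm_id Y) (cpm_sym X Z)) (linear_function (cpm_oplus (cpm_sym X Y) (cpm_id Z)) (x @\<^sub>v u))"
        using * by (subst linear_function_arrow_comp) (simp_all add: simps)
      also have "linear_function (cpm_oplus (cpm_sym X Y) (cpm_id Z)) (x @\<^sub>v u) =
          linear_function (cpm_oplus (cpm_sym X Y) (cpm_id Z)) ((x @\<^sub>v y) @\<^sub>v z)"
        by (simp add: yz append_vec_assoc)
      also have "\<dots> = y @\<^sub>v x @\<^sub>v z"
        using * x yz(1,2)
        by (subst linear_function_oplus) (simp_all add: cpm_arrow_simps linear_function_simps)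
      also have "linear_function (cpm_oplus (cpm_id Y) (cpm_sym X Z)) \<dots> = u @\<^sub>v x"
        using * x yz(1,2)
        by (subst linear_function_oplus) (simp_all add: cpm_arrow_simps linear_function_simps yz(3))
      also have "\<dots> = linear_function (cpm_sym X (Y @ Z)) (x @\<^sub>v u)"
        using * x u by (simp add: linear_function_sym cpm_arrow_simps)
      finally show "linear_function (cpm_sym X (Y @ Z)) (x @\<^sub>v u) =
        linear_function (cpm_comp (cpm_oplus (cpm_id Y) (cpm_sym X Z)) (cpm_oplus (cpm_sym X Y) (cpm_id Z))) (x @\<^sub>v u)" ..
    qed (use * in \<open>simp_all add: simps\<close>)
    then show "cpm_comp (cpm_assoc Y Z X) (cpm_comp (cpm_sym X (Y @ Z)) (cpm_assoc X Y Z)) =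
        cpm_comp (cpm_oplus (cpm_id Y) (cpm_sym X Z))
          (cpm_comp (cpm_assoc Y X Z) (cpm_oplus (cpm_sym X Y) (cpm_id Z)))"
      using * by (simp add: simps)
  qed (auto simp: simps)
qed

section \<open>Functions computed by arrows\<close>

text \<open>Allows a function on tuples to be recognised as an arrow from the way its formula is
  built: application of arrows, sums, zeros, concatenation and projections. Subtraction is absent
  from this list, so every solution below has to be written without it.\<close>

definition cpm_computable ::
    "'a cpm_obj \<Rightarrow> 'a cpm_obj \<Rightarrow> (('a \<Rightarrow> 'a) vec \<Rightarrow> ('a \<Rightarrow> 'a) vec) \<Rightarrow> bool" where
  "cpm_computable X Y \<phi> \<longleftrightarrow> (\<exists>f. is_cpm_arrow f \<and> source f = X \<and> target f = Y \<and>
     (\<forall>v \<in> vectors X. linear_function f v = \<phi> v))"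

lemma cpm_computableE:
  assumes "cpm_computable X Y \<phi>"
  obtains f where "is_cpm_arrow f" "source f = X" "target f = Y"
    "\<And>v. v \<in> vectors X \<Longrightarrow> linear_function f v = \<phi> v"
  using assms by (auto simp: cpm_computable_def)

lemma cpm_computable_arrow:
  assumes "is_cpm_arrow f" "target f = Y" "cpm_computable Z (source f) \<phi>"
  shows "cpm_computable Z Y (\<lambda>v. linear_function f (\<phi> v))"
proof -
  obtain g where "is_cpm_arrow g" "source g = Z" "target g = source f"
    "\<And>v. v \<in> vectors Z \<Longrightarrow> linear_function g v = \<phi> v"
    using assms(3) by (rule cpm_computableE) blast
  then show ?thesis
    using assms unfolding cpm_computable_def
    by (intro exI[of _ "cpm_comp f g"]) (simp add: cpm_arrow_simps linear_function_simps)
qed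

lemma cpm_computable_id: "X \<in> cpm_objects \<Longrightarrow> cpm_computable X X (\<lambda>v. v)"
  unfolding cpm_computable_def
  by (intro exI[of _ "cpm_id X"]) (simp add: cpm_arrow_simps linear_function_simps)

lemma cpm_computable_zero:
  "X \<in> cpm_objects \<Longrightarrow> Y \<in> cpm_objects \<Longrightarrow> cpm_computable X Y (\<lambda>_. \<zero>\<^bsub>operator_sum Y\<^esub>)"
  unfolding cpm_computable_def
  by (intro exI[of _ "cpm_zero X Y"]) (simp add: cpm_arrow_simps linear_function_zero_arrow)

lemma cpm_computable_add:
  assumes "cpm_computable X Y \<phi>" "cpm_computable X Y \<psi>"
  shows "cpm_computable X Y (\<lambda>v. \<phi> v \<oplus>\<^bsub>operator_sum Y\<^esub> \<psi> v)"
proof -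
  obtain f where f: "is_cpm_arrow f" "source f = X" "target f = Y"
    "\<And>v. v \<in> vectors X \<Longrightarrow> linear_function f v = \<phi> v"
    using assms(1) by (rule cpm_computableE) blast
  obtain g where g: "is_cpm_arrow g" "source g = X" "target g = Y"
    "\<And>v. v \<in> vectors X \<Longrightarrow> linear_function g v = \<psi> v"
    using assms(2) by (rule cpm_computableE) blast
  have X: "X \<in> cpm_objects" and Y: "Y \<in> cpm_objects" and "f \<in> cpm_hom X Y" "g \<in> cpm_hom X Y"
    using is_cpm_arrowD[OF f(1)] is_cpm_arrowD[OF g(1)] f g by simp_all
  then show ?thesis
    using f g cpm_add_hom[OF X Y] linear_function_add_arrow[OF X Y] unfolding cpm_computable_def
    by (intro exI[of _ "cpm_add f g"]) (simp add: cpm_hom_iff)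
qed

lemma cpm_computable_append:
  fixes X U Z :: "'a cpm_obj"
  assumes "cpm_computable Z X \<phi>" "cpm_computable Z U \<psi>"
  shows "cpm_computable Z (X @ U) (\<lambda>v. \<phi> v @\<^sub>v \<psi> v)"
proof -
  obtain f where f: "is_cpm_arrow f" "source f = Z" "target f = X"
    "\<And>v. v \<in> vectors Z \<Longrightarrow> linear_function f v = \<phi> v"
    using assms(1) by (rule cpm_computableE) blast
  obtain g where g: "is_cpm_arrow g" "source g = Z" "target g = U"
    "\<And>v. v \<in> vectors Z \<Longrightarrow> linear_function g v = \<psi> v"
    using assms(2) by (rule cpm_computableE) blast
  have obj: "X \<in> cpm_objects" "U \<in> cpm_objects" "Z \<in> cpm_objects"
    using is_cpm_arrowD(1,2)[OF f(1)] is_cpm_arrowD(1,2)[OF g(1)] f g by simp_all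
  \<comment> \<open>The pairing is a block arrow with column \<open>f\<close>, \<open>g\<close> and
    an empty second column: its source \<open>Z @ []\<close> is just \<open>Z\<close>.\<close>
  define b where "b = cpm_block f (cpm_zero [] X) g (cpm_zero [] U)"
  have b: "is_cpm_arrow b"
    unfolding b_def using f g obj
    by (intro is_cpm_arrow_block) (simp_all add: cpm_arrow_simps Nil_cpm_objects)
  have empty: "vec 0 (\<lambda>_. undefined) \<in> vectors ([] :: 'a cpm_obj)"
    by (simp add: carrier_operator_sum)
  have "linear_function b v = \<phi> v @\<^sub>v \<psi> v" if v: "v \<in> vectors Z" for v
  proof -
    have "linear_function b v = linear_function b (v @\<^sub>v vec 0 (\<lambda>_. undefined))"
      by (simp add: append_vec_empty)
    also have "\<dots> = \<phi> v @\<^sub>v \<psi> v"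
      unfolding b_def using f g obj v empty linear_function_arrow_closed[OF f(1,3)]
        linear_function_arrow_closed[OF g(1,3)]
      by (subst linear_function_arrow_block)
        (simp_all add: cpm_arrow_simps Nil_cpm_objects linear_function_zero_arrow operator_sum_simps)
    finally show ?thesis .
  qed
  then show ?thesis
    unfolding cpm_computable_def using b f g
    by (intro exI[of _ b]) (simp add: b_def source_target_simps)
qed

lemma
  fixes X U Z :: "'a cpm_obj"
  assumes X: "X \<in> cpm_objects" and U: "U \<in> cpm_objects" and \<phi>: "cpm_computable Z (X @ U) \<phi>"
  shows cpm_computable_vec_first: "cpm_computable Z X (\<lambda>v. vec_first (\<phi> v) (length X))"
    and cpm_computable_vec_last: "cpm_computable Z U (\<lambda>v. vec_last (\<phi> v) (length U))"
proof -
  obtain f where f: "is_cpm_arrow f" "source f = Z" "target f = X @ U"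
    "\<And>v. v \<in> vectors Z \<Longrightarrow> linear_function f v = \<phi> v"
    using \<phi> by (rule cpm_computableE) blast
  have \<phi>_closed: "\<phi> v \<in> vectors (X @ U)" if "v \<in> vectors Z" for v
    using linear_function_arrow_closed[OF f(1,3)] that f(2,4) by simp
  have Z: "Z \<in> cpm_objects" using is_cpm_arrowD(1)[OF f(1)] f(2) by simp
  have dim_zero: "dim_vec \<zero>\<^bsub>operator_sum ([] :: 'a cpm_obj)\<^esub> = 0"
    by (simp add: operator_sum_ops)
  \<comment> \<open>The projections are block arrows with one empty row: their targets are
    \<open>X @ []\<close> and \<open>[] @ U\<close>.\<close>
  define p q where "p = cpm_block (cpm_id X) (cpm_zero U X) (cpm_zero X []) (cpm_zero U [])"
    and "q = cpm_block (cpm_zero X []) (cpm_zero U []) (cpm_zero X U) (cpm_id U)"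
  have p: "is_cpm_arrow p" "source p = X @ U" "target p = X"
    and q: "is_cpm_arrow q" "source q = X @ U" "target q = U"
    unfolding p_def q_def using X U by (auto simp: cpm_arrow_simps Nil_cpm_objects intro!: is_cpm_arrow_block)
  have p_app: "linear_function p v = vec_first v (length X)"
    and q_app: "linear_function q v = vec_last v (length U)"
    if v: "v \<in> vectors (X @ U)" for v
  proof -
    note xu = operator_sum_vec_first[OF v] operator_sum_vec_last[OF v]
    have "linear_function p (vec_first v (length X) @\<^sub>v vec_last v (length U)) = vec_first v (length X)"
      unfolding p_def q_def using X U xu
      by (subst linear_function_arrow_block)
        (simp_all add: cpm_arrow_simps Nil_cpm_objects linear_function_zero_arrow operator_sum_simps
          linear_function_id append_vec_empty dim_zero)
    moreover have "linear_function q (vec_first v (length X) @\<^sub>v vec_last v (length U)) = vec_last v (length U)"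
      unfolding p_def q_def using X U xu
      by (subst linear_function_arrow_block)
        (simp_all add: cpm_arrow_simps Nil_cpm_objects linear_function_zero_arrow operator_sum_simps
          linear_function_id append_vec_empty dim_zero)
    ultimately show "linear_function p v = vec_first v (length X)" "linear_function q v = vec_last v (length U)"
      by (simp_all add: operator_sum_append_first_last[OF v])
  qed
  show "cpm_computable Z X (\<lambda>v. vec_first (\<phi> v) (length X))"
    unfolding cpm_computable_def using f p p_app \<phi>_closed
    by (intro exI[of _ "cpm_comp p f"]) (simp add: cpm_arrow_simps linear_function_simps)
  show "cpm_computable Z U (\<lambda>v. vec_last (\<phi> v) (length U))"
    unfolding cpm_computable_def using f q q_app \<phi>_closed
    by (intro exI[of _ "cpm_comp q f"]) (simp add: cpm_arrow_simps linear_function_simps)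
qed


section \<open>The trace as a feedback equation\<close>

text \<open>\<open>s\<close> stands for the map sending \<open>(x, u)\<close> to
  \<open>(I - f22)^-1 (u + f21 x)\<close>. The equivalence combines existence and uniqueness of the
  solution, and the equation mentions neither blocks nor subtraction.\<close>

definition is_feedback :: "'a cpm_obj \<Rightarrow> 'a cpm_obj \<Rightarrow> 'a cpm_arrow \<Rightarrow> 'a cpm_arrow \<Rightarrow> bool" where
  "is_feedback U X f s \<longleftrightarrow> is_cpm_arrow s \<and> source s = X @ U \<and> target s = U \<and>
     (\<forall>x \<in> vectors X. \<forall>u \<in> vectors U. \<forall>a \<in> vectors U.
        a = u \<oplus>\<^bsub>operator_sum U\<^esub> vec_last (linear_function f (x @\<^sub>v a)) (length U) \<longleftrightarrow>
        a = linear_function s (x @\<^sub>v u))"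

text \<open>The value of \<open>s\<close> solves the equation, and \<open>s'\<close> computes the
  only solution.\<close>

lemma is_feedback_unique:
  assumes "is_feedback U X f s" "is_feedback U X f s'"
  shows "s = s'"
proof (rule is_cpm_arrow_append_eqI[of _ _ X U])
  fix x u assume x: "x \<in> vectors X" and u: "u \<in> vectors U"
  have "linear_function s (x @\<^sub>v u) \<in> vectors U"
    using assms(1) operator_sum_append[OF x u]
    by (intro linear_function_arrow_closed) (simp_all add: is_feedback_def)
  then show "linear_function s (x @\<^sub>v u) = linear_function s' (x @\<^sub>v u)"
    using assms x u unfolding is_feedback_def by metis
qed (use assms in \<open>simp_all add: is_feedback_def\<close>)

section \<open>Feedback equation versus inverse of the diagonal block\<close>

context
  fixes U X Y :: "'a cpm_obj" and f f11 f12 f21 f22 :: "'a cpm_arrow"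
  assumes objs: "U \<in> cpm_objects" "X \<in> cpm_objects" "Y \<in> cpm_objects"
    and homs: "f11 \<in> cpm_hom X Y" "f12 \<in> cpm_hom U Y" "f21 \<in> cpm_hom X U" "f22 \<in> cpm_hom U U"
    and f: "f = cpm_block f11 f12 f21 f22"
begin

interpretation U: Module.module class_ring "operator_sum U" by (intro operator_sum_module objs)

lemmas blocks = homs[simplified cpm_hom_iff[OF objs(2,3)] cpm_hom_iff[OF objs(1,3)]
  cpm_hom_iff[OF objs(2,1)] cpm_hom_iff[OF objs(1,1)]]

lemma blocks_closed:
  "x \<in> vectors X \<Longrightarrow> linear_function f11 x \<in> vectors Y"
  "u \<in> vectors U \<Longrightarrow> linear_function f12 u \<in> vectors Y"
  "x \<in> vectors X \<Longrightarrow> linear_function f21 x \<in> vectors U"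
  "u \<in> vectors U \<Longrightarrow> linear_function f22 u \<in> vectors U"
  using blocks by (auto intro!: linear_function_arrow_closed)

lemma
  assumes x: "x \<in> vectors X" and u: "u \<in> vectors U"
  shows vec_first_block: "vec_first (linear_function f (x @\<^sub>v u)) (length Y) =
      linear_function f11 x \<oplus>\<^bsub>operator_sum Y\<^esub> linear_function f12 u"
    and vec_last_block: "vec_last (linear_function f (x @\<^sub>v u)) (length U) =
      linear_function f21 x \<oplus>\<^bsub>operator_sum U\<^esub> linear_function f22 u"
  using linear_function_block[OF objs(2,1,3,1) homs x u] blocks_closed x u objs
  by (simp_all add: f operator_sum_vec_first_append operator_sum_vec_last_append operator_sum_simps)

text \<open>Trades the subtraction in \<open>id_minus\<close> for an addition on the other side,
  which arrows can express.\<close>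

lemma id_minus_eq_iff:
  assumes "a \<in> vectors U" "u \<in> vectors U"
  shows "id_minus f22 a = u \<longleftrightarrow> a = u \<oplus>\<^bsub>operator_sum U\<^esub> linear_function f22 a"
proof -
  have b: "linear_function f22 a \<in> vectors U" by (rule blocks_closed(4)[OF assms(1)])
  have "id_minus f22 a = a \<oplus>\<^bsub>operator_sum U\<^esub> \<ominus>\<^bsub>operator_sum U\<^esub> linear_function f22 a"
    by (simp add: id_minus_def a_minus_def blocks(4))
  moreover have "(u \<oplus>\<^bsub>operator_sum U\<^esub> linear_function f22 a) \<oplus>\<^bsub>operator_sum U\<^esub>
      \<ominus>\<^bsub>operator_sum U\<^esub> linear_function f22 a = u"
    using assms b by (simp add: U.a_assoc U.r_neg)
  moreover have "(a \<oplus>\<^bsub>operator_sum U\<^esub> \<ominus>\<^bsub>operator_sum U\<^esub> linear_function f22 a)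
      \<oplus>\<^bsub>operator_sum U\<^esub> linear_function f22 a = a"
    using assms b by (simp add: U.a_assoc U.l_neg)
  ultimately show ?thesis by metis
qed

lemma id_minus_closed: "a \<in> vectors U \<Longrightarrow> id_minus f22 a \<in> vectors U"
  using blocks_closed(4) blocks(4) by (simp add: id_minus_def)

text \<open>Merges (a) and (b) into the single statement that \<open>n\<close> inverts
  \<open>I - f22\<close> on both sides. From left to right, \<open>inv_into\<close> is a genuine
  inverse because \<open>I - f22\<close> is a bijection of \<open>vectors U\<close>.\<close>

lemma represents_inverse_iff:
  assumes n: "n \<in> cpm_hom U U"
  shows "represents_inverse U f22 n \<and> invertible_linear (operator_sum U) (operator_sum U) (id_minus f22) \<longleftrightarrow>
    (\<forall>u \<in> vectors U. \<forall>a \<in> vectors U.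
       id_minus f22 a = u \<longleftrightarrow> a = linear_function n u)" (is "?l \<longleftrightarrow> ?r")
proof
  let ?S = "vectors U"
  assume ?l
  then have inj: "inj_on (id_minus f22) ?S" and surj: "id_minus f22 ` ?S = ?S"
    and n_inv: "\<And>u. u \<in> ?S \<Longrightarrow> linear_function n u = inv_into ?S (id_minus f22) u"
    using id_minus_closed
    by (auto simp: represents_inverse_def invertible_linear_def inj_on_def image_iff
      complex_linear_closed) (metis complex_linear_closed)+
  show ?r
    using inj surj by (auto simp: n_inv f_inv_into_f inv_into_f_f)
next
  let ?S = "vectors U"
  assume r: ?r
  note n_lin = linear_function_linear[OF objs(1,1) n]
  have nT: "linear_function n (id_minus f22 a) = a" if "a \<in> ?S" for a
    using r that id_minus_closed by metis
  have Tn: "id_minus f22 (linear_function n u) = u" if "u \<in> ?S" for u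
    using r that complex_linear_closed[OF n_lin] by blast
  \<comment> \<open>Linearity is inherited from the inverse: apply \<open>n\<close> to the
    right-hand side, use its linearity, and return with \<open>Tn\<close>.\<close>
  have T_lin: "id_minus f22 \<in> complex_linear (operator_sum U) (operator_sum U)"
  proof (rule complex_linearI)
    fix a b assume a: "a \<in> ?S" and b: "b \<in> ?S"
    have "linear_function n (id_minus f22 a \<oplus>\<^bsub>operator_sum U\<^esub> id_minus f22 b) = a \<oplus>\<^bsub>operator_sum U\<^esub> b"
      using a b by (simp add: complex_linear_add[OF n_lin] id_minus_closed nT)
    then show "id_minus f22 (a \<oplus>\<^bsub>operator_sum U\<^esub> b) = id_minus f22 a \<oplus>\<^bsub>operator_sum U\<^esub> id_minus f22 b"
      using Tn[of "id_minus f22 a \<oplus>\<^bsub>operator_sum U\<^esub> id_minus f22 b"] a b by (simp add: id_minus_closed)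
  next
    fix c a assume a: "a \<in> ?S"
    have cT: "c \<odot>\<^bsub>operator_sum U\<^esub> id_minus f22 a \<in> ?S"
      using a by (simp add: id_minus_closed U.smult_closed[simplified])
    have "linear_function n (c \<odot>\<^bsub>operator_sum U\<^esub> id_minus f22 a) = c \<odot>\<^bsub>operator_sum U\<^esub> a"
      using a by (simp add: complex_linear_smult[OF n_lin] id_minus_closed nT)
    then show "id_minus f22 (c \<odot>\<^bsub>operator_sum U\<^esub> a) = c \<odot>\<^bsub>operator_sum U\<^esub> id_minus f22 a"
      using Tn[OF cT] by simp
  qed (rule id_minus_closed)
  have "inj_on (id_minus f22) ?S"
    using nT by (metis inj_onI)
  then have "inv_into ?S (id_minus f22) u = linear_function n u" if "u \<in> ?S" for u
    using that Tn complex_linear_closed[OF n_lin] by (intro inv_into_f_eq) auto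
  then show ?l
    using n n_lin T_lin nT Tn by (auto simp: represents_inverse_def invertible_linear_def)
qed

text \<open>Take \<open>s(x, u) = n (u + f21 x)\<close>, an arrow because it is built from
  \<open>n\<close>, \<open>f21\<close>, projections and one sum.\<close>

lemma feedback_of_inverse:
  assumes n: "n \<in> cpm_hom U U" "represents_inverse U f22 n"
    "invertible_linear (operator_sum U) (operator_sum U) (id_minus f22)"
  obtains s where "is_feedback U X f s"
    "\<And>x. x \<in> vectors X \<Longrightarrow>
      linear_function s (x @\<^sub>v \<zero>\<^bsub>operator_sum U\<^esub>) = linear_function n (linear_function f21 x)"
proof -
  have n': "is_cpm_arrow n" "source n = U" "target n = U" using n(1) objs by (simp_all add: cpm_hom_iff)
  have inv: "id_minus f22 a = u \<longleftrightarrow> a = linear_function n u"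
    if "a \<in> vectors U" "u \<in> vectors U" for a u
    using represents_inverse_iff[OF n(1)] n(2,3) that by blast
  have id: "cpm_computable (X @ U) (X @ U) (\<lambda>v. v)"
    by (intro cpm_computable_id) (simp add: cpm_objects_append objs)
  have "cpm_computable (X @ U) (source f21) (\<lambda>v. vec_first v (length X))"
    using cpm_computable_vec_first[OF objs(2,1) id] by (simp add: blocks(3))
  then have "cpm_computable (X @ U) U (\<lambda>v. linear_function f21 (vec_first v (length X)))"
    by (intro cpm_computable_arrow) (simp_all add: blocks(3))
  then have "cpm_computable (X @ U) (source n)
      (\<lambda>v. vec_last v (length U) \<oplus>\<^bsub>operator_sum U\<^esub> linear_function f21 (vec_first v (length X)))"
    unfolding n'(2) by (intro cpm_computable_add cpm_computable_vec_last[OF objs(2,1) id])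
  then have "cpm_computable (X @ U) U (\<lambda>v. linear_function n (vec_last v (length U) \<oplus>\<^bsub>operator_sum U\<^esub>
      linear_function f21 (vec_first v (length X))))"
    using n' by (intro cpm_computable_arrow)
  then obtain s where s: "is_cpm_arrow s" "source s = X @ U" "target s = U"
    and s_app: "\<And>v. v \<in> vectors (X @ U) \<Longrightarrow> linear_function s v =
      linear_function n (vec_last v (length U) \<oplus>\<^bsub>operator_sum U\<^esub> linear_function f21 (vec_first v (length X)))"
    by (rule cpm_computableE) blast
  have s_app': "linear_function s (x @\<^sub>v u) = linear_function n (u \<oplus>\<^bsub>operator_sum U\<^esub> linear_function f21 x)"
    if "x \<in> vectors X" "u \<in> vectors U" for x u
    using that by (simp add: s_app operator_sum_append operator_sum_vec_first_append operator_sum_vec_last_append)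
  have "is_feedback U X f s"
    unfolding is_feedback_def using s
    by (auto simp: vec_last_block s_app' blocks_closed inv[symmetric] id_minus_eq_iff U.a_assoc)
  moreover have "linear_function s (x @\<^sub>v \<zero>\<^bsub>operator_sum U\<^esub>) = linear_function n (linear_function f21 x)"
    if "x \<in> vectors X" for x
    using that by (simp add: s_app' blocks_closed)
  ultimately show ?thesis by (rule that)
qed

text \<open>Fix \<open>x\<close> to zero. The contribution of \<open>f21\<close> disappears, the
  equation reads \<open>a = u + f22 a\<close>, and its solution \<open>s(0, u)\<close> is the
  inverse applied to \<open>u\<close>.\<close>

lemma inverse_of_feedback:
  assumes s: "is_feedback U X f s"
  shows "\<exists>n. n \<in> cpm_hom U U \<and> represents_inverse U f22 n \<and>
    invertible_linear (operator_sum U) (operator_sum U) (id_minus f22)"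
proof -
  have s': "is_cpm_arrow s" "source s = X @ U" "target s = U" using s by (simp_all add: is_feedback_def)
  have "cpm_computable U U (\<lambda>u. linear_function s (\<zero>\<^bsub>operator_sum X\<^esub> @\<^sub>v u))"
    using s' objs by (intro cpm_computable_arrow)
      (auto intro!: cpm_computable_append cpm_computable_zero cpm_computable_id)
  then obtain n where n: "is_cpm_arrow n" "source n = U" "target n = U"
    and n_app: "\<And>u. u \<in> vectors U \<Longrightarrow>
      linear_function n u = linear_function s (\<zero>\<^bsub>operator_sum X\<^esub> @\<^sub>v u)"
    by (rule cpm_computableE) blast
  have X0: "\<zero>\<^bsub>operator_sum X\<^esub> \<in> vectors X" by (simp add: operator_sum_simps objs)
  have f21_0: "linear_function f21 \<zero>\<^bsub>operator_sum X\<^esub> = \<zero>\<^bsub>operator_sum U\<^esub>"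
    using linear_function_arrow_zero[of f21 X] blocks(3) by simp
  have n_hom: "n \<in> cpm_hom U U" using n objs by (simp add: cpm_hom_iff)
  have "id_minus f22 a = u \<longleftrightarrow> a = linear_function n u"
    if a: "a \<in> vectors U" and u: "u \<in> vectors U" for a u
  proof -
    have "vec_last (linear_function f (\<zero>\<^bsub>operator_sum X\<^esub> @\<^sub>v a)) (length U) = linear_function f22 a"
      using vec_last_block[OF X0 a] blocks_closed(4)[OF a] by (simp add: f21_0)
    moreover have "a = u \<oplus>\<^bsub>operator_sum U\<^esub> vec_last (linear_function f (\<zero>\<^bsub>operator_sum X\<^esub> @\<^sub>v a)) (length U)
        \<longleftrightarrow> a = linear_function s (\<zero>\<^bsub>operator_sum X\<^esub> @\<^sub>v u)"
      using s X0 a u unfolding is_feedback_def by blast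
    ultimately show ?thesis using a u by (simp add: id_minus_eq_iff n_app)
  qed
  then show ?thesis using represents_inverse_iff[OF n_hom] n_hom by blast
qed

end

lemma represents_inverse_unique:
  assumes "U \<in> cpm_objects" "represents_inverse U f n" "represents_inverse U f n'"
  shows "n = n'"
  using assms by (intro cpm_hom_eqI[of U U]) (simp_all add: represents_inverse_def)

text \<open>With input \<open>u = 0\<close> the solution is
  \<open>s(x, 0) = (I - f22)^-1 f21 x\<close>, and the first component of \<open>f\<close> at
  \<open>(x, s(x, 0))\<close> is \<open>f11 x + f12 s(x, 0)\<close>, the formula for the trace. The
  block decomposition and the definite description are thereby hidden from the proofs of the
  axioms.\<close>

lemma cpm_trace_eq_Some_iff:
  assumes U: "U \<in> cpm_objects" and X: "X \<in> cpm_objects" and Y: "Y \<in> cpm_objects"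
    and f: "f \<in> cpm_hom (X @ U) (Y @ U)"
  shows "cpm_trace U X Y f = Some t \<longleftrightarrow> t \<in> cpm_hom X Y \<and>
    (\<exists>s. is_feedback U X f s \<and> (\<forall>x \<in> vectors X. linear_function t x =
      vec_first (linear_function f (x @\<^sub>v linear_function s (x @\<^sub>v \<zero>\<^bsub>operator_sum U\<^esub>))) (length Y)))"
    (is "_ \<longleftrightarrow> ?r t")
proof -
  obtain E11 E12 E21 E22 where split: "split_block (entries f) (length Y) (length X) = (E11, E12, E21, E22)"
    by (metis prod_cases4)
  define f11 f12 f21 f22 where defs: "f11 = \<lparr>source = X, target = Y, entries = E11\<rparr>"
    "f12 = \<lparr>source = U, target = Y, entries = E12\<rparr>" "f21 = \<lparr>source = X, target = U, entries = E21\<rparr>"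
    "f22 = \<lparr>source = U, target = U, entries = E22\<rparr>"
  note blk = split_cpm_block[OF f split, folded defs]
  have trace: "cpm_trace U X Y f =
    (if invertible_linear (operator_sum U) (operator_sum U) (id_minus f22) \<and> (\<exists>N. represents_inverse U f22 N)
     then Some (cpm_add f11 (cpm_comp f12 (cpm_comp (THE N. represents_inverse U f22 N) f21))) else None)"
    using f by (simp add: cpm_trace_def split defs Let_def)
  \<comment> \<open>An inverse produces the value of the trace together with its feedback
    description; both directions of the equivalence draw on this.\<close>
  have some: "\<exists>t. cpm_trace U X Y f = Some t \<and> ?r t"
    if inv: "invertible_linear (operator_sum U) (operator_sum U) (id_minus f22)" and n: "represents_inverse U f22 n" for n
  proof -
    have the: "(THE N. represents_inverse U f22 N) = n"
      using n represents_inverse_unique[OF U] by blast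
    have n_hom: "n \<in> cpm_hom U U" using n by (simp add: represents_inverse_def)
    obtain s where s: "is_feedback U X f s" "\<And>x. x \<in> vectors X \<Longrightarrow>
      linear_function s (x @\<^sub>v \<zero>\<^bsub>operator_sum U\<^esub>) = linear_function n (linear_function f21 x)"
      using feedback_of_inverse[OF U X Y blk n_hom n inv] by blast
    let ?t = "cpm_add f11 (cpm_comp f12 (cpm_comp n f21))"
    have arrows: "is_cpm_arrow f11" "is_cpm_arrow f12" "is_cpm_arrow f21" "is_cpm_arrow n"
      "source f11 = X" "source f12 = U" "source f21 = X" "source n = U"
      "target f11 = Y" "target f12 = Y" "target f21 = U" "target n = U"
      using blk(1-3) n_hom U X Y by (simp_all add: cpm_hom_iff)
    have c: "cpm_comp f12 (cpm_comp n f21) \<in> cpm_hom X Y"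
      using arrows U X Y by (simp add: cpm_hom_iff cpm_arrow_simps)
    have "linear_function ?t x = vec_first (linear_function f (x @\<^sub>v linear_function s (x @\<^sub>v \<zero>\<^bsub>operator_sum U\<^esub>))) (length Y)"
      if "x \<in> vectors X" for x
      using that arrows
      by (simp add: s(2) vec_first_block[OF U X Y blk] linear_function_add_arrow[OF X Y blk(1) c]
        cpm_arrow_simps linear_function_simps)
    then show ?thesis
      using s(1) cpm_add_hom[OF X Y blk(1) c] inv n by (auto simp: trace the)
  qed
  \<comment> \<open>The description determines \<open>t\<close>. Hence, given \<open>?r t\<close>,
    it is enough that the trace is defined with some value \<open>t'\<close> that fits the
    description too.\<close>
  have r_unique: "t = t'" if t: "?r t" and t': "?r t'" for t t'
  proof -
    obtain s where s: "is_feedback U X f s" "\<forall>x \<in> vectors X. linear_function t x =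
      vec_first (linear_function f (x @\<^sub>v linear_function s (x @\<^sub>v \<zero>\<^bsub>operator_sum U\<^esub>))) (length Y)"
      using t by blast
    obtain s' where s': "is_feedback U X f s'" "\<forall>x \<in> vectors X. linear_function t' x =
      vec_first (linear_function f (x @\<^sub>v linear_function s' (x @\<^sub>v \<zero>\<^bsub>operator_sum U\<^esub>))) (length Y)"
      using t' by blast
    have "s' = s" by (rule is_feedback_unique[OF s'(1) s(1)])
    then show ?thesis using s(2) s'(2) t t' by (intro cpm_hom_eqI[OF X Y]) auto
  qed
  show ?thesis
  proof
    assume t: "cpm_trace U X Y f = Some t"
    then obtain n where "invertible_linear (operator_sum U) (operator_sum U) (id_minus f22)" "represents_inverse U f22 n"
      unfolding trace by (auto split: if_splits)
    then show "?r t" using some t by fastforce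
  next
    assume t: "?r t"
    then obtain s where "is_feedback U X f s" by blast
    then obtain n where "represents_inverse U f22 n" "invertible_linear (operator_sum U) (operator_sum U) (id_minus f22)"
      using inverse_of_feedback[OF U X Y blk] by blast
    then obtain t' where "cpm_trace U X Y f = Some t'" "?r t'" using some by blast
    then show "cpm_trace U X Y f = Some t" using r_unique[OF t] by simp
  qed
qed

section \<open>The trace axioms\<close>

text \<open>The counterpart of \<open>is_feedback\<close> for a solution given by a formula
  \<open>\<sigma>\<close> in two variables instead of by an arrow on concatenated tuples.\<close>

definition feedback_solution ::
    "'a cpm_obj \<Rightarrow> 'a cpm_obj \<Rightarrow> 'a cpm_arrow \<Rightarrow>
      (('a \<Rightarrow> 'a) vec \<Rightarrow> ('a \<Rightarrow> 'a) vec \<Rightarrow> ('a \<Rightarrow> 'a) vec) \<Rightarrow> bool" where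
  "feedback_solution U X f \<sigma> \<longleftrightarrow>
     cpm_computable (X @ U) U (\<lambda>v. \<sigma> (vec_first v (length X)) (vec_last v (length U))) \<and>
     (\<forall>x \<in> vectors X. \<forall>u \<in> vectors U. \<forall>a \<in> vectors U.
        a = u \<oplus>\<^bsub>operator_sum U\<^esub> vec_last (linear_function f (x @\<^sub>v a)) (length U) \<longleftrightarrow> a = \<sigma> x u)"

lemma feedback_solution_arrow:
  assumes "feedback_solution U X f \<sigma>"
  obtains s where "is_feedback U X f s"
    "\<And>x u. x \<in> vectors X \<Longrightarrow> u \<in> vectors U \<Longrightarrow>
      linear_function s (x @\<^sub>v u) = \<sigma> x u"
proof -
  obtain s where s: "is_cpm_arrow s" "source s = X @ U" "target s = U"
    and s_app: "\<And>v. v \<in> vectors (X @ U) \<Longrightarrow>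
      linear_function s v = \<sigma> (vec_first v (length X)) (vec_last v (length U))"
    using assms unfolding feedback_solution_def by (auto elim: cpm_computableE)
  have s_app': "linear_function s (x @\<^sub>v u) = \<sigma> x u"
    if "x \<in> vectors X" "u \<in> vectors U" for x u
    using that
    by (simp add: s_app operator_sum_append operator_sum_vec_first_append operator_sum_vec_last_append)
  then have "is_feedback U X f s"
    using assms s by (simp add: is_feedback_def feedback_solution_def)
  then show ?thesis using s_app' by (rule that)
qed

lemma is_feedback_closed:
  assumes "is_feedback U X f s" "x \<in> vectors X" "u \<in> vectors U"
  shows "linear_function s (x @\<^sub>v u) \<in> vectors U"
  using assms by (intro linear_function_arrow_closed) (simp_all add: is_feedback_def operator_sum_append)

lemma is_feedback_iff:
  assumes "is_feedback U X f s" "x \<in> vectors X" "u \<in> vectors U"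
    "a \<in> vectors U"
  shows "a = u \<oplus>\<^bsub>operator_sum U\<^esub> vec_last (linear_function f (x @\<^sub>v a)) (length U) \<longleftrightarrow>
    a = linear_function s (x @\<^sub>v u)"
  using assms unfolding is_feedback_def by blast

lemma is_feedback_fixpoint:
  assumes s: "is_feedback U X f s" and x: "x \<in> vectors X" and u: "u \<in> vectors U"
  shows "u \<oplus>\<^bsub>operator_sum U\<^esub> vec_last (linear_function f (x @\<^sub>v linear_function s (x @\<^sub>v u))) (length U)
    = linear_function s (x @\<^sub>v u)"
  using is_feedback_iff[OF s x u is_feedback_closed[OF s x u]] by simp

lemma cpm_computable_arrow':
  assumes "is_cpm_arrow f \<and> source f = X \<and> target f = Y" "cpm_computable Z X \<phi>"
  shows "cpm_computable Z Y (\<lambda>v. linear_function f (\<phi> v))"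
  using assms by (intro cpm_computable_arrow) auto

section \<open>Establishing and using values of the trace\<close>

context
  fixes U X Y :: "'a cpm_obj" and f :: "'a cpm_arrow"
  assumes objs: "U \<in> cpm_objects" "X \<in> cpm_objects" "Y \<in> cpm_objects"
    and f: "f \<in> cpm_hom (X @ U) (Y @ U)"
begin

lemma cpm_trace_SomeE:
  assumes "cpm_trace U X Y f = Some t"
  obtains s where "is_feedback U X f s" "t \<in> cpm_hom X Y"
    "\<And>x. x \<in> vectors X \<Longrightarrow> linear_function t x =
      vec_first (linear_function f (x @\<^sub>v linear_function s (x @\<^sub>v \<zero>\<^bsub>operator_sum U\<^esub>))) (length Y)"
  using assms unfolding cpm_trace_eq_Some_iff[OF objs f] by blast

lemma cpm_trace_SomeI:
  assumes \<sigma>: "feedback_solution U X f \<sigma>" and t: "t \<in> cpm_hom X Y"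
    and eq: "\<And>x. x \<in> vectors X \<Longrightarrow>
      linear_function t x = vec_first (linear_function f (x @\<^sub>v \<sigma> x \<zero>\<^bsub>operator_sum U\<^esub>)) (length Y)"
  shows "cpm_trace U X Y f = Some t"
proof -
  obtain s where s: "is_feedback U X f s"
    "\<And>x u. x \<in> vectors X \<Longrightarrow> u \<in> vectors U \<Longrightarrow>
      linear_function s (x @\<^sub>v u) = \<sigma> x u"
    using \<sigma> by (rule feedback_solution_arrow) blast
  show ?thesis
    unfolding cpm_trace_eq_Some_iff[OF objs f] using s t eq objs
    by (auto simp: operator_sum_simps intro!: exI[of _ s])
qed

text \<open>Once a solution is at hand, the formula for the trace is computable, so some arrow has
  that value. This is the form for arguments about domains of definition alone.\<close>

lemma cpm_trace_defined:
  assumes \<sigma>: "feedback_solution U X f \<sigma>"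
  shows "cpm_trace U X Y f \<noteq> None"
proof -
  obtain s where s: "is_feedback U X f s" using \<sigma> by (rule feedback_solution_arrow)
  have f': "is_cpm_arrow f \<and> source f = X @ U \<and> target f = Y @ U"
    using f objs by (simp add: cpm_hom_iff cpm_objects_append)
  have s': "is_cpm_arrow s \<and> source s = X @ U \<and> target s = U" using s by (simp add: is_feedback_def)
  have "cpm_computable X Y (\<lambda>x. vec_first (linear_function f
      (x @\<^sub>v linear_function s (x @\<^sub>v \<zero>\<^bsub>operator_sum U\<^esub>))) (length Y))"
    by (intro cpm_computable_vec_first[of Y U] cpm_computable_arrow'[OF f'] cpm_computable_arrow'[OF s']
      cpm_computable_append cpm_computable_id cpm_computable_zero objs)
  then obtain t where "is_cpm_arrow t" "source t = X" "target t = Y"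
    "\<And>x. x \<in> vectors X \<Longrightarrow> linear_function t x =
      vec_first (linear_function f (x @\<^sub>v linear_function s (x @\<^sub>v \<zero>\<^bsub>operator_sum U\<^esub>))) (length Y)"
    by (rule cpm_computableE) blast
  then have "cpm_trace U X Y f = Some t"
    unfolding cpm_trace_eq_Some_iff[OF objs f] using s objs by (auto simp: cpm_hom_iff)
  then show ?thesis by simp
qed

end

text \<open>Kleene equality needs definedness in both directions, but the values have to be compared
  only once; hence \<open>backward\<close> asks merely for a solution.\<close>

lemma cpm_trace_eqI:
  assumes objs: "U \<in> cpm_objects" "U' \<in> cpm_objects" "X \<in> cpm_objects" "Y \<in> cpm_objects"
    and f: "f \<in> cpm_hom (X @ U) (Y @ U)" and f': "f' \<in> cpm_hom (X @ U') (Y @ U')"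
    and forward: "\<And>s. is_feedback U X f s \<Longrightarrow> \<exists>\<sigma>. feedback_solution U' X f' \<sigma> \<and>
      (\<forall>x \<in> vectors X.
        vec_first (linear_function f (x @\<^sub>v linear_function s (x @\<^sub>v \<zero>\<^bsub>operator_sum U\<^esub>))) (length Y) =
        vec_first (linear_function f' (x @\<^sub>v \<sigma> x \<zero>\<^bsub>operator_sum U'\<^esub>)) (length Y))"
    and backward: "\<And>s. is_feedback U' X f' s \<Longrightarrow> \<exists>\<sigma>. feedback_solution U X f \<sigma>"
  shows "cpm_trace U X Y f = cpm_trace U' X Y f'"
proof (cases "cpm_trace U X Y f")
  case None
  have "cpm_trace U' X Y f' = None"
  proof (rule ccontr)
    assume "cpm_trace U' X Y f' \<noteq> None"
    then obtain t where "cpm_trace U' X Y f' = Some t" by auto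
    then obtain s where "is_feedback U' X f' s" by (rule cpm_trace_SomeE[OF objs(2-4) f'])
    then show False using backward cpm_trace_defined[OF objs(1,3,4) f] None by blast
  qed
  with None show ?thesis by simp
next
  case (Some t)
  then obtain s where s: "is_feedback U X f s" "t \<in> cpm_hom X Y"
    "\<And>x. x \<in> vectors X \<Longrightarrow> linear_function t x =
      vec_first (linear_function f (x @\<^sub>v linear_function s (x @\<^sub>v \<zero>\<^bsub>operator_sum U\<^esub>))) (length Y)"
    by (rule cpm_trace_SomeE[OF objs(1,3,4) f]) blast
  obtain \<sigma> where \<sigma>: "feedback_solution U' X f' \<sigma>" "\<forall>x \<in> vectors X.
        vec_first (linear_function f (x @\<^sub>v linear_function s (x @\<^sub>v \<zero>\<^bsub>operator_sum U\<^esub>))) (length Y) =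
        vec_first (linear_function f' (x @\<^sub>v \<sigma> x \<zero>\<^bsub>operator_sum U'\<^esub>)) (length Y)"
    using forward[OF s(1)] by blast
  show ?thesis
    unfolding Some using s(2,3) \<sigma>(2)
    by (intro cpm_trace_SomeI[OF objs(2-4) f' \<sigma>(1), symmetric]) simp_all
qed

lemma linear_function_append:
  assumes f: "is_cpm_arrow f \<and> source f = X @ U \<and> target f = Y @ V"
    and x: "x \<in> vectors X" and u: "u \<in> vectors U"
  shows "vec_first (linear_function f (x @\<^sub>v u)) (length Y) \<in> vectors Y"
    "vec_last (linear_function f (x @\<^sub>v u)) (length V) \<in> vectors V"
    "vec_first (linear_function f (x @\<^sub>v u)) (length Y) @\<^sub>v vec_last (linear_function f (x @\<^sub>v u)) (length V)
      = linear_function f (x @\<^sub>v u)"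
proof -
  have "linear_function f (x @\<^sub>v u) \<in> vectors (Y @ V)"
    using f operator_sum_append[OF x u] by (intro linear_function_arrow_closed) auto
  then show "vec_first (linear_function f (x @\<^sub>v u)) (length Y) \<in> vectors Y"
    "vec_last (linear_function f (x @\<^sub>v u)) (length V) \<in> vectors V"
    "vec_first (linear_function f (x @\<^sub>v u)) (length Y) @\<^sub>v vec_last (linear_function f (x @\<^sub>v u)) (length V)
      = linear_function f (x @\<^sub>v u)"
    by (rule operator_sum_vec_first operator_sum_vec_last operator_sum_append_first_last)+
qed

lemma operator_sum_vec_last_add:
  assumes "v \<in> vectors (X @ U)" "w \<in> vectors (X @ U)"
  shows "vec_last (v \<oplus>\<^bsub>operator_sum (X @ U)\<^esub> w) (length U) =
    vec_last v (length U) \<oplus>\<^bsub>operator_sum U\<^esub> vec_last w (length U)"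
  using operator_sum_dim[OF assms(1)] operator_sum_dim[OF assms(2)]
  by (intro eq_vecI) (simp_all add: operator_sum_ops vec_last_def)

text \<open>Additivity in both inputs jointly: with a zero in one slot it separates the contribution
  of a single summand.\<close>

lemma vec_last_linear_function_add:
  assumes f: "is_cpm_arrow f \<and> source f = X @ U \<and> target f = Y @ V"
    and xu: "x \<in> vectors X" "u \<in> vectors U"
      "x' \<in> vectors X" "u' \<in> vectors U"
  shows "vec_last (linear_function f ((x \<oplus>\<^bsub>operator_sum X\<^esub> x') @\<^sub>v (u \<oplus>\<^bsub>operator_sum U\<^esub> u'))) (length V) =
    vec_last (linear_function f (x @\<^sub>v u)) (length V) \<oplus>\<^bsub>operator_sum V\<^esub>
    vec_last (linear_function f (x' @\<^sub>v u')) (length V)"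
proof -
  have closed: "linear_function f (x @\<^sub>v u) \<in> vectors (Y @ V)"
    if "x \<in> vectors X" "u \<in> vectors U" for x u
    using f operator_sum_append[OF that] by (intro linear_function_arrow_closed) auto
  have "linear_function f ((x \<oplus>\<^bsub>operator_sum X\<^esub> x') @\<^sub>v (u \<oplus>\<^bsub>operator_sum U\<^esub> u')) =
      linear_function f (x @\<^sub>v u) \<oplus>\<^bsub>operator_sum (Y @ V)\<^esub> linear_function f (x' @\<^sub>v u')"
    using f linear_function_arrow_add[of f "X @ U"] operator_sum_append[OF xu(1,2)] operator_sum_append[OF xu(3,4)]
    by (simp flip: operator_sum_append_add[OF xu])
  then show ?thesis using operator_sum_vec_last_add[OF closed[OF xu(1,2)] closed[OF xu(3,4)]] by simp
qed

lemma linear_function_oplus_split: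
  assumes f: "is_cpm_arrow f" "source f = X" and g: "is_cpm_arrow g" "source g = U"
    and v: "v \<in> vectors (X @ U)"
  shows "linear_function (cpm_oplus f g) v =
    linear_function f (vec_first v (length X)) @\<^sub>v linear_function g (vec_last v (length U))"
  using linear_function_oplus[OF f(1) g(1)] operator_sum_vec_first[OF v] operator_sum_vec_last[OF v]
    operator_sum_append_first_last[OF v] f(2) g(2) by metis

text \<open>Neither \<open>g\<close> nor \<open>h\<close> touches the loop: the feedback equation of
  the new arrow at \<open>x\<close> is that of \<open>f\<close> at \<open>g x\<close>, with solution
  \<open>s(g x, u)\<close>, and \<open>h\<close> acts only on the output.\<close>

lemma cpm_trace_naturality:
  assumes objs: "U \<in> cpm_objects" "X \<in> cpm_objects" "Y \<in> cpm_objects" "X' \<in> cpm_objects" "Y' \<in> cpm_objects"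
    and f: "f \<in> cpm_hom (X @ U) (Y @ U)" and g: "g \<in> cpm_hom X' X" and h: "h \<in> cpm_hom Y Y'"
    and t: "cpm_trace U X Y f = Some t"
  shows "cpm_trace U X' Y' (cpm_comp (cpm_oplus h (cpm_id U)) (cpm_comp f (cpm_oplus g (cpm_id U)))) =
    Some (cpm_comp h (cpm_comp t g))"
proof -
  let ?F = "cpm_comp (cpm_oplus h (cpm_id U)) (cpm_comp f (cpm_oplus g (cpm_id U)))"
  obtain s where s: "is_feedback U X f s" and t_hom: "t \<in> cpm_hom X Y"
    and t_app: "\<And>x. x \<in> vectors X \<Longrightarrow> linear_function t x =
      vec_first (linear_function f (x @\<^sub>v linear_function s (x @\<^sub>v \<zero>\<^bsub>operator_sum U\<^esub>))) (length Y)"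
    using t by (rule cpm_trace_SomeE[OF objs(1-3) f]) blast
  have f': "is_cpm_arrow f \<and> source f = X @ U \<and> target f = Y @ U"
    and g': "is_cpm_arrow g \<and> source g = X' \<and> target g = X"
    and h': "is_cpm_arrow h \<and> source h = Y \<and> target h = Y'"
    and t': "is_cpm_arrow t \<and> source t = X \<and> target t = Y"
    using f g h t_hom objs by (simp_all add: cpm_hom_iff cpm_objects_append)
  have s': "is_cpm_arrow s \<and> source s = X @ U \<and> target s = U" using s by (simp add: is_feedback_def)
  have F: "?F \<in> cpm_hom (X' @ U) (Y' @ U)"
    using f' g' h' objs by (simp add: cpm_hom_iff cpm_arrow_simps)
  have gx: "linear_function g x \<in> vectors X" if "x \<in> vectors X'" for x
    using g' that by (intro linear_function_arrow_closed) auto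
  have F_app: "linear_function ?F (x @\<^sub>v a) =
      linear_function h (vec_first (linear_function f (linear_function g x @\<^sub>v a)) (length Y)) @\<^sub>v
      vec_last (linear_function f (linear_function g x @\<^sub>v a)) (length U)"
    if "x \<in> vectors X'" "a \<in> vectors U" for x a
    using that f' g' h' objs linear_function_append[OF f' gx[OF that(1)] that(2)] gx[OF that(1)]
    by (simp add: cpm_arrow_simps linear_function_simps
      linear_function_oplus_split[of h Y "cpm_id U" U])
  have h_closed: "linear_function h y \<in> vectors Y'" if "y \<in> vectors Y" for y
    using h' that by (intro linear_function_arrow_closed) auto
  have F_first: "vec_first (linear_function ?F (x @\<^sub>v a)) (length Y') =
      linear_function h (vec_first (linear_function f (linear_function g x @\<^sub>v a)) (length Y))"
    and F_last: "vec_last (linear_function ?F (x @\<^sub>v a)) (length U) =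
      vec_last (linear_function f (linear_function g x @\<^sub>v a)) (length U)"
    if "x \<in> vectors X'" "a \<in> vectors U" for x a
    using linear_function_append[OF f' gx[OF that(1)] that(2)]
    by (simp_all add: F_app[OF that] h_closed operator_sum_vec_first_append operator_sum_vec_last_append)
  show ?thesis
  proof (rule cpm_trace_SomeI[OF objs(1,4,5) F])
    have "cpm_computable (X' @ U) U (\<lambda>v. linear_function s
        (linear_function g (vec_first v (length X')) @\<^sub>v vec_last v (length U)))"
      by (intro cpm_computable_arrow'[OF s'] cpm_computable_append cpm_computable_arrow'[OF g']
        cpm_computable_vec_first[of X' U] cpm_computable_vec_last[of X' U] cpm_computable_id objs)
        (simp_all add: cpm_objects_append objs)
    then show "feedback_solution U X' ?F (\<lambda>x u. linear_function s (linear_function g x @\<^sub>v u))"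
      unfolding feedback_solution_def by (simp add: F_last is_feedback_iff[OF s] gx)
    show "cpm_comp h (cpm_comp t g) \<in> cpm_hom X' Y'"
      using g' h' t' objs by (simp add: cpm_hom_iff cpm_arrow_simps)
    fix x assume x: "x \<in> vectors X'"
    show "linear_function (cpm_comp h (cpm_comp t g)) x =
      vec_first (linear_function ?F (x @\<^sub>v linear_function s (linear_function g x @\<^sub>v \<zero>\<^bsub>operator_sum U\<^esub>))) (length Y')"
      using x g' h' t' objs gx[OF x] is_feedback_closed[OF s gx[OF x]]
      by (simp add: F_first operator_sum_simps t_app cpm_arrow_simps linear_function_simps)
  qed
qed

text \<open>The loops are \<open>g f22\<close> on \<open>U\<close> and \<open>f22 g\<close> on
  \<open>U'\<close>. The two parts of the proof establish
  \<open>(I - f22 g)^-1 = I + f22 (I - g f22)^-1 g\<close> and its mirror image, in the language of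
  feedback equations.\<close>

lemma cpm_trace_dinaturality:
  assumes objs: "U \<in> cpm_objects" "U' \<in> cpm_objects" "X \<in> cpm_objects" "Y \<in> cpm_objects"
    and f: "f \<in> cpm_hom (X @ U) (Y @ U')" and g: "g \<in> cpm_hom U' U"
  shows "cpm_trace U X Y (cpm_comp (cpm_oplus (cpm_id Y) g) f) =
    cpm_trace U' X Y (cpm_comp f (cpm_oplus (cpm_id X) g))"
proof -
  let ?F = "cpm_comp (cpm_oplus (cpm_id Y) g) f" and ?F' = "cpm_comp f (cpm_oplus (cpm_id X) g)"
  interpret U: Module.module class_ring "operator_sum U" by (intro operator_sum_module objs)
  interpret U': Module.module class_ring "operator_sum U'" by (intro operator_sum_module objs)
  interpret X: Module.module class_ring "operator_sum X" by (intro operator_sum_module objs)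
  have f': "is_cpm_arrow f \<and> source f = X @ U \<and> target f = Y @ U'"
    and g': "is_cpm_arrow g \<and> source g = U' \<and> target g = U"
    using f g objs by (simp_all add: cpm_hom_iff cpm_objects_append)
  have F: "?F \<in> cpm_hom (X @ U) (Y @ U)" and F': "?F' \<in> cpm_hom (X @ U') (Y @ U')"
    using f' g' objs by (simp_all add: cpm_hom_iff cpm_arrow_simps)
  define f1 where "f1 x a = vec_first (linear_function f (x @\<^sub>v a)) (length Y)" for x a
  define f2 where "f2 x a = vec_last (linear_function f (x @\<^sub>v a)) (length U')" for x a
  have f_closed: "f1 x a \<in> vectors Y" "f2 x a \<in> vectors U'"
    "f1 x a @\<^sub>v f2 x a = linear_function f (x @\<^sub>v a)"
    if "x \<in> vectors X" "a \<in> vectors U" for x a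
    using linear_function_append[OF f' that] by (simp_all add: f1_def f2_def)
  \<comment> \<open>The whole of \<open>x\<close> goes to the second summand, so an extra input
    \<open>u\<close> contributes a term that no longer depends on \<open>x\<close>.\<close>
  have f2_add: "f2 x (u \<oplus>\<^bsub>operator_sum U\<^esub> a) = f2 \<zero>\<^bsub>operator_sum X\<^esub> u \<oplus>\<^bsub>operator_sum U'\<^esub> f2 x a"
    if "x \<in> vectors X" "a \<in> vectors U" "u \<in> vectors U" for x u a
    using vec_last_linear_function_add[OF f' X.zero_closed that(3,1,2)] that by (simp add: f2_def)
  have g_closed: "linear_function g b \<in> vectors U" if "b \<in> vectors U'" for b
    using g' that by (intro linear_function_arrow_closed) auto
  have g_add: "linear_function g (b \<oplus>\<^bsub>operator_sum U'\<^esub> c) = linear_function g b \<oplus>\<^bsub>operator_sum U\<^esub> linear_function g c"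
    if "b \<in> vectors U'" "c \<in> vectors U'" for b c
    using g' linear_function_arrow_add[of g U'] that by auto
  have g_zero: "linear_function g \<zero>\<^bsub>operator_sum U'\<^esub> = \<zero>\<^bsub>operator_sum U\<^esub>"
    using g' linear_function_arrow_zero[of g U'] by auto
  have F_app: "linear_function ?F (x @\<^sub>v a) = f1 x a @\<^sub>v linear_function g (f2 x a)"
    if "x \<in> vectors X" "a \<in> vectors U" for x a
  proof -
    have "linear_function ?F (x @\<^sub>v a) = linear_function (cpm_oplus (cpm_id Y) g) (f1 x a @\<^sub>v f2 x a)"
      using that f' g' objs by (simp add: f_closed cpm_arrow_simps linear_function_simps)
    also have "\<dots> = f1 x a @\<^sub>v linear_function g (f2 x a)"
      using f_closed(1,2)[OF that] g' objs by (simp add: cpm_arrow_simps linear_function_simps)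
    finally show ?thesis .
  qed
  have F_last: "vec_last (linear_function ?F (x @\<^sub>v a)) (length U) = linear_function g (f2 x a)"
    and F_first: "vec_first (linear_function ?F (x @\<^sub>v a)) (length Y) = f1 x a"
    if "x \<in> vectors X" "a \<in> vectors U" for x a
    using that by (simp_all add: F_app f_closed g_closed operator_sum_vec_last_append operator_sum_vec_first_append)
  have F'_app: "linear_function ?F' (x @\<^sub>v b) = linear_function f (x @\<^sub>v linear_function g b)"
    if "x \<in> vectors X" "b \<in> vectors U'" for x b
    using that f' g' objs by (simp add: cpm_arrow_simps linear_function_simps)
  have F'_last: "vec_last (linear_function ?F' (x @\<^sub>v b)) (length U') = f2 x (linear_function g b)"
    and F'_first: "vec_first (linear_function ?F' (x @\<^sub>v b)) (length Y) = f1 x (linear_function g b)"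
    if "x \<in> vectors X" "b \<in> vectors U'" for x b
    using that by (simp_all add: F'_app f1_def f2_def)
  show ?thesis
  proof (rule cpm_trace_eqI[OF objs F F'])
    fix s assume s: "is_feedback U X ?F s"
    then have s': "is_cpm_arrow s \<and> source s = X @ U \<and> target s = U" by (simp add: is_feedback_def)
    \<comment> \<open>If \<open>b\<close> solves the equation over \<open>U'\<close> with input
      \<open>u'\<close>, then \<open>g b\<close> solves the one over \<open>U\<close> with input
      \<open>g u'\<close>. So \<open>\<tau>\<close> is what \<open>g b\<close> must be.\<close>
    define \<tau> where "\<tau> x u' = linear_function s (x @\<^sub>v linear_function g u')" for x u'
    have \<tau>_closed: "\<tau> x u' \<in> vectors U"
      and \<tau>_fix: "linear_function g u' \<oplus>\<^bsub>operator_sum U\<^esub> linear_function g (f2 x (\<tau> x u')) = \<tau> x u'"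
      if "x \<in> vectors X" "u' \<in> vectors U'" for x u'
      using that is_feedback_closed[OF s that(1) g_closed[OF that(2)]]
        is_feedback_fixpoint[OF s that(1) g_closed[OF that(2)]]
      by (simp_all add: \<tau>_def F_last)
    \<comment> \<open>The right-hand side of the equation over \<open>U'\<close> sees
      \<open>b\<close> only through \<open>g b\<close>; inserting \<open>\<tau>\<close> for it
      recovers \<open>b\<close>.\<close>
    define \<sigma> where "\<sigma> x u' = u' \<oplus>\<^bsub>operator_sum U'\<^esub> f2 x (\<tau> x u')" for x u'
    have g\<sigma>: "linear_function g (\<sigma> x u') = \<tau> x u'"
      if "x \<in> vectors X" "u' \<in> vectors U'" for x u'
      using that by (simp add: \<sigma>_def g_add f_closed \<tau>_closed \<tau>_fix)
    have "b = u' \<oplus>\<^bsub>operator_sum U'\<^esub> vec_last (linear_function ?F' (x @\<^sub>v b)) (length U') \<longleftrightarrow> b = \<sigma> x u'"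
      if x: "x \<in> vectors X" and u': "u' \<in> vectors U'"
        and b: "b \<in> vectors U'" for x u' b
    proof
      assume "b = u' \<oplus>\<^bsub>operator_sum U'\<^esub> vec_last (linear_function ?F' (x @\<^sub>v b)) (length U')"
      then have b_eq: "b = u' \<oplus>\<^bsub>operator_sum U'\<^esub> f2 x (linear_function g b)" using x b by (simp add: F'_last)
      then have "linear_function g b = linear_function g (u' \<oplus>\<^bsub>operator_sum U'\<^esub> f2 x (linear_function g b))"
        by simp
      also have "\<dots> = linear_function g u' \<oplus>\<^bsub>operator_sum U\<^esub> linear_function g (f2 x (linear_function g b))"
        using x u' b by (simp add: g_add f_closed g_closed)
      finally have "linear_function g b = \<tau> x u'"
        unfolding \<tau>_def is_feedback_iff[OF s x g_closed[OF u'] g_closed[OF b], symmetric]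
        using x b by (simp add: F_last g_closed)
      then show "b = \<sigma> x u'" using b_eq by (simp add: \<sigma>_def)
    next
      assume "b = \<sigma> x u'"
      then have "vec_last (linear_function ?F' (x @\<^sub>v b)) (length U') = f2 x (\<tau> x u')"
        using F'_last[OF x b] g\<sigma>[OF x u'] by simp
      then show "b = u' \<oplus>\<^bsub>operator_sum U'\<^esub> vec_last (linear_function ?F' (x @\<^sub>v b)) (length U')"
        using \<open>b = \<sigma> x u'\<close> by (simp add: \<sigma>_def)
    qed
    moreover have "cpm_computable (X @ U') U' (\<lambda>v. \<sigma> (vec_first v (length X)) (vec_last v (length U')))"
      unfolding \<sigma>_def \<tau>_def f2_def
      by (intro cpm_computable_add cpm_computable_append cpm_computable_vec_last[of X U']
        cpm_computable_vec_last[of Y U'] cpm_computable_vec_first[of X U'] cpm_computable_arrow'[OF f']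
        cpm_computable_arrow'[OF g'] cpm_computable_arrow'[OF s'] cpm_computable_id objs)
        (simp_all add: cpm_objects_append objs)
    ultimately have "feedback_solution U' X ?F' \<sigma>"
      unfolding feedback_solution_def by blast
    \<comment> \<open>At zero input, \<open>g\<close> maps the new solution to
      \<open>\<tau> x 0 = s(x, 0)\<close>, so both sides equal
      \<open>f1 x (s(x, 0))\<close>.\<close>
    moreover have "vec_first (linear_function ?F (x @\<^sub>v linear_function s (x @\<^sub>v \<zero>\<^bsub>operator_sum U\<^esub>))) (length Y) =
        vec_first (linear_function ?F' (x @\<^sub>v \<sigma> x \<zero>\<^bsub>operator_sum U'\<^esub>)) (length Y)"
      if x: "x \<in> vectors X" for x
    proof -
      have "\<sigma> x \<zero>\<^bsub>operator_sum U'\<^esub> \<in> vectors U'"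
        using x by (simp add: \<sigma>_def f_closed \<tau>_closed)
      moreover have "\<tau> x \<zero>\<^bsub>operator_sum U'\<^esub> = linear_function s (x @\<^sub>v \<zero>\<^bsub>operator_sum U\<^esub>)"
        by (simp add: \<tau>_def g_zero)
      ultimately show ?thesis
        using x \<tau>_closed[OF x U'.zero_closed] by (simp add: F_first F'_first g\<sigma>)
    qed
    ultimately show "\<exists>\<sigma>. feedback_solution U' X ?F' \<sigma> \<and> (\<forall>x \<in> vectors X.
        vec_first (linear_function ?F (x @\<^sub>v linear_function s (x @\<^sub>v \<zero>\<^bsub>operator_sum U\<^esub>))) (length Y) =
        vec_first (linear_function ?F' (x @\<^sub>v \<sigma> x \<zero>\<^bsub>operator_sum U'\<^esub>)) (length Y))"
      by blast
  next
    fix s assume s: "is_feedback U' X ?F' s"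
    then have s': "is_cpm_arrow s \<and> source s = X @ U' \<and> target s = U'" by (simp add: is_feedback_def)
    \<comment> \<open>Mirror image: if \<open>a\<close> solves the equation over \<open>U\<close>,
      additivity shows that \<open>f2 x a\<close> solves the one over \<open>U'\<close> with input
      \<open>f2 0 u\<close>.\<close>
    define \<tau> where "\<tau> x u = linear_function s (x @\<^sub>v f2 \<zero>\<^bsub>operator_sum X\<^esub> u)" for x u
    have \<tau>_closed: "\<tau> x u \<in> vectors U'"
      and \<tau>_fix: "f2 \<zero>\<^bsub>operator_sum X\<^esub> u \<oplus>\<^bsub>operator_sum U'\<^esub> f2 x (linear_function g (\<tau> x u)) = \<tau> x u"
      if "x \<in> vectors X" "u \<in> vectors U" for x u
      using that is_feedback_closed[OF s that(1) f_closed(2)[OF X.zero_closed that(2)]]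
        is_feedback_fixpoint[OF s that(1) f_closed(2)[OF X.zero_closed that(2)]]
      by (simp_all add: \<tau>_def F'_last)
    \<comment> \<open>Again the unknown is recovered from the right-hand side of its equation, which
      sees \<open>a\<close> only through \<open>f2 x a\<close>.\<close>
    define \<sigma> where "\<sigma> x u = u \<oplus>\<^bsub>operator_sum U\<^esub> linear_function g (\<tau> x u)" for x u
    have "a = u \<oplus>\<^bsub>operator_sum U\<^esub> vec_last (linear_function ?F (x @\<^sub>v a)) (length U) \<longleftrightarrow> a = \<sigma> x u"
      if x: "x \<in> vectors X" and u: "u \<in> vectors U"
        and a: "a \<in> vectors U" for x u a
    proof
      assume "a = u \<oplus>\<^bsub>operator_sum U\<^esub> vec_last (linear_function ?F (x @\<^sub>v a)) (length U)"
      then have a_eq: "a = u \<oplus>\<^bsub>operator_sum U\<^esub> linear_function g (f2 x a)" using x a by (simp add: F_last)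
      then have "f2 x a = f2 x (u \<oplus>\<^bsub>operator_sum U\<^esub> linear_function g (f2 x a))" by simp
      also have "\<dots> = f2 \<zero>\<^bsub>operator_sum X\<^esub> u \<oplus>\<^bsub>operator_sum U'\<^esub> f2 x (linear_function g (f2 x a))"
        using x u a by (simp add: f2_add f_closed g_closed)
      finally have "f2 x a = \<tau> x u"
        unfolding \<tau>_def is_feedback_iff[OF s x f_closed(2)[OF X.zero_closed u] f_closed(2)[OF x a], symmetric]
        using x a by (simp add: F'_last f_closed)
      then show "a = \<sigma> x u" using a_eq by (simp add: \<sigma>_def)
    next
      assume a_eq: "a = \<sigma> x u"
      then have "f2 x a = \<tau> x u"
        using x u by (simp add: \<sigma>_def f2_add g_closed \<tau>_closed \<tau>_fix)
      then show "a = u \<oplus>\<^bsub>operator_sum U\<^esub> vec_last (linear_function ?F (x @\<^sub>v a)) (length U)"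
        using F_last[OF x a] a_eq by (simp add: \<sigma>_def)
    qed
    moreover have "cpm_computable (X @ U) U (\<lambda>v. \<sigma> (vec_first v (length X)) (vec_last v (length U)))"
      unfolding \<sigma>_def \<tau>_def f2_def
      by (intro cpm_computable_add cpm_computable_append cpm_computable_vec_last[of X U]
        cpm_computable_vec_last[of Y U'] cpm_computable_vec_first[of X U] cpm_computable_arrow'[OF f']
        cpm_computable_arrow'[OF g'] cpm_computable_arrow'[OF s'] cpm_computable_zero cpm_computable_id objs)
        (simp_all add: cpm_objects_append objs)
    ultimately show "\<exists>\<sigma>. feedback_solution U X ?F \<sigma>"
      unfolding feedback_solution_def by blast
  qed
qed

text \<open>Over the empty sequence all tuples coincide, so the feedback equation holds trivially
  and the zero tuple is its solution.\<close>

lemma cpm_trace_vanishing_I: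
  fixes X Y :: "'a cpm_obj"
  assumes objs: "X \<in> cpm_objects" "Y \<in> cpm_objects" and f: "f \<in> cpm_hom X Y"
  shows "cpm_trace [] X Y f = Some f"
proof (rule cpm_trace_SomeI[OF Nil_cpm_objects objs])
  have f': "is_cpm_arrow f \<and> source f = X \<and> target f = Y" using f objs by (simp add: cpm_hom_iff)
  show "f \<in> cpm_hom X Y" "f \<in> cpm_hom (X @ []) (Y @ [])" using f by simp_all
  have "a = b" if "a \<in> vectors ([] :: 'a cpm_obj)" "dim_vec b = 0" for a b
    using that by (intro eq_vecI) (auto simp: operator_sum_dim)
  moreover have "cpm_computable (X @ []) [] (\<lambda>_. \<zero>\<^bsub>operator_sum ([] :: 'a cpm_obj)\<^esub>)"
    using objs by (intro cpm_computable_zero) (simp_all add: Nil_cpm_objects)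
  ultimately show "feedback_solution [] X f (\<lambda>_ _. \<zero>\<^bsub>operator_sum ([] :: 'a cpm_obj)\<^esub>)"
    by (simp add: feedback_solution_def operator_sum_ops)
  fix x assume x: "x \<in> vectors X"
  have "linear_function f x \<in> vectors (Y @ [])"
    using f' x by (intro linear_function_arrow_closed) auto
  from operator_sum_append_first_last[OF this] 
  show "linear_function f x =
      vec_first (linear_function f (x @\<^sub>v \<zero>\<^bsub>operator_sum ([] :: 'a cpm_obj)\<^esub>)) (length Y)"
    by (simp add: append_vec_empty operator_sum_ops)
qed

text \<open>The summand \<open>W\<close> bypasses the loop, so \<open>s\<close> is fed with the
  \<open>X\<close> part of the input only. The effort lies in reading tuples over
  \<open>(W @ X) @ U\<close> as tuples over \<open>W @ (X @ U)\<close>.\<close>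

lemma cpm_trace_superposing:
  assumes objs: "U \<in> cpm_objects" "X \<in> cpm_objects" "Y \<in> cpm_objects" "W \<in> cpm_objects" "Z \<in> cpm_objects"
    and f: "f \<in> cpm_hom (X @ U) (Y @ U)" and g: "g \<in> cpm_hom W Z"
    and t: "cpm_trace U X Y f = Some t"
  shows "cpm_trace U (W @ X) (Z @ Y) (cpm_oplus g f) = Some (cpm_oplus g t)"
proof -
  obtain s where s: "is_feedback U X f s" and t_hom: "t \<in> cpm_hom X Y"
    and t_app: "\<And>x. x \<in> vectors X \<Longrightarrow> linear_function t x =
      vec_first (linear_function f (x @\<^sub>v linear_function s (x @\<^sub>v \<zero>\<^bsub>operator_sum U\<^esub>))) (length Y)"
    using t by (rule cpm_trace_SomeE[OF objs(1-3) f]) blast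
  have f': "is_cpm_arrow f \<and> source f = X @ U \<and> target f = Y @ U"
    and g': "is_cpm_arrow g \<and> source g = W \<and> target g = Z"
    and t': "is_cpm_arrow t \<and> source t = X \<and> target t = Y"
    using f g t_hom objs by (simp_all add: cpm_hom_iff cpm_objects_append)
  have s': "is_cpm_arrow s \<and> source s = X @ U \<and> target s = U" using s by (simp add: is_feedback_def)
  have WX: "W @ X \<in> cpm_objects" "Z @ Y \<in> cpm_objects" using objs by (simp_all add: cpm_objects_append)
  have F: "cpm_oplus g f \<in> cpm_hom ((W @ X) @ U) ((Z @ Y) @ U)"
    using f' g' objs by (simp add: cpm_hom_iff cpm_arrow_simps)
  have g_closed: "linear_function g w \<in> vectors Z" if "w \<in> vectors W" for w
    using g' that by (intro linear_function_arrow_closed) auto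
  have F_first: "vec_first (linear_function (cpm_oplus g f) (wx @\<^sub>v a)) (length (Z @ Y)) =
      linear_function g (vec_first wx (length W)) @\<^sub>v vec_first (linear_function f (vec_last wx (length X) @\<^sub>v a)) (length Y)"
    and F_last: "vec_last (linear_function (cpm_oplus g f) (wx @\<^sub>v a)) (length U) =
      vec_last (linear_function f (vec_last wx (length X) @\<^sub>v a)) (length U)"
    if wx: "wx \<in> vectors (W @ X)" and a: "a \<in> vectors U" for wx a
  proof -
    define w x where "w = vec_first wx (length W)" and "x = vec_last wx (length X)"
    have w: "w \<in> vectors W" and x: "x \<in> vectors X" and wx_eq: "wx = w @\<^sub>v x"
      using wx by (simp_all add: w_def x_def operator_sum_vec_first operator_sum_vec_last operator_sum_append_first_last)
    note fxa = linear_function_append[OF f' x a]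
    have "linear_function (cpm_oplus g f) (wx @\<^sub>v a) = linear_function g w @\<^sub>v linear_function f (x @\<^sub>v a)"
      using w x a f' g' by (simp add: wx_eq append_vec_assoc linear_function_oplus operator_sum_append)
    \<comment> \<open>Regrouped so that the \<open>U\<close> component stands alone at the end,
      where the trace cuts it off.\<close>
    also have "\<dots> = (linear_function g w @\<^sub>v vec_first (linear_function f (x @\<^sub>v a)) (length Y)) @\<^sub>v
        vec_last (linear_function f (x @\<^sub>v a)) (length U)"
      using fxa(3) by (simp add: append_vec_assoc)
    finally have eq: "linear_function (cpm_oplus g f) (wx @\<^sub>v a) =
       (linear_function g w @\<^sub>v vec_first (linear_function f (x @\<^sub>v a)) (length Y)) @\<^sub>v
        vec_last (linear_function f (x @\<^sub>v a)) (length U)" .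
    show "vec_first (linear_function (cpm_oplus g f) (wx @\<^sub>v a)) (length (Z @ Y)) =
        linear_function g w @\<^sub>v vec_first (linear_function f (x @\<^sub>v a)) (length Y)"
      unfolding eq by (intro operator_sum_vec_first_append operator_sum_append g_closed[OF w] fxa)
    show "vec_last (linear_function (cpm_oplus g f) (wx @\<^sub>v a)) (length U) =
        vec_last (linear_function f (x @\<^sub>v a)) (length U)"
      unfolding eq by (intro operator_sum_vec_last_append fxa)
  qed
  show ?thesis
  proof (rule cpm_trace_SomeI[OF objs(1) WX F])
    have "cpm_computable ((W @ X) @ U) U (\<lambda>v. linear_function s
        (vec_last (vec_first v (length (W @ X))) (length X) @\<^sub>v vec_last v (length U)))"
      by (intro cpm_computable_arrow'[OF s'] cpm_computable_append cpm_computable_vec_last[of W X]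
        cpm_computable_vec_first[of "W @ X" U] cpm_computable_vec_last[of "W @ X" U] cpm_computable_id objs WX)
        (simp_all add: cpm_objects_append objs)
    then show "feedback_solution U (W @ X) (cpm_oplus g f) (\<lambda>wx u. linear_function s (vec_last wx (length X) @\<^sub>v u))"
      unfolding feedback_solution_def
      by (simp add: F_last is_feedback_iff[OF s] operator_sum_vec_last)
    show "cpm_oplus g t \<in> cpm_hom (W @ X) (Z @ Y)"
      using g' t' objs by (simp add: cpm_hom_iff cpm_arrow_simps)
    fix wx assume wx: "wx \<in> vectors (W @ X)"
    note x = operator_sum_vec_last[OF wx]
    have zero: "\<zero>\<^bsub>operator_sum U\<^esub> \<in> vectors U" using objs by (simp add: operator_sum_simps)
    show "linear_function (cpm_oplus g t) wx = vec_first (linear_function (cpm_oplus g f)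
        (wx @\<^sub>v linear_function s (vec_last wx (length X) @\<^sub>v \<zero>\<^bsub>operator_sum U\<^esub>))) (length (Z @ Y))"
      unfolding F_first[OF wx is_feedback_closed[OF s x zero]] t_app[OF x, symmetric]
      using g' t' wx by (intro linear_function_oplus_split) auto
  qed
qed

text \<open>The symmetry sends \<open>(x, a)\<close> to \<open>(a, x)\<close>. Its diagonal block on
  \<open>U\<close> is zero, so the equation is \<open>a = u + x\<close>, already solved, and the
  output at \<open>u = 0\<close> is \<open>x\<close>.\<close>

lemma cpm_trace_yanking:
  assumes U: "U \<in> cpm_objects"
  shows "cpm_trace U U U (cpm_sym U U) = Some (cpm_id U)"
proof (rule cpm_trace_SomeI[OF U U U])
  show "cpm_sym U U \<in> cpm_hom (U @ U) (U @ U)" "cpm_id U \<in> cpm_hom U U"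
    using U by (simp_all add: cpm_hom_iff cpm_arrow_simps)
  have "cpm_computable (U @ U) U (\<lambda>v. vec_last v (length U) \<oplus>\<^bsub>operator_sum U\<^esub> vec_first v (length U))"
    by (intro cpm_computable_add cpm_computable_vec_last[of U U] cpm_computable_vec_first[of U U] cpm_computable_id U)
      (simp_all add: cpm_objects_append U)
  then show "feedback_solution U U (cpm_sym U U) (\<lambda>x u. u \<oplus>\<^bsub>operator_sum U\<^esub> x)"
    unfolding feedback_solution_def by (simp add: linear_function_sym U operator_sum_vec_last_append)
  fix x assume x: "x \<in> vectors U"
  show "linear_function (cpm_id U) x = vec_first (linear_function (cpm_sym U U)
      (x @\<^sub>v (\<zero>\<^bsub>operator_sum U\<^esub> \<oplus>\<^bsub>operator_sum U\<^esub> x))) (length U)"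
    using x U by (simp add: linear_function_id operator_sum_simps linear_function_sym operator_sum_vec_first_append)
qed

text \<open>Over \<open>U @ V\<close> the feedback equation is a system in two unknowns. Definedness
  of the inner trace permits elimination of the unknown in \<open>V\<close>, which leaves, up to a
  modified input, the equation of \<open>T\<close> over \<open>U\<close>.\<close>

lemma cpm_trace_vanishing_II:
  assumes objs: "U \<in> cpm_objects" "V \<in> cpm_objects" "X \<in> cpm_objects" "Y \<in> cpm_objects"
    and g: "g \<in> cpm_hom ((X @ U) @ V) ((Y @ U) @ V)"
    and T: "cpm_trace V (X @ U) (Y @ U) g = Some T"
  shows "cpm_trace (U @ V) X Y g = cpm_trace U X Y T"
proof -
  interpret U: Module.module class_ring "operator_sum U" by (intro operator_sum_module objs)
  interpret V: Module.module class_ring "operator_sum V" by (intro operator_sum_module objs)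
  interpret X: Module.module class_ring "operator_sum X" by (intro operator_sum_module objs)
  have obj2: "X @ U \<in> cpm_objects" "Y @ U \<in> cpm_objects" "U @ V \<in> cpm_objects"
    using objs by (simp_all add: cpm_objects_append)
  obtain s where s: "is_feedback V (X @ U) g s" and T_hom: "T \<in> cpm_hom (X @ U) (Y @ U)"
    and T_app: "\<And>v. v \<in> vectors (X @ U) \<Longrightarrow> linear_function T v =
      vec_first (linear_function g (v @\<^sub>v linear_function s (v @\<^sub>v \<zero>\<^bsub>operator_sum V\<^esub>))) (length (Y @ U))"
    using T by (rule cpm_trace_SomeE[OF objs(2) obj2(1,2) g]) blast
  have g': "is_cpm_arrow g \<and> source g = X @ U @ V \<and> target g = Y @ U @ V"
    using g objs by (simp add: cpm_hom_iff cpm_objects_append)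
  have s': "is_cpm_arrow s \<and> source s = (X @ U) @ V \<and> target s = V" using s by (simp add: is_feedback_def)
  have g_hom: "g \<in> cpm_hom (X @ U @ V) (Y @ U @ V)" using g by simp
  \<comment> \<open>Outputs of \<open>g\<close> as functions of three inputs. \<open>g23\<close>
    stays whole because the feedback over \<open>U @ V\<close> cuts off a single tail.\<close>
  define g1 where "g1 x u v = vec_first (linear_function g (x @\<^sub>v u @\<^sub>v v)) (length Y)" for x u v
  define g23 where "g23 x u v = vec_last (linear_function g (x @\<^sub>v u @\<^sub>v v)) (length (U @ V))" for x u v
  define g2 where "g2 x u v = vec_first (g23 x u v) (length U)" for x u v
  define g3 where "g3 x u v = vec_last (g23 x u v) (length V)" for x u v
  have g23_closed: "g23 x u v \<in> vectors (U @ V)"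
    and g_closed: "g1 x u v \<in> vectors Y" "g2 x u v \<in> vectors U"
      "g3 x u v \<in> vectors V"
    and g23_eq: "g23 x u v = g2 x u v @\<^sub>v g3 x u v"
    and g_eq: "linear_function g (x @\<^sub>v u @\<^sub>v v) = g1 x u v @\<^sub>v g2 x u v @\<^sub>v g3 x u v"
    if "x \<in> vectors X" "u \<in> vectors U" "v \<in> vectors V" for x u v
  proof -
    note app = linear_function_append[OF g' that(1) operator_sum_append[OF that(2,3)]]
    show c: "g23 x u v \<in> vectors (U @ V)" "g1 x u v \<in> vectors Y"
      using app(1,2) by (simp_all add: g1_def g23_def)
    show "g2 x u v \<in> vectors U" "g3 x u v \<in> vectors V"
      unfolding g2_def g3_def by (rule operator_sum_vec_first[OF c(1)] operator_sum_vec_last[OF c(1)])+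
    show e: "g23 x u v = g2 x u v @\<^sub>v g3 x u v"
      unfolding g2_def g3_def by (rule operator_sum_append_first_last[OF c(1), symmetric])
    show "linear_function g (x @\<^sub>v u @\<^sub>v v) = g1 x u v @\<^sub>v g2 x u v @\<^sub>v g3 x u v"
      using app(3) e by (simp add: g1_def g23_def)
  qed
  have g2_add: "g2 x u (v \<oplus>\<^bsub>operator_sum V\<^esub> w) =
      g2 x u v \<oplus>\<^bsub>operator_sum U\<^esub> g2 \<zero>\<^bsub>operator_sum X\<^esub> \<zero>\<^bsub>operator_sum U\<^esub> w"
    if "x \<in> vectors X" "u \<in> vectors U"
      "v \<in> vectors V" "w \<in> vectors V" for x u v w
  proof -
    have "g23 x u (v \<oplus>\<^bsub>operator_sum V\<^esub> w) =
        g23 x u v \<oplus>\<^bsub>operator_sum (U @ V)\<^esub> g23 \<zero>\<^bsub>operator_sum X\<^esub> \<zero>\<^bsub>operator_sum U\<^esub> w"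
      using vec_last_linear_function_add[OF g' that(1) operator_sum_append[OF that(2,3)]
        X.zero_closed operator_sum_append[OF U.zero_closed that(4)]] that
      by (simp add: g23_def operator_sum_append_add)
    then have "g2 x u (v \<oplus>\<^bsub>operator_sum V\<^esub> w) @\<^sub>v g3 x u (v \<oplus>\<^bsub>operator_sum V\<^esub> w) =
        (g2 x u v \<oplus>\<^bsub>operator_sum U\<^esub> g2 \<zero>\<^bsub>operator_sum X\<^esub> \<zero>\<^bsub>operator_sum U\<^esub> w) @\<^sub>v
        (g3 x u v \<oplus>\<^bsub>operator_sum V\<^esub> g3 \<zero>\<^bsub>operator_sum X\<^esub> \<zero>\<^bsub>operator_sum U\<^esub> w)"
      using that by (simp add: g23_eq operator_sum_append_add g_closed)
    then show ?thesis
      using that operator_sum_append_eq_iff by (metis U.a_closed U.zero_closed V.a_closed X.zero_closed g_closed(2))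
  qed
  \<comment> \<open>The solution in \<open>V\<close> with \<open>u\<close> held as a parameter and
    free input \<open>w\<close>.\<close>
  define \<tau> where "\<tau> x u w = linear_function s ((x @\<^sub>v u) @\<^sub>v w)" for x u w
  have \<tau>_closed: "\<tau> x u w \<in> vectors V"
    and \<tau>_iff: "v \<in> vectors V \<Longrightarrow> v = w \<oplus>\<^bsub>operator_sum V\<^esub> g3 x u v \<longleftrightarrow> v = \<tau> x u w"
    if "x \<in> vectors X" "u \<in> vectors U" "w \<in> vectors V" for x u v w
  proof -
    note xu = operator_sum_append[OF that(1,2)]
    show "\<tau> x u w \<in> vectors V"
      unfolding \<tau>_def by (rule is_feedback_closed[OF s xu that(3)])
    assume v: "v \<in> vectors V"
    have "linear_function g ((x @\<^sub>v u) @\<^sub>v v) = (g1 x u v @\<^sub>v g2 x u v) @\<^sub>v g3 x u v"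
      using g_eq[OF that(1,2) v] by (simp add: append_vec_assoc)
    then have "vec_last (linear_function g ((x @\<^sub>v u) @\<^sub>v v)) (length V) = g3 x u v"
      using operator_sum_vec_last_append[OF g_closed(3)[OF that(1,2) v]] by simp
    then show "v = w \<oplus>\<^bsub>operator_sum V\<^esub> g3 x u v \<longleftrightarrow> v = \<tau> x u w"
      using is_feedback_iff[OF s xu that(3) v] by (simp add: \<tau>_def)
  qed
  \<comment> \<open>\<open>T\<close> is built from the solution with \<open>w = 0\<close>, while the
    system over \<open>U @ V\<close> has an arbitrary input on \<open>V\<close>. The difference
    splits off as a term independent of \<open>x\<close> and \<open>u\<close>.\<close>
  have \<tau>_add: "\<tau> x u w = \<tau> x u \<zero>\<^bsub>operator_sum V\<^esub> \<oplus>\<^bsub>operator_sum V\<^esub> \<tau> \<zero>\<^bsub>operator_sum X\<^esub> \<zero>\<^bsub>operator_sum U\<^esub> w"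
    if "x \<in> vectors X" "u \<in> vectors U" "w \<in> vectors V" for x u w
  proof -
    note xu = operator_sum_append[OF that(1,2)]
      and zero = operator_sum_append[OF X.zero_closed U.zero_closed]
    have "((x @\<^sub>v u) @\<^sub>v \<zero>\<^bsub>operator_sum V\<^esub>) \<oplus>\<^bsub>operator_sum ((X @ U) @ V)\<^esub>
        ((\<zero>\<^bsub>operator_sum X\<^esub> @\<^sub>v \<zero>\<^bsub>operator_sum U\<^esub>) @\<^sub>v w) = (x @\<^sub>v u) @\<^sub>v w"
      using that by (simp only: operator_sum_append_add[OF xu V.zero_closed zero that(3)]
        operator_sum_append_add[OF that(1,2) X.zero_closed U.zero_closed] X.r_zero U.r_zero V.l_zero)
    then show ?thesis
      using linear_function_arrow_add[of s "(X @ U) @ V", OF _ _ operator_sum_append[OF xu V.zero_closed]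
          operator_sum_append[OF zero that(3)]] s'
      by (simp add: \<tau>_def)
  qed
  have T_app': "linear_function T (x @\<^sub>v u) =
      g1 x u (\<tau> x u \<zero>\<^bsub>operator_sum V\<^esub>) @\<^sub>v g2 x u (\<tau> x u \<zero>\<^bsub>operator_sum V\<^esub>)"
    if "x \<in> vectors X" "u \<in> vectors U" for x u
  proof -
    note xu = operator_sum_append[OF that]
    note t = \<tau>_closed[OF that V.zero_closed]
    have "linear_function g ((x @\<^sub>v u) @\<^sub>v \<tau> x u \<zero>\<^bsub>operator_sum V\<^esub>) =
        (g1 x u (\<tau> x u \<zero>\<^bsub>operator_sum V\<^esub>) @\<^sub>v g2 x u (\<tau> x u \<zero>\<^bsub>operator_sum V\<^esub>)) @\<^sub>v g3 x u (\<tau> x u \<zero>\<^bsub>operator_sum V\<^esub>)"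
      using g_eq[OF that t] by (simp add: append_vec_assoc)
    then show ?thesis
      unfolding T_app[OF xu] \<tau>_def[symmetric]
      using operator_sum_vec_first_append[OF operator_sum_append[OF g_closed(1,2)[OF that t]]] by simp
  qed
  have T_last: "vec_last (linear_function T (x @\<^sub>v u)) (length U) = g2 x u (\<tau> x u \<zero>\<^bsub>operator_sum V\<^esub>)"
    and T_first: "vec_first (linear_function T (x @\<^sub>v u)) (length Y) = g1 x u (\<tau> x u \<zero>\<^bsub>operator_sum V\<^esub>)"
    if "x \<in> vectors X" "u \<in> vectors U" for x u
    using that by (simp_all add: T_app' operator_sum_vec_last_append operator_sum_vec_first_append g_closed \<tau>_closed)
  \<comment> \<open>Read componentwise, the second equation determines \<open>v\<close> as
    \<open>\<tau> x u q\<close>; this is substituted into the first.\<close>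
  have system_iff: "u @\<^sub>v v = (p @\<^sub>v q) \<oplus>\<^bsub>operator_sum (U @ V)\<^esub>
        vec_last (linear_function g (x @\<^sub>v u @\<^sub>v v)) (length (U @ V)) \<longleftrightarrow>
      u = p \<oplus>\<^bsub>operator_sum U\<^esub> g2 x u (\<tau> x u q) \<and> v = \<tau> x u q"
    if "x \<in> vectors X" "u \<in> vectors U" "v \<in> vectors V"
      "p \<in> vectors U" "q \<in> vectors V" for x u v p q
  proof -
    have "(p @\<^sub>v q) \<oplus>\<^bsub>operator_sum (U @ V)\<^esub> vec_last (linear_function g (x @\<^sub>v u @\<^sub>v v)) (length (U @ V)) =
        (p \<oplus>\<^bsub>operator_sum U\<^esub> g2 x u v) @\<^sub>v (q \<oplus>\<^bsub>operator_sum V\<^esub> g3 x u v)"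
      unfolding g23_def[symmetric] g23_eq[OF that(1-3)]
      by (rule operator_sum_append_add[OF that(4,5) g_closed(2,3)[OF that(1-3)]])
    then have "u @\<^sub>v v = (p @\<^sub>v q) \<oplus>\<^bsub>operator_sum (U @ V)\<^esub>
          vec_last (linear_function g (x @\<^sub>v u @\<^sub>v v)) (length (U @ V)) \<longleftrightarrow>
        u = p \<oplus>\<^bsub>operator_sum U\<^esub> g2 x u v \<and> v = q \<oplus>\<^bsub>operator_sum V\<^esub> g3 x u v"
      using operator_sum_append_eq_iff[OF that(2) U.a_closed[OF that(4) g_closed(2)[OF that(1-3)]]] by simp
    then show ?thesis using \<tau>_iff[OF that(1,2,5,3)] by auto
  qed
  \<comment> \<open>Oriented with \<open>T\<close> on the left, so that values are compared in the
    direction where the solution over \<open>U @ V\<close> is constructed explicitly.\<close>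
  have "cpm_trace U X Y T = cpm_trace (U @ V) X Y g"
  proof (rule cpm_trace_eqI[OF objs(1) obj2(3) objs(3,4) T_hom g_hom])
    fix r assume r: "is_feedback U X T r"
    then have r': "is_cpm_arrow r \<and> source r = X @ U \<and> target r = U" by (simp add: is_feedback_def)
    \<comment> \<open>The effect on \<open>U\<close> of an input \<open>q\<close> on
      \<open>V\<close>: run \<open>q\<close> through the loop on \<open>V\<close>, then pass to
      \<open>U\<close>. In block notation it is \<open>g_UV (I - g_VV)^-1 q\<close>.\<close>
    define \<pi> where "\<pi> q = g2 \<zero>\<^bsub>operator_sum X\<^esub> \<zero>\<^bsub>operator_sum U\<^esub> (\<tau> \<zero>\<^bsub>operator_sum X\<^esub> \<zero>\<^bsub>operator_sum U\<^esub> q)" for q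
    have \<pi>_closed: "\<pi> q \<in> vectors U" if "q \<in> vectors V" for q
      using that by (simp add: \<pi>_def g_closed \<tau>_closed)
    \<comment> \<open>After elimination the equation for \<open>u\<close> is that of
      \<open>T\<close> with input \<open>p\<close> increased by \<open>\<pi> q\<close>, so
      \<open>r\<close> solves it.\<close>
    define \<mu> where "\<mu> x p q = linear_function r (x @\<^sub>v (p \<oplus>\<^bsub>operator_sum U\<^esub> \<pi> q))" for x p q
    have \<mu>_closed: "\<mu> x p q \<in> vectors U"
      and \<mu>_iff: "u \<in> vectors U \<Longrightarrow>
        u = p \<oplus>\<^bsub>operator_sum U\<^esub> g2 x u (\<tau> x u q) \<longleftrightarrow> u = \<mu> x p q"
      if x: "x \<in> vectors X" and p: "p \<in> vectors U" and q: "q \<in> vectors V"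
      for x p q u
    proof -
      have p\<pi>: "p \<oplus>\<^bsub>operator_sum U\<^esub> \<pi> q \<in> vectors U" using p \<pi>_closed[OF q] by simp
      show "\<mu> x p q \<in> vectors U"
        unfolding \<mu>_def by (rule is_feedback_closed[OF r x p\<pi>])
      assume u: "u \<in> vectors U"
      have "g2 x u (\<tau> x u q) = g2 x u (\<tau> x u \<zero>\<^bsub>operator_sum V\<^esub>) \<oplus>\<^bsub>operator_sum U\<^esub> \<pi> q"
        unfolding \<tau>_add[OF x u q] \<pi>_def using x u q by (intro g2_add) (simp_all add: \<tau>_closed)
      then have "p \<oplus>\<^bsub>operator_sum U\<^esub> g2 x u (\<tau> x u q) =
          (p \<oplus>\<^bsub>operator_sum U\<^esub> \<pi> q) \<oplus>\<^bsub>operator_sum U\<^esub> vec_last (linear_function T (x @\<^sub>v u)) (length U)"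
        using x u p q by (simp add: T_last U.a_ac \<pi>_closed g_closed \<tau>_closed)
      then show "u = p \<oplus>\<^bsub>operator_sum U\<^esub> g2 x u (\<tau> x u q) \<longleftrightarrow> u = \<mu> x p q"
        using is_feedback_iff[OF r x p\<pi> u] by (simp add: \<mu>_def)
    qed
    \<comment> \<open>Back substitution: the solution in \<open>U\<close> comes first, then
      \<open>\<tau>\<close> yields the component in \<open>V\<close>.\<close>
    define \<sigma> where "\<sigma> x pq = (let p = vec_first pq (length U); q = vec_last pq (length V); u = \<mu> x p q
      in u @\<^sub>v \<tau> x u q)" for x pq
    have "uv = pq \<oplus>\<^bsub>operator_sum (U @ V)\<^esub> vec_last (linear_function g (x @\<^sub>v uv)) (length (U @ V)) \<longleftrightarrow> uv = \<sigma> x pq"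
      if x: "x \<in> vectors X" and pq: "pq \<in> vectors (U @ V)"
        and uv: "uv \<in> vectors (U @ V)" for x pq uv
    proof -
      define u v p q where "u = vec_first uv (length U)" and "v = vec_last uv (length V)"
        and "p = vec_first pq (length U)" and "q = vec_last pq (length V)"
      note parts = u_def v_def p_def q_def
      have closed: "u \<in> vectors U" "v \<in> vectors V"
        "p \<in> vectors U" "q \<in> vectors V"
        unfolding parts using uv pq by (simp_all add: operator_sum_vec_first operator_sum_vec_last)
      have uv_eq: "uv = u @\<^sub>v v" and pq_eq: "pq = p @\<^sub>v q"
        unfolding parts using uv pq by (simp_all add: operator_sum_append_first_last)
      have "uv = \<sigma> x pq \<longleftrightarrow> u @\<^sub>v v = \<mu> x p q @\<^sub>v \<tau> x (\<mu> x p q) q"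
        by (simp add: \<sigma>_def Let_def flip: uv_eq p_def q_def)
      also have "\<dots> \<longleftrightarrow> u = \<mu> x p q \<and> v = \<tau> x u q"
        using operator_sum_append_eq_iff[OF closed(1) \<mu>_closed[OF x closed(3,4)]] by auto
      finally show ?thesis
        unfolding uv_eq pq_eq
        using system_iff[OF x closed] \<mu>_iff[OF x closed(3,4,1)] by simp
    qed
    moreover have "cpm_computable (X @ U @ V) (U @ V)
        (\<lambda>w. \<sigma> (vec_first w (length X)) (vec_last w (length (U @ V))))"
    proof -
      have id: "cpm_computable (X @ U @ V) (X @ U @ V) (\<lambda>w. w)"
        using objs by (intro cpm_computable_id) (simp add: cpm_objects_append)
      note x = cpm_computable_vec_first[OF objs(3) obj2(3) id]
        and pq = cpm_computable_vec_last[OF objs(3) obj2(3) id]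
      note p = cpm_computable_vec_first[OF objs(1,2) pq] and q = cpm_computable_vec_last[OF objs(1,2) pq]
      have XUV: "X @ U @ V \<in> cpm_objects" using objs by (simp add: cpm_objects_append)
      note zeros = cpm_computable_zero[OF XUV objs(3)] cpm_computable_zero[OF XUV objs(1)]
      have \<tau>: "cpm_computable (X @ U @ V) V (\<lambda>w. \<tau> (a w) (b w) (c w))"
        if "cpm_computable (X @ U @ V) X a" "cpm_computable (X @ U @ V) U b" "cpm_computable (X @ U @ V) V c" for a b c
        unfolding \<tau>_def by (intro cpm_computable_arrow'[OF s'] cpm_computable_append that)
      have g2: "cpm_computable (X @ U @ V) U (\<lambda>w. g2 (a w) (b w) (c w))"
        if "cpm_computable (X @ U @ V) X a" "cpm_computable (X @ U @ V) U b" "cpm_computable (X @ U @ V) V c" for a b c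
        unfolding g2_def g23_def
        by (intro cpm_computable_vec_first[OF objs(1,2)] cpm_computable_vec_last[OF objs(4) obj2(3)]
          cpm_computable_arrow'[OF g'] cpm_computable_append that)
      have \<pi>: "cpm_computable (X @ U @ V) U (\<lambda>w. \<pi> (c w))" if "cpm_computable (X @ U @ V) V c" for c
        unfolding \<pi>_def by (intro g2 \<tau> zeros that)
      note \<mu> = cpm_computable_arrow'[OF r' cpm_computable_append[OF x cpm_computable_add[OF p \<pi>[OF q]]],
        folded \<mu>_def]
      show ?thesis
        unfolding \<sigma>_def Let_def by (intro cpm_computable_append \<mu> \<tau> x q)
    qed
    ultimately have "feedback_solution (U @ V) X g \<sigma>"
      unfolding feedback_solution_def by blast
    moreover have "vec_first (linear_function T (x @\<^sub>v linear_function r (x @\<^sub>v \<zero>\<^bsub>operator_sum U\<^esub>))) (length Y) =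
        vec_first (linear_function g (x @\<^sub>v \<sigma> x \<zero>\<^bsub>operator_sum (U @ V)\<^esub>)) (length Y)"
      if x: "x \<in> vectors X" for x
    proof -
      have s_arrow: "is_cpm_arrow s" "source s = (X @ U) @ V" using s' by auto
      have "\<tau> \<zero>\<^bsub>operator_sum X\<^esub> \<zero>\<^bsub>operator_sum U\<^esub> \<zero>\<^bsub>operator_sum V\<^esub> = \<zero>\<^bsub>operator_sum V\<^esub>"
        using linear_function_arrow_zero[OF s_arrow] s' by (simp add: \<tau>_def operator_sum_append_zero)
      moreover have "g2 \<zero>\<^bsub>operator_sum X\<^esub> \<zero>\<^bsub>operator_sum U\<^esub> \<zero>\<^bsub>operator_sum V\<^esub> = \<zero>\<^bsub>operator_sum U\<^esub>"
      proof -
        have "linear_function g (\<zero>\<^bsub>operator_sum X\<^esub> @\<^sub>v \<zero>\<^bsub>operator_sum U\<^esub> @\<^sub>v \<zero>\<^bsub>operator_sum V\<^esub>) =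
            \<zero>\<^bsub>operator_sum Y\<^esub> @\<^sub>v \<zero>\<^bsub>operator_sum U\<^esub> @\<^sub>v \<zero>\<^bsub>operator_sum V\<^esub>"
          using linear_function_arrow_zero[of g "X @ U @ V"] g' by (simp add: operator_sum_append_zero)
        then show ?thesis
          by (simp add: g2_def g23_def operator_sum_append operator_sum_vec_first_append
            operator_sum_vec_last_append[of _ "U @ V", simplified])
      qed
      \<comment> \<open>Zero input on \<open>V\<close> has no effect on \<open>U\<close>, so the
        modified input of \<open>T\<close> is zero as well.\<close>
      ultimately have \<mu>_zero: "\<mu> x \<zero>\<^bsub>operator_sum U\<^esub> \<zero>\<^bsub>operator_sum V\<^esub> = linear_function r (x @\<^sub>v \<zero>\<^bsub>operator_sum U\<^esub>)"
        by (simp add: \<mu>_def \<pi>_def)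
      define u where "u = linear_function r (x @\<^sub>v \<zero>\<^bsub>operator_sum U\<^esub>)"
      have u: "u \<in> vectors U"
        unfolding u_def by (rule is_feedback_closed[OF r x U.zero_closed])
      have "\<sigma> x \<zero>\<^bsub>operator_sum (U @ V)\<^esub> = u @\<^sub>v \<tau> x u \<zero>\<^bsub>operator_sum V\<^esub>"
        unfolding \<sigma>_def Let_def operator_sum_append_zero[symmetric]
        by (simp add: operator_sum_vec_first_append operator_sum_vec_last_append \<mu>_zero flip: u_def)
      then show ?thesis
        using T_first[OF x u] by (simp add: g1_def flip: u_def)
    qed
    ultimately show "\<exists>\<sigma>. feedback_solution (U @ V) X g \<sigma> \<and> (\<forall>x \<in> vectors X.
        vec_first (linear_function T (x @\<^sub>v linear_function r (x @\<^sub>v \<zero>\<^bsub>operator_sum U\<^esub>))) (length Y) =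
        vec_first (linear_function g (x @\<^sub>v \<sigma> x \<zero>\<^bsub>operator_sum (U @ V)\<^esub>)) (length Y))"
      by blast
  next
    fix r assume r: "is_feedback (U @ V) X g r"
    then have r': "is_cpm_arrow r \<and> source r = X @ U @ V \<and> target r = U @ V" by (simp add: is_feedback_def)
    \<comment> \<open>The \<open>U\<close> part of the joint solution with zero input on
      \<open>V\<close>: in block notation, the \<open>U\<close> block of the whole inverse, which
      inverts the Schur complement.\<close>
    define \<sigma> where "\<sigma> x p = vec_first (linear_function r (x @\<^sub>v p @\<^sub>v \<zero>\<^bsub>operator_sum V\<^esub>)) (length U)" for x p
    have "u = p \<oplus>\<^bsub>operator_sum U\<^esub> vec_last (linear_function T (x @\<^sub>v u)) (length U) \<longleftrightarrow> u = \<sigma> x p"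
      if x: "x \<in> vectors X" and p: "p \<in> vectors U" and u: "u \<in> vectors U"
      for x p u
    proof -
      note p0 = operator_sum_append[OF p V.zero_closed]
      note t = \<tau>_closed[OF x u V.zero_closed]
      define v where "v = vec_last (linear_function r (x @\<^sub>v p @\<^sub>v \<zero>\<^bsub>operator_sum V\<^esub>)) (length V)"
      have rc: "linear_function r (x @\<^sub>v p @\<^sub>v \<zero>\<^bsub>operator_sum V\<^esub>) \<in> vectors (U @ V)"
        by (rule is_feedback_closed[OF r x p0])
      have v: "v \<in> vectors V" and \<sigma>_closed: "\<sigma> x p \<in> vectors U"
        and r_eq: "linear_function r (x @\<^sub>v p @\<^sub>v \<zero>\<^bsub>operator_sum V\<^esub>) = \<sigma> x p @\<^sub>v v"
        unfolding v_def \<sigma>_def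
        by (rule operator_sum_vec_last[OF rc] operator_sum_vec_first[OF rc]
          operator_sum_append_first_last[OF rc, symmetric])+
      have T_eq: "vec_last (linear_function T (x @\<^sub>v u)) (length U) = g2 x u (\<tau> x u \<zero>\<^bsub>operator_sum V\<^esub>)"
        by (rule T_last[OF x u])
      show ?thesis
      proof
        assume "u = p \<oplus>\<^bsub>operator_sum U\<^esub> vec_last (linear_function T (x @\<^sub>v u)) (length U)"
        \<comment> \<open>Completing \<open>u\<close> by \<open>\<tau> x u 0\<close> gives a
          solution of the whole system; its uniqueness identifies the pair with the value of
          \<open>r\<close>.\<close>
        then have "u @\<^sub>v \<tau> x u \<zero>\<^bsub>operator_sum V\<^esub> = \<sigma> x p @\<^sub>v v"
          using system_iff[OF x u t p V.zero_closed] is_feedback_iff[OF r x p0 operator_sum_append[OF u t]]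
          unfolding T_eq r_eq by blast
        then show "u = \<sigma> x p"
          using operator_sum_append_eq_iff[OF u \<sigma>_closed] by simp
      next
        \<comment> \<open>Conversely the value of \<open>r\<close> solves the system, whose second
          equation forces \<open>v = \<tau> x u 0\<close>; what remains is the equation of
          \<open>T\<close>.\<close>
        assume u_eq: "u = \<sigma> x p"
        then have "u @\<^sub>v v = (p @\<^sub>v \<zero>\<^bsub>operator_sum V\<^esub>) \<oplus>\<^bsub>operator_sum (U @ V)\<^esub>
            vec_last (linear_function g (x @\<^sub>v u @\<^sub>v v)) (length (U @ V))"
          using is_feedback_iff[OF r x p0 operator_sum_append[OF u v]] r_eq by simp
        then show "u = p \<oplus>\<^bsub>operator_sum U\<^esub> vec_last (linear_function T (x @\<^sub>v u)) (length U)"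
          using system_iff[OF x u v p V.zero_closed] unfolding T_eq by blast
      qed
    qed
    moreover have "cpm_computable (X @ U) U (\<lambda>w. \<sigma> (vec_first w (length X)) (vec_last w (length U)))"
      unfolding \<sigma>_def
      by (intro cpm_computable_vec_first[of U V] cpm_computable_arrow'[OF r'] cpm_computable_append
        cpm_computable_vec_first[of X U] cpm_computable_vec_last[of X U] cpm_computable_zero
        cpm_computable_id objs obj2)
    ultimately show "\<exists>\<sigma>. feedback_solution U X T \<sigma>"
      unfolding feedback_solution_def by blast
  qed
  then show ?thesis by simp
qed

theorem proposition4p2p15:
  shows "partially_traced_category
    (cpm_objects :: 'a cpm_obj set) cpm_hom cpm_comp cpm_id
    (@) cpm_oplus [] cpm_assoc cpm_lunit cpm_runit cpm_sym
    cpm_trace"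
proof -
  interpret symmetric_monoidal_category "cpm_objects :: 'a cpm_obj set" cpm_hom cpm_comp cpm_id
    "(@)" cpm_oplus "[]" cpm_assoc cpm_lunit cpm_runit cpm_sym
    by (rule cpm_symmetric_monoidal_category)
  \<comment> \<open>Membership in the hom set is tested in \<open>cpm_trace\<close> itself, so a
    defined value already types its argument.\<close>
  have trace_dom: "f \<in> cpm_hom (X @ U) (Y @ U)" if "cpm_trace U X Y f = Some t" for U X Y f t
    using that by (auto simp: cpm_trace_def Let_def split: prod.splits if_splits)
  show ?thesis
  proof
    fix U X Y :: "'a cpm_obj" assume objs: "U \<in> cpm_objects" "X \<in> cpm_objects" "Y \<in> cpm_objects"
    show "dom (cpm_trace U X Y) \<subseteq> cpm_hom (X @ U) (Y @ U) \<and> ran (cpm_trace U X Y) \<subseteq> cpm_hom X Y"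
    proof (intro conjI subsetI)
      fix f assume "f \<in> dom (cpm_trace U X Y)"
      then show "f \<in> cpm_hom (X @ U) (Y @ U)" using trace_dom by (auto simp: dom_def)
    next
      fix t assume "t \<in> ran (cpm_trace U X Y)"
      then obtain f where f: "cpm_trace U X Y f = Some t" by (auto simp: ran_def)
      show "t \<in> cpm_hom X Y" using cpm_trace_eq_Some_iff[OF objs trace_dom[OF f]] f by blast
    qed
  next
    fix U X Y X' Y' :: "'a cpm_obj" and f g h
    assume *: "U \<in> cpm_objects" "X \<in> cpm_objects" "Y \<in> cpm_objects" "X' \<in> cpm_objects" "Y' \<in> cpm_objects"
      "f \<in> cpm_hom (X @ U) (Y @ U)" "g \<in> cpm_hom X' X" "h \<in> cpm_hom Y Y'"
    show "map_option (\<lambda>t. cpm_comp h (cpm_comp t g)) (cpm_trace U X Y f) \<lesssim>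
        cpm_trace U X' Y' (cpm_comp (cpm_oplus h (cpm_id U)) (cpm_comp f (cpm_oplus g (cpm_id U))))"
      using cpm_trace_naturality[OF *] by (cases "cpm_trace U X Y f") (simp_all add: kleene_le_def)
  next
    fix U U' X Y :: "'a cpm_obj" and f g
    assume "U \<in> cpm_objects" "U' \<in> cpm_objects" "X \<in> cpm_objects" "Y \<in> cpm_objects"
      "f \<in> cpm_hom (X @ U) (Y @ U')" "g \<in> cpm_hom U' U"
    then show "cpm_trace U X Y (cpm_comp (cpm_oplus (cpm_id Y) g) f) =
        cpm_trace U' X Y (cpm_comp f (cpm_oplus (cpm_id X) g))"
      by (rule cpm_trace_dinaturality)
  next
    fix X Y :: "'a cpm_obj" and f
    assume "X \<in> cpm_objects" "Y \<in> cpm_objects" "f \<in> cpm_hom (X @ []) (Y @ [])"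
    then show "cpm_trace [] X Y f = Some (cpm_comp (cpm_runit Y) (cpm_comp f (inverse_of (X @ []) X (cpm_runit X))))"
      by (simp add: cpm_trace_vanishing_I cpm_runit_def cpm_inverse_of_id comp_ident_left comp_ident_right)
  next
    fix U V X Y :: "'a cpm_obj" and g
    assume *: "U \<in> cpm_objects" "V \<in> cpm_objects" "X \<in> cpm_objects" "Y \<in> cpm_objects"
      "g \<in> cpm_hom ((X @ U) @ V) ((Y @ U) @ V)" "cpm_trace V (X @ U) (Y @ U) g \<noteq> None"
    then obtain T where T: "cpm_trace V (X @ U) (Y @ U) g = Some T" by blast
    have objs: "X @ U @ V \<in> cpm_objects" "Y @ U @ V \<in> cpm_objects" using * by (simp_all add: cpm_objects_append)
    \<comment> \<open>Both associators are identities, so the axiom concerns \<open>g\<close>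
      itself.\<close>
    have "cpm_comp (cpm_assoc Y U V) (cpm_comp g (inverse_of ((X @ U) @ V) (X @ U @ V) (cpm_assoc X U V))) = g"
      using objs *(5) by (simp add: cpm_assoc_def cpm_inverse_of_id comp_ident_left comp_ident_right)
    then show "cpm_trace (U @ V) X Y
        (cpm_comp (cpm_assoc Y U V) (cpm_comp g (inverse_of ((X @ U) @ V) (X @ U @ V) (cpm_assoc X U V)))) =
        Option.bind (cpm_trace V (X @ U) (Y @ U) g) (cpm_trace U X Y)"
      using cpm_trace_vanishing_II[OF *(1-5) T] T by simp
  next
    fix U X Y W Z :: "'a cpm_obj" and f g
    assume *: "U \<in> cpm_objects" "X \<in> cpm_objects" "Y \<in> cpm_objects" "W \<in> cpm_objects" "Z \<in> cpm_objects"
      "f \<in> cpm_hom (X @ U) (Y @ U)" "g \<in> cpm_hom W Z"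
    have objs: "W @ X @ U \<in> cpm_objects" "Z @ Y @ U \<in> cpm_objects" using * by (simp_all add: cpm_objects_append)
    have gf: "cpm_oplus g f \<in> cpm_hom (W @ X @ U) (Z @ Y @ U)"
      using * by (simp add: cpm_hom_iff cpm_arrow_simps)
    have "cpm_comp (inverse_of ((Z @ Y) @ U) (Z @ Y @ U) (cpm_assoc Z Y U))
        (cpm_comp (cpm_oplus g f) (cpm_assoc W X U)) = cpm_oplus g f"
      using objs gf by (simp add: cpm_assoc_def cpm_inverse_of_id comp_ident_left comp_ident_right)
    then show "map_option (cpm_oplus g) (cpm_trace U X Y f) \<lesssim> cpm_trace U (W @ X) (Z @ Y)
        (cpm_comp (inverse_of ((Z @ Y) @ U) (Z @ Y @ U) (cpm_assoc Z Y U))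
          (cpm_comp (cpm_oplus g f) (cpm_assoc W X U)))"
      using cpm_trace_superposing[OF *] by (cases "cpm_trace U X Y f") (simp_all add: kleene_le_def)
  next
    fix U :: "'a cpm_obj" assume "U \<in> cpm_objects"
    then show "cpm_trace U U U (cpm_sym U U) = Some (cpm_id U)" by (rule cpm_trace_yanking)
  qed
qed

end
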